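(* Let $H$ be a Hopf algebra with bijective antipode $S$ over a field $k$. Let $N$ be a Yetter-Drinfeld module and $M$ an anti-Yetter-Drinfeld module over $H$, both of the same type (left-left, left-right, right-left, or right-right). Then: (i) In the left-left case, $N\otimes M$ is an anti-Yetter-Drinfeld module via $h(n\otimes m)=h^{(1)}n\otimes h^{(2)}m$ and ${}_{N\otimes M}\Delta(n\otimes m)=n^{(-1)}m^{(-1)}\otimes n^{(0)}\otimes m^{(0)}$. (ii) In the left-right case, $N\otimes M$ is an anti-Yetter-Drinfeld module via $h(n\otimes m)=h^{(2)}n\otimes h^{(1)}m$ and $\Delta_{N\otimes M}(n\otimes m)=n^{(0)}\otimes m^{(0)}\otimes n^{(1)}m^{(1)}$. (iii) In the right-left case, $M\otimes N$ is an anti-Yetter-Drinfeld module via $(m\otimes n)h=mh^{(2)}\otimes nh^{(1)}$ and ${}_{M\otimes N}\Delta(m\otimes n)=m^{(-1)}n^{(-1)}\otimes m^{(0)}\otimes n^{(0)}$. (iv) In the right-right case, $M\otimes N$ is an anti-Yetter-Drinfeld module via $(m\otimes n)h=mh^{(1)}\otimes nh^{(2)}$ and $\Delta_{M\otimes N}(m\otimes n)=m^{(0)}\otimes n^{(0)}\otimes m^{(1)}n^{(1)}$.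
   Context: Sumless Sweedler notation: $\Delta(h)=h^{(1)}\otimes h^{(2)}$; left coactions ${}_M\Delta(m)=m^{(-1)}\otimes m^{(0)}\in H\otimes M$; right coactions $\Delta_M(m)=m^{(0)}\otimes m^{(1)}\in M\otimes H$. In "left-right" etc. the first word gives the side of the action and the second the side of the coaction. A module and comodule $M$ over $H$ is an anti-Yetter-Drinfeld module if for all $h\in H$, $m\in M$: left-left: ${}_M\Delta(hm)=h^{(1)}m^{(-1)}S^{-1}(h^{(3)})\otimes h^{(2)}m^{(0)}$; left-right: $\Delta_M(hm)=h^{(2)}m^{(0)}\otimes h^{(3)}m^{(1)}S(h^{(1)})$; right-left: ${}_M\Delta(mh)=S(h^{(3)})m^{(-1)}h^{(1)}\otimes m^{(0)}h^{(2)}$; right-right: $\Delta_M(mh)=m^{(0)}h^{(2)}\otimes S^{-1}(h^{(1)})m^{(1)}h^{(3)}$. Yetter-Drinfeld modules are defined by the same conditions with $S$ and $S^{-1}$ interchanged: left-left: ${}_N\Delta(hn)=h^{(1)}n^{(-1)}S(h^{(3)})\otimes h^{(2)}n^{(0)}$; left-right: $\Delta_N(hn)=h^{(2)}n^{(0)}\otimes h^{(3)}n^{(1)}S^{-1}(h^{(1)})$; right-left: ${}_N\Delta(nh)=S^{-1}(h^{(3)})n^{(-1)}h^{(1)}\otimes n^{(0)}h^{(2)}$; right-right: $\Delta_N(nh)=n^{(0)}h^{(2)}\otimes S(h^{(1)})n^{(1)}h^{(3)}$. *)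

theory Defs
  imports "HOL-Algebra.Module"
begin

section \<open>Tensor products\<close>

text \<open>
  The tensor product of the \<open>K\<close>-modules \<open>A\<close> and \<open>B\<close> is the set of formal sums of pairs
  \<open>(a, b) \<in> carrier A \<times> carrier B\<close>, modulo the least additive congruence making \<open>(a, b)\<close>
  bilinear and balanced in \<open>a\<close> and \<open>b\<close>. A list \<open>[(a\<^sub>1, b\<^sub>1), \<dots>, (a\<^sub>n, b\<^sub>n)]\<close> stands for
  \<open>a\<^sub>1 \<otimes> b\<^sub>1 + \<dots> + a\<^sub>n \<otimes> b\<^sub>n\<close>. Formal negatives are not needed, since \<open>-(a \<otimes> b) = (-a) \<otimes> b\<close>;
  instead, the congruence has to identify \<open>0 \<otimes> b\<close> and \<open>a \<otimes> 0\<close> with the empty sum.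
\<close>

type_synonym ('a, 'b) tens = "('a \<times> 'b) list set"

inductive_set tensor_rel ::
  "'k ring \<Rightarrow> ('k, 'a, 'x) module_scheme \<Rightarrow> ('k, 'b, 'y) module_scheme
    \<Rightarrow> (('a \<times> 'b) list \<times> ('a \<times> 'b) list) set"
  for K :: "'k ring" and A :: "('k, 'a, 'x) module_scheme" and B :: "('k, 'b, 'y) module_scheme"
where
  refl: "xs \<in> lists (carrier A \<times> carrier B) \<Longrightarrow> (xs, xs) \<in> tensor_rel K A B"
| sym: "(xs, ys) \<in> tensor_rel K A B \<Longrightarrow> (ys, xs) \<in> tensor_rel K A B"
| trans: "(xs, ys) \<in> tensor_rel K A B \<Longrightarrow> (ys, zs) \<in> tensor_rel K A B
    \<Longrightarrow> (xs, zs) \<in> tensor_rel K A B"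
| append: "(xs, xs') \<in> tensor_rel K A B \<Longrightarrow> (ys, ys') \<in> tensor_rel K A B
    \<Longrightarrow> (xs @ ys, xs' @ ys') \<in> tensor_rel K A B"
| commute: "xs \<in> lists (carrier A \<times> carrier B) \<Longrightarrow> ys \<in> lists (carrier A \<times> carrier B)
    \<Longrightarrow> (xs @ ys, ys @ xs) \<in> tensor_rel K A B"
| add_left: "a \<in> carrier A \<Longrightarrow> a' \<in> carrier A \<Longrightarrow> b \<in> carrier B
    \<Longrightarrow> ([(a \<oplus>\<^bsub>A\<^esub> a', b)], [(a, b), (a', b)]) \<in> tensor_rel K A B"
| add_right: "a \<in> carrier A \<Longrightarrow> b \<in> carrier B \<Longrightarrow> b' \<in> carrier B
    \<Longrightarrow> ([(a, b \<oplus>\<^bsub>B\<^esub> b')], [(a, b), (a, b')]) \<in> tensor_rel K A B"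
| zero_left: "b \<in> carrier B \<Longrightarrow> ([(\<zero>\<^bsub>A\<^esub>, b)], []) \<in> tensor_rel K A B"
| zero_right: "a \<in> carrier A \<Longrightarrow> ([(a, \<zero>\<^bsub>B\<^esub>)], []) \<in> tensor_rel K A B"
| balanced: "c \<in> carrier K \<Longrightarrow> a \<in> carrier A \<Longrightarrow> b \<in> carrier B
    \<Longrightarrow> ([(c \<odot>\<^bsub>A\<^esub> a, b)], [(a, c \<odot>\<^bsub>B\<^esub> b)]) \<in> tensor_rel K A B"

definition tensor_class ::
  "'k ring \<Rightarrow> ('k, 'a, 'x) module_scheme \<Rightarrow> ('k, 'b, 'y) module_scheme
    \<Rightarrow> ('a \<times> 'b) list \<Rightarrow> ('a, 'b) tens"
  where "tensor_class K A B xs = tensor_rel K A B `` {xs}"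

definition pure_tensor ::
  "'k ring \<Rightarrow> ('k, 'a, 'x) module_scheme \<Rightarrow> ('k, 'b, 'y) module_scheme
    \<Rightarrow> 'a \<Rightarrow> 'b \<Rightarrow> ('a, 'b) tens"
  where "pure_tensor K A B a b = tensor_class K A B [(a, b)]"

definition tensor_rep :: "('a, 'b) tens \<Rightarrow> ('a \<times> 'b) list"
  where "tensor_rep t = (SOME xs. xs \<in> t)"

text \<open>
  The multiplicative components are those of the tensor product of algebras,
  \<open>(a \<otimes> b) (a' \<otimes> b') = a a' \<otimes> b b'\<close>. They are meaningful only if \<open>A\<close> and \<open>B\<close> are algebras
  and play no role if \<open>A\<close> and \<open>B\<close> are used merely as vector spaces.
\<close>

definition tensor ::
  "'k ring \<Rightarrow> ('k, 'a, 'x) module_scheme \<Rightarrow> ('k, 'b, 'y) module_scheme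
    \<Rightarrow> ('k, ('a, 'b) tens) module"
  where "tensor K A B =
    \<lparr> carrier = lists (carrier A \<times> carrier B) // tensor_rel K A B,
      monoid.mult = (\<lambda>s t. tensor_class K A B
        [(fst x \<otimes>\<^bsub>A\<^esub> fst y, snd x \<otimes>\<^bsub>B\<^esub> snd y). x \<leftarrow> tensor_rep s, y \<leftarrow> tensor_rep t]),
      one = pure_tensor K A B \<one>\<^bsub>A\<^esub> \<one>\<^bsub>B\<^esub>,
      ring.zero = tensor_class K A B [],
      add = (\<lambda>s t. tensor_class K A B (tensor_rep s @ tensor_rep t)),
      smult = (\<lambda>c t. tensor_class K A B (map (\<lambda>(a, b). (c \<odot>\<^bsub>A\<^esub> a, b)) (tensor_rep t))) \<rparr>"

text \<open>
  \<open>sweedler W t f\<close> is the value at \<open>t\<close> of the linear map into \<open>W\<close> induced by a bilinear \<open>f\<close>: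
  if \<open>t = \<Sum> a\<^sub>i \<otimes> b\<^sub>i\<close>, then it is \<open>\<Sum> f a\<^sub>i b\<^sub>i\<close>, computed in \<open>W\<close>; for bilinear \<open>f\<close> this does
  not depend on how \<open>t\<close> is written as a sum. Thus \<open>sweedler W (comult H h) (\<lambda>h1 h2. f h1 h2)\<close>
  is \<open>f(h\<^sup>(\<^sup>1\<^sup>), h\<^sup>(\<^sup>2\<^sup>))\<close> in sumless Sweedler notation.
\<close>

definition sweedler ::
  "('w, 'z) ring_scheme \<Rightarrow> ('a, 'b) tens \<Rightarrow> ('a \<Rightarrow> 'b \<Rightarrow> 'w) \<Rightarrow> 'w"
  where "sweedler W t f = foldr (\<lambda>(a, b) w. f a b \<oplus>\<^bsub>W\<^esub> w) (tensor_rep t) \<zero>\<^bsub>W\<^esub>"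

definition linear_map ::
  "'k ring \<Rightarrow> ('k, 'a, 'x) module_scheme \<Rightarrow> ('k, 'b, 'y) module_scheme \<Rightarrow> ('a \<Rightarrow> 'b) \<Rightarrow> bool"
  where "linear_map K A B f \<longleftrightarrow>
    f \<in> carrier A \<rightarrow> carrier B \<and>
    (\<forall>x\<in>carrier A. \<forall>y\<in>carrier A. f (x \<oplus>\<^bsub>A\<^esub> y) = f x \<oplus>\<^bsub>B\<^esub> f y) \<and>
    (\<forall>c\<in>carrier K. \<forall>x\<in>carrier A. f (c \<odot>\<^bsub>A\<^esub> x) = c \<odot>\<^bsub>B\<^esub> f x)"


section \<open>Hopf algebras\<close>

record ('k, 'h) hopf = "('k, 'h) module" +
  comult :: "'h \<Rightarrow> ('h, 'h) tens"
  counit :: "'h \<Rightarrow> 'k"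
  antipode :: "'h \<Rightarrow> 'h"

text \<open>The library locale \<^locale>\<open>algebra\<close> is restricted to commutative algebras.\<close>

locale unital_algebra = field K + module K H + ring H
  for K :: "'k ring" and H :: "('k, 'h) hopf" +
  assumes smult_mult_left: "\<lbrakk>c \<in> carrier K; x \<in> carrier H; y \<in> carrier H\<rbrakk> \<Longrightarrow>
      (c \<odot>\<^bsub>H\<^esub> x) \<otimes>\<^bsub>H\<^esub> y = c \<odot>\<^bsub>H\<^esub> (x \<otimes>\<^bsub>H\<^esub> y)"
    and smult_mult_right: "\<lbrakk>c \<in> carrier K; x \<in> carrier H; y \<in> carrier H\<rbrakk> \<Longrightarrow>
      x \<otimes>\<^bsub>H\<^esub> (c \<odot>\<^bsub>H\<^esub> y) = c \<odot>\<^bsub>H\<^esub> (x \<otimes>\<^bsub>H\<^esub> y)"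

text \<open>Iterated tensor products are bracketed to the right: \<open>H \<otimes> (H \<otimes> H)\<close>.\<close>

locale coalgebra = field K + module K H
  for K :: "'k ring" and H :: "('k, 'h) hopf" +
  assumes comult_linear: "linear_map K H (tensor K H H) (comult H)"
    and counit_closed: "h \<in> carrier H \<Longrightarrow> counit H h \<in> carrier K"
    and counit_add: "\<lbrakk>h \<in> carrier H; g \<in> carrier H\<rbrakk> \<Longrightarrow>
      counit H (h \<oplus>\<^bsub>H\<^esub> g) = counit H h \<oplus>\<^bsub>K\<^esub> counit H g"
    and counit_smult: "\<lbrakk>c \<in> carrier K; h \<in> carrier H\<rbrakk> \<Longrightarrow>
      counit H (c \<odot>\<^bsub>H\<^esub> h) = c \<otimes>\<^bsub>K\<^esub> counit H h"
    and coassoc: "h \<in> carrier H \<Longrightarrow>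
      sweedler (tensor K H (tensor K H H)) (comult H h) (\<lambda>x h3.
        sweedler (tensor K H (tensor K H H)) (comult H x) (\<lambda>h1 h2.
          pure_tensor K H (tensor K H H) h1 (pure_tensor K H H h2 h3)))
      = sweedler (tensor K H (tensor K H H)) (comult H h) (\<lambda>h1 x.
          pure_tensor K H (tensor K H H) h1 (comult H x))"
    and counit_left: "h \<in> carrier H \<Longrightarrow>
      sweedler H (comult H h) (\<lambda>h1 h2. counit H h1 \<odot>\<^bsub>H\<^esub> h2) = h"
    and counit_right: "h \<in> carrier H \<Longrightarrow>
      sweedler H (comult H h) (\<lambda>h1 h2. counit H h2 \<odot>\<^bsub>H\<^esub> h1) = h"

locale hopf_algebra = unital_algebra K H + coalgebra K H
  for K :: "'k ring" and H :: "('k, 'h) hopf" +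
  assumes comult_hom: "comult H \<in> ring_hom H (tensor K H H)"
    and counit_hom: "counit H \<in> ring_hom H K"
    and antipode_linear: "linear_map K H H (antipode H)"
    and antipode_left: "h \<in> carrier H \<Longrightarrow>
      sweedler H (comult H h) (\<lambda>h1 h2. antipode H h1 \<otimes>\<^bsub>H\<^esub> h2) = counit H h \<odot>\<^bsub>H\<^esub> \<one>\<^bsub>H\<^esub>"
    and antipode_right: "h \<in> carrier H \<Longrightarrow>
      sweedler H (comult H h) (\<lambda>h1 h2. h1 \<otimes>\<^bsub>H\<^esub> antipode H h2) = counit H h \<odot>\<^bsub>H\<^esub> \<one>\<^bsub>H\<^esub>"

definition antipode_inv :: "('k, 'h) hopf \<Rightarrow> 'h \<Rightarrow> 'h"
  where "antipode_inv H = inv_into (carrier H) (antipode H)"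

text \<open>The value \<open>f(h\<^sup>(\<^sup>1\<^sup>), h\<^sup>(\<^sup>2\<^sup>), h\<^sup>(\<^sup>3\<^sup>))\<close> of a trilinear map \<open>f\<close> into \<open>W\<close>.\<close>

definition sweedler3 ::
  "('k, 'h) hopf \<Rightarrow> ('w, 'z) ring_scheme \<Rightarrow> 'h \<Rightarrow> ('h \<Rightarrow> 'h \<Rightarrow> 'h \<Rightarrow> 'w) \<Rightarrow> 'w"
  where "sweedler3 H W h f =
    sweedler W (comult H h) (\<lambda>h1 x. sweedler W (comult H x) (\<lambda>h2 h3. f h1 h2 h3))"


section \<open>Modules and comodules\<close>

locale left_module = unital_algebra K H + M: module K M
  for K :: "'k ring" and H :: "('k, 'h) hopf" and M :: "('k, 'm) module"
    and act :: "'h \<Rightarrow> 'm \<Rightarrow> 'm" +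
  assumes act_linear_right: "h \<in> carrier H \<Longrightarrow> linear_map K M M (\<lambda>m. act h m)"
    and act_linear_left: "m \<in> carrier M \<Longrightarrow> linear_map K H M (\<lambda>h. act h m)"
    and act_one: "m \<in> carrier M \<Longrightarrow> act \<one>\<^bsub>H\<^esub> m = m"
    and act_mult: "\<lbrakk>g \<in> carrier H; h \<in> carrier H; m \<in> carrier M\<rbrakk> \<Longrightarrow>
      act (g \<otimes>\<^bsub>H\<^esub> h) m = act g (act h m)"

locale right_module = unital_algebra K H + M: module K M
  for K :: "'k ring" and H :: "('k, 'h) hopf" and M :: "('k, 'm) module"
    and act :: "'m \<Rightarrow> 'h \<Rightarrow> 'm" +
  assumes act_linear_left: "h \<in> carrier H \<Longrightarrow> linear_map K M M (\<lambda>m. act m h)"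
    and act_linear_right: "m \<in> carrier M \<Longrightarrow> linear_map K H M (\<lambda>h. act m h)"
    and act_one: "m \<in> carrier M \<Longrightarrow> act m \<one>\<^bsub>H\<^esub> = m"
    and act_mult: "\<lbrakk>g \<in> carrier H; h \<in> carrier H; m \<in> carrier M\<rbrakk> \<Longrightarrow>
      act m (g \<otimes>\<^bsub>H\<^esub> h) = act (act m g) h"

locale left_comodule = coalgebra K H + M: module K M
  for K :: "'k ring" and H :: "('k, 'h) hopf" and M :: "('k, 'm) module"
    and coact :: "'m \<Rightarrow> ('h, 'm) tens" +
  assumes coact_linear: "linear_map K M (tensor K H M) coact"
    and coact_coassoc: "m \<in> carrier M \<Longrightarrow>
      sweedler (tensor K H (tensor K H M)) (coact m) (\<lambda>x m0.
        sweedler (tensor K H (tensor K H M)) (comult H x) (\<lambda>h1 h2.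
          pure_tensor K H (tensor K H M) h1 (pure_tensor K H M h2 m0)))
      = sweedler (tensor K H (tensor K H M)) (coact m) (\<lambda>h1 x.
          pure_tensor K H (tensor K H M) h1 (coact x))"
    and coact_counit: "m \<in> carrier M \<Longrightarrow>
      sweedler M (coact m) (\<lambda>h m0. counit H h \<odot>\<^bsub>M\<^esub> m0) = m"

locale right_comodule = coalgebra K H + M: module K M
  for K :: "'k ring" and H :: "('k, 'h) hopf" and M :: "('k, 'm) module"
    and coact :: "'m \<Rightarrow> ('m, 'h) tens" +
  assumes coact_linear: "linear_map K M (tensor K M H) coact"
    and coact_coassoc: "m \<in> carrier M \<Longrightarrow>
      sweedler (tensor K M (tensor K H H)) (coact m) (\<lambda>x h2.
        sweedler (tensor K M (tensor K H H)) (coact x) (\<lambda>m0 h1.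
          pure_tensor K M (tensor K H H) m0 (pure_tensor K H H h1 h2)))
      = sweedler (tensor K M (tensor K H H)) (coact m) (\<lambda>m0 x.
          pure_tensor K M (tensor K H H) m0 (comult H x))"
    and coact_counit: "m \<in> carrier M \<Longrightarrow>
      sweedler M (coact m) (\<lambda>m0 h. counit H h \<odot>\<^bsub>M\<^esub> m0) = m"


section \<open>Yetter-Drinfeld and anti-Yetter-Drinfeld modules\<close>

text \<open>
  The first word is the side of the action, the second the side of the coaction. In the bound
  variables, \<open>m1'\<close> stands for \<open>m\<^sup>(\<^sup>-\<^sup>1\<^sup>)\<close> (left coactions) and \<open>m1\<close> for \<open>m\<^sup>(\<^sup>1\<^sup>)\<close> (right coactions).
\<close>

locale YD_left_left = hopf_algebra K H + left_module K H N act + left_comodule K H N coact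
  for K :: "'k ring" and H :: "('k, 'h) hopf" and N :: "('k, 'n) module"
    and act :: "'h \<Rightarrow> 'n \<Rightarrow> 'n" and coact :: "'n \<Rightarrow> ('h, 'n) tens" +
  assumes YD: "\<lbrakk>h \<in> carrier H; n \<in> carrier N\<rbrakk> \<Longrightarrow>
    coact (act h n) =
      sweedler3 H (tensor K H N) h (\<lambda>h1 h2 h3.
        sweedler (tensor K H N) (coact n) (\<lambda>n1' n0.
          pure_tensor K H N (h1 \<otimes>\<^bsub>H\<^esub> n1' \<otimes>\<^bsub>H\<^esub> antipode H h3) (act h2 n0)))"

locale YD_left_right = hopf_algebra K H + left_module K H N act + right_comodule K H N coact
  for K :: "'k ring" and H :: "('k, 'h) hopf" and N :: "('k, 'n) module"
    and act :: "'h \<Rightarrow> 'n \<Rightarrow> 'n" and coact :: "'n \<Rightarrow> ('n, 'h) tens" +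
  assumes YD: "\<lbrakk>h \<in> carrier H; n \<in> carrier N\<rbrakk> \<Longrightarrow>
    coact (act h n) =
      sweedler3 H (tensor K N H) h (\<lambda>h1 h2 h3.
        sweedler (tensor K N H) (coact n) (\<lambda>n0 n1.
          pure_tensor K N H (act h2 n0) (h3 \<otimes>\<^bsub>H\<^esub> n1 \<otimes>\<^bsub>H\<^esub> antipode_inv H h1)))"

locale YD_right_left = hopf_algebra K H + right_module K H N act + left_comodule K H N coact
  for K :: "'k ring" and H :: "('k, 'h) hopf" and N :: "('k, 'n) module"
    and act :: "'n \<Rightarrow> 'h \<Rightarrow> 'n" and coact :: "'n \<Rightarrow> ('h, 'n) tens" +
  assumes YD: "\<lbrakk>h \<in> carrier H; n \<in> carrier N\<rbrakk> \<Longrightarrow>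
    coact (act n h) =
      sweedler3 H (tensor K H N) h (\<lambda>h1 h2 h3.
        sweedler (tensor K H N) (coact n) (\<lambda>n1' n0.
          pure_tensor K H N (antipode_inv H h3 \<otimes>\<^bsub>H\<^esub> n1' \<otimes>\<^bsub>H\<^esub> h1) (act n0 h2)))"

locale YD_right_right = hopf_algebra K H + right_module K H N act + right_comodule K H N coact
  for K :: "'k ring" and H :: "('k, 'h) hopf" and N :: "('k, 'n) module"
    and act :: "'n \<Rightarrow> 'h \<Rightarrow> 'n" and coact :: "'n \<Rightarrow> ('n, 'h) tens" +
  assumes YD: "\<lbrakk>h \<in> carrier H; n \<in> carrier N\<rbrakk> \<Longrightarrow>
    coact (act n h) =
      sweedler3 H (tensor K N H) h (\<lambda>h1 h2 h3.
        sweedler (tensor K N H) (coact n) (\<lambda>n0 n1.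
          pure_tensor K N H (act n0 h2) (antipode H h1 \<otimes>\<^bsub>H\<^esub> n1 \<otimes>\<^bsub>H\<^esub> h3)))"

locale aYD_left_left = hopf_algebra K H + left_module K H M act + left_comodule K H M coact
  for K :: "'k ring" and H :: "('k, 'h) hopf" and M :: "('k, 'm) module"
    and act :: "'h \<Rightarrow> 'm \<Rightarrow> 'm" and coact :: "'m \<Rightarrow> ('h, 'm) tens" +
  assumes aYD: "\<lbrakk>h \<in> carrier H; m \<in> carrier M\<rbrakk> \<Longrightarrow>
    coact (act h m) =
      sweedler3 H (tensor K H M) h (\<lambda>h1 h2 h3.
        sweedler (tensor K H M) (coact m) (\<lambda>m1' m0.
          pure_tensor K H M (h1 \<otimes>\<^bsub>H\<^esub> m1' \<otimes>\<^bsub>H\<^esub> antipode_inv H h3) (act h2 m0)))"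

locale aYD_left_right = hopf_algebra K H + left_module K H M act + right_comodule K H M coact
  for K :: "'k ring" and H :: "('k, 'h) hopf" and M :: "('k, 'm) module"
    and act :: "'h \<Rightarrow> 'm \<Rightarrow> 'm" and coact :: "'m \<Rightarrow> ('m, 'h) tens" +
  assumes aYD: "\<lbrakk>h \<in> carrier H; m \<in> carrier M\<rbrakk> \<Longrightarrow>
    coact (act h m) =
      sweedler3 H (tensor K M H) h (\<lambda>h1 h2 h3.
        sweedler (tensor K M H) (coact m) (\<lambda>m0 m1.
          pure_tensor K M H (act h2 m0) (h3 \<otimes>\<^bsub>H\<^esub> m1 \<otimes>\<^bsub>H\<^esub> antipode H h1)))"

locale aYD_right_left = hopf_algebra K H + right_module K H M act + left_comodule K H M coact
  for K :: "'k ring" and H :: "('k, 'h) hopf" and M :: "('k, 'm) module"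
    and act :: "'m \<Rightarrow> 'h \<Rightarrow> 'm" and coact :: "'m \<Rightarrow> ('h, 'm) tens" +
  assumes aYD: "\<lbrakk>h \<in> carrier H; m \<in> carrier M\<rbrakk> \<Longrightarrow>
    coact (act m h) =
      sweedler3 H (tensor K H M) h (\<lambda>h1 h2 h3.
        sweedler (tensor K H M) (coact m) (\<lambda>m1' m0.
          pure_tensor K H M (antipode H h3 \<otimes>\<^bsub>H\<^esub> m1' \<otimes>\<^bsub>H\<^esub> h1) (act m0 h2)))"

locale aYD_right_right = hopf_algebra K H + right_module K H M act + right_comodule K H M coact
  for K :: "'k ring" and H :: "('k, 'h) hopf" and M :: "('k, 'm) module"
    and act :: "'m \<Rightarrow> 'h \<Rightarrow> 'm" and coact :: "'m \<Rightarrow> ('m, 'h) tens" +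
  assumes aYD: "\<lbrakk>h \<in> carrier H; m \<in> carrier M\<rbrakk> \<Longrightarrow>
    coact (act m h) =
      sweedler3 H (tensor K M H) h (\<lambda>h1 h2 h3.
        sweedler (tensor K M H) (coact m) (\<lambda>m0 m1.
          pure_tensor K M H (act m0 h2) (antipode_inv H h1 \<otimes>\<^bsub>H\<^esub> m1 \<otimes>\<^bsub>H\<^esub> h3)))"


section \<open>Actions and coactions on tensor products\<close>

text \<open>
  The suffix \<open>_swap\<close> marks the use of the opposite comultiplication:
  \<open>h (x \<otimes> y) = h\<^sup>(\<^sup>2\<^sup>) x \<otimes> h\<^sup>(\<^sup>1\<^sup>) y\<close> and \<open>(x \<otimes> y) h = x h\<^sup>(\<^sup>2\<^sup>) \<otimes> y h\<^sup>(\<^sup>1\<^sup>)\<close>.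
  The coactions multiply the \<open>H\<close>-components in the order of the tensor factors.
\<close>

definition tensor_left_act ::
  "'k ring \<Rightarrow> ('k, 'h) hopf \<Rightarrow> ('k, 'a) module \<Rightarrow> ('k, 'b) module
    \<Rightarrow> ('h \<Rightarrow> 'a \<Rightarrow> 'a) \<Rightarrow> ('h \<Rightarrow> 'b \<Rightarrow> 'b) \<Rightarrow> 'h \<Rightarrow> ('a, 'b) tens \<Rightarrow> ('a, 'b) tens"
  where "tensor_left_act K H A B actA actB h t =
    sweedler (tensor K A B) (comult H h) (\<lambda>h1 h2. sweedler (tensor K A B) t (\<lambda>x y.
      pure_tensor K A B (actA h1 x) (actB h2 y)))"

definition tensor_left_act_swap ::
  "'k ring \<Rightarrow> ('k, 'h) hopf \<Rightarrow> ('k, 'a) module \<Rightarrow> ('k, 'b) module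
    \<Rightarrow> ('h \<Rightarrow> 'a \<Rightarrow> 'a) \<Rightarrow> ('h \<Rightarrow> 'b \<Rightarrow> 'b) \<Rightarrow> 'h \<Rightarrow> ('a, 'b) tens \<Rightarrow> ('a, 'b) tens"
  where "tensor_left_act_swap K H A B actA actB h t =
    sweedler (tensor K A B) (comult H h) (\<lambda>h1 h2. sweedler (tensor K A B) t (\<lambda>x y.
      pure_tensor K A B (actA h2 x) (actB h1 y)))"

definition tensor_right_act ::
  "'k ring \<Rightarrow> ('k, 'h) hopf \<Rightarrow> ('k, 'a) module \<Rightarrow> ('k, 'b) module
    \<Rightarrow> ('a \<Rightarrow> 'h \<Rightarrow> 'a) \<Rightarrow> ('b \<Rightarrow> 'h \<Rightarrow> 'b) \<Rightarrow> ('a, 'b) tens \<Rightarrow> 'h \<Rightarrow> ('a, 'b) tens"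
  where "tensor_right_act K H A B actA actB t h =
    sweedler (tensor K A B) (comult H h) (\<lambda>h1 h2. sweedler (tensor K A B) t (\<lambda>x y.
      pure_tensor K A B (actA x h1) (actB y h2)))"

definition tensor_right_act_swap ::
  "'k ring \<Rightarrow> ('k, 'h) hopf \<Rightarrow> ('k, 'a) module \<Rightarrow> ('k, 'b) module
    \<Rightarrow> ('a \<Rightarrow> 'h \<Rightarrow> 'a) \<Rightarrow> ('b \<Rightarrow> 'h \<Rightarrow> 'b) \<Rightarrow> ('a, 'b) tens \<Rightarrow> 'h \<Rightarrow> ('a, 'b) tens"
  where "tensor_right_act_swap K H A B actA actB t h =
    sweedler (tensor K A B) (comult H h) (\<lambda>h1 h2. sweedler (tensor K A B) t (\<lambda>x y.
      pure_tensor K A B (actA x h2) (actB y h1)))"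

definition tensor_left_coact ::
  "'k ring \<Rightarrow> ('k, 'h) hopf \<Rightarrow> ('k, 'a) module \<Rightarrow> ('k, 'b) module
    \<Rightarrow> ('a \<Rightarrow> ('h, 'a) tens) \<Rightarrow> ('b \<Rightarrow> ('h, 'b) tens) \<Rightarrow> ('a, 'b) tens \<Rightarrow> ('h, ('a, 'b) tens) tens"
  where "tensor_left_coact K H A B coactA coactB t =
    sweedler (tensor K H (tensor K A B)) t (\<lambda>x y.
      sweedler (tensor K H (tensor K A B)) (coactA x) (\<lambda>x1' x0.
        sweedler (tensor K H (tensor K A B)) (coactB y) (\<lambda>y1' y0.
          pure_tensor K H (tensor K A B) (x1' \<otimes>\<^bsub>H\<^esub> y1') (pure_tensor K A B x0 y0))))"

definition tensor_right_coact ::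
  "'k ring \<Rightarrow> ('k, 'h) hopf \<Rightarrow> ('k, 'a) module \<Rightarrow> ('k, 'b) module
    \<Rightarrow> ('a \<Rightarrow> ('a, 'h) tens) \<Rightarrow> ('b \<Rightarrow> ('b, 'h) tens) \<Rightarrow> ('a, 'b) tens \<Rightarrow> (('a, 'b) tens, 'h) tens"
  where "tensor_right_coact K H A B coactA coactB t =
    sweedler (tensor K (tensor K A B) H) t (\<lambda>x y.
      sweedler (tensor K (tensor K A B) H) (coactA x) (\<lambda>x0 x1.
        sweedler (tensor K (tensor K A B) H) (coactB y) (\<lambda>y0 y1.
          pure_tensor K (tensor K A B) H (pure_tensor K A B x0 y0) (x1 \<otimes>\<^bsub>H\<^esub> y1))))"

end

theory Submission
  imports Defs
begin

text \<open>
  All conditions are linear in the element of the tensor product, so they are checked on pure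
  tensors. There the compatibility of the left-left case reads
  \<open>h\<^sup>(\<^sup>1\<^sup>) n\<^sup>(\<^sup>-\<^sup>1\<^sup>) S(h\<^sup>(\<^sup>3\<^sup>)) h\<^sup>(\<^sup>4\<^sup>) m\<^sup>(\<^sup>-\<^sup>1\<^sup>) S\<^sup>-\<^sup>1(h\<^sup>(\<^sup>6\<^sup>)) \<otimes> h\<^sup>(\<^sup>2\<^sup>) n\<^sup>(\<^sup>0\<^sup>) \<otimes> h\<^sup>(\<^sup>5\<^sup>) m\<^sup>(\<^sup>0\<^sup>)
    = h\<^sup>(\<^sup>1\<^sup>) n\<^sup>(\<^sup>-\<^sup>1\<^sup>) m\<^sup>(\<^sup>-\<^sup>1\<^sup>) S\<^sup>-\<^sup>1(h\<^sup>(\<^sup>4\<^sup>)) \<otimes> h\<^sup>(\<^sup>2\<^sup>) n\<^sup>(\<^sup>0\<^sup>) \<otimes> h\<^sup>(\<^sup>3\<^sup>) m\<^sup>(\<^sup>0\<^sup>)\<close>,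
  which is the cancellation of the inner factors \<open>S(h\<^sup>(\<^sup>3\<^sup>)) h\<^sup>(\<^sup>4\<^sup>)\<close>. The other three types
  differ only in what cancels: \<open>S\<^sup>-\<^sup>1(h\<^sup>(\<^sup>4\<^sup>)) h\<^sup>(\<^sup>3\<^sup>)\<close>, \<open>h\<^sup>(\<^sup>4\<^sup>) S\<^sup>-\<^sup>1(h\<^sup>(\<^sup>3\<^sup>))\<close> and
  \<open>h\<^sup>(\<^sup>3\<^sup>) S(h\<^sup>(\<^sup>4\<^sup>))\<close>. The two laws for \<open>S\<^sup>-\<^sup>1\<close> follow from those for \<open>S\<close> because
  \<open>S\<close> is an antihomomorphism.
\<close>

section \<open>Linear and bilinear maps\<close>

text \<open>The obstacle is that a tensor is a class of lists and \<open>sweedler\<close> sums over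
  one list taken from it by Hilbert choice. Only a bilinear summand makes the value independent of
  that list, so every regrouping inside a nested sum carries linearity or closure conditions in each
  variable. The rules \<open>multilinear\<close> are shaped so that these conditions are solved by
  resolution, which leaves the proofs as chains of Sweedler rewriting. The order of the tensor
  factors and the choice between \<Delta> and its opposite are matched to the cancellation: they put
  the antipode leg of the Yetter-Drinfeld factor N directly beside the neighbouring leg of h that
  comes from M. The antipode leg of M stays at the outer end, which is why the product satisfies the
  anti-Yetter-Drinfeld condition. The two middle legs that remain act on one tensor factor each;
  together they are the action of the middle leg of h on the product.\<close>

lemma linear_mapI:
  assumes "\<And>x. x \<in> carrier A \<Longrightarrow> f x \<in> carrier B"
    and "\<And>x y. \<lbrakk>x \<in> carrier A; y \<in> carrier A\<rbrakk> \<Longrightarrow> f (x \<oplus>\<^bsub>A\<^esub> y) = f x \<oplus>\<^bsub>B\<^esub> f y"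
    and "\<And>c x. \<lbrakk>c \<in> carrier K; x \<in> carrier A\<rbrakk> \<Longrightarrow> f (c \<odot>\<^bsub>A\<^esub> x) = c \<odot>\<^bsub>B\<^esub> f x"
  shows "linear_map K A B f"
  using assms by (simp add: linear_map_def)

lemma linear_map_closed: "\<lbrakk>linear_map K A B f; x \<in> carrier A\<rbrakk> \<Longrightarrow> f x \<in> carrier B"
  by (auto simp: linear_map_def)

lemma linear_map_add:
  "\<lbrakk>linear_map K A B f; x \<in> carrier A; y \<in> carrier A\<rbrakk> \<Longrightarrow> f (x \<oplus>\<^bsub>A\<^esub> y) = f x \<oplus>\<^bsub>B\<^esub> f y"
  by (simp add: linear_map_def)

lemma linear_map_smult:
  "\<lbrakk>linear_map K A B f; c \<in> carrier K; x \<in> carrier A\<rbrakk> \<Longrightarrow> f (c \<odot>\<^bsub>A\<^esub> x) = c \<odot>\<^bsub>B\<^esub> f x"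
  by (simp add: linear_map_def)

lemma linear_map_compose:
  assumes "linear_map K A B f" "linear_map K B C g"
  shows "linear_map K A C (\<lambda>x. g (f x))"
  using assms by (auto simp: linear_map_def Pi_iff)

lemma linear_map_zero:
  assumes "module K A" "module K B" "linear_map K A B f"
  shows "f \<zero>\<^bsub>A\<^esub> = \<zero>\<^bsub>B\<^esub>"
proof -
  interpret A: module K A by fact
  interpret B: module K B by fact
  have "f (\<zero>\<^bsub>K\<^esub> \<odot>\<^bsub>A\<^esub> \<zero>\<^bsub>A\<^esub>) = \<zero>\<^bsub>K\<^esub> \<odot>\<^bsub>B\<^esub> f \<zero>\<^bsub>A\<^esub>"
    by (rule linear_map_smult[OF assms(3)]) auto
  then show ?thesis using linear_map_closed[OF assms(3)] by simp
qed

definition bilinear_map ::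
  "'k ring \<Rightarrow> ('k, 'a, 'x) module_scheme \<Rightarrow> ('k, 'b, 'y) module_scheme
    \<Rightarrow> ('k, 'w, 'z) module_scheme \<Rightarrow> ('a \<Rightarrow> 'b \<Rightarrow> 'w) \<Rightarrow> bool"
  where "bilinear_map K A B W F \<longleftrightarrow>
    (\<forall>b\<in>carrier B. linear_map K A W (\<lambda>a. F a b)) \<and>
    (\<forall>a\<in>carrier A. linear_map K B W (\<lambda>b. F a b))"

lemma bilinear_mapI:
  assumes "\<And>b. b \<in> carrier B \<Longrightarrow> linear_map K A W (\<lambda>a. F a b)"
    and "\<And>a. a \<in> carrier A \<Longrightarrow> linear_map K B W (\<lambda>b. F a b)"
  shows "bilinear_map K A B W F"
  using assms by (simp add: bilinear_map_def)

lemma bilinear_mapD: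
  assumes "bilinear_map K A B W F"
  shows "b \<in> carrier B \<Longrightarrow> linear_map K A W (\<lambda>a. F a b)"
    and "a \<in> carrier A \<Longrightarrow> linear_map K B W (\<lambda>b. F a b)"
  using assms by (auto simp: bilinear_map_def)

lemma bilinear_map_closed:
  "\<lbrakk>bilinear_map K A B W F; a \<in> carrier A; b \<in> carrier B\<rbrakk> \<Longrightarrow> F a b \<in> carrier W"
  by (blast dest: bilinear_mapD linear_map_closed)

definition trilinear_map ::
  "'k ring \<Rightarrow> ('k, 'a, 'x) module_scheme \<Rightarrow> ('k, 'b, 'y) module_scheme
    \<Rightarrow> ('k, 'c, 'u) module_scheme \<Rightarrow> ('k, 'w, 'z) module_scheme
    \<Rightarrow> ('a \<Rightarrow> 'b \<Rightarrow> 'c \<Rightarrow> 'w) \<Rightarrow> bool"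
  where "trilinear_map K A B C W F \<longleftrightarrow>
    (\<forall>b\<in>carrier B. \<forall>c\<in>carrier C. linear_map K A W (\<lambda>a. F a b c)) \<and>
    (\<forall>a\<in>carrier A. bilinear_map K B C W (F a))"

lemma trilinear_mapI:
  assumes "\<And>b c. \<lbrakk>b \<in> carrier B; c \<in> carrier C\<rbrakk> \<Longrightarrow> linear_map K A W (\<lambda>a. F a b c)"
    and "\<And>a c. \<lbrakk>a \<in> carrier A; c \<in> carrier C\<rbrakk> \<Longrightarrow> linear_map K B W (\<lambda>b. F a b c)"
    and "\<And>a b. \<lbrakk>a \<in> carrier A; b \<in> carrier B\<rbrakk> \<Longrightarrow> linear_map K C W (\<lambda>c. F a b c)"
  shows "trilinear_map K A B C W F"
  using assms by (simp add: trilinear_map_def bilinear_map_def)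

lemma trilinear_mapD:
  assumes "trilinear_map K A B C W F"
  shows "\<lbrakk>b \<in> carrier B; c \<in> carrier C\<rbrakk> \<Longrightarrow> linear_map K A W (\<lambda>a. F a b c)"
    and "\<lbrakk>a \<in> carrier A; c \<in> carrier C\<rbrakk> \<Longrightarrow> linear_map K B W (\<lambda>b. F a b c)"
    and "\<lbrakk>a \<in> carrier A; b \<in> carrier B\<rbrakk> \<Longrightarrow> linear_map K C W (\<lambda>c. F a b c)"
  using assms by (auto simp: trilinear_map_def bilinear_map_def)

section \<open>The tensor product of two modules\<close>

text \<open>Membership in \<open>lists\<close> stays structural along Cons and append, as the list
  inductions need; \<open>listsD\<close> gives the elementwise form.\<close>

declare in_lists_conv_set [simp del] in_listsD [rule del] in_listsI [rule del]

text \<open>\<open>sweedler\<close> without the choice of a representative: on lists, independence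
  of the representative becomes a statement open to induction.\<close>

definition tensor_sum ::
  "('w, 'z) ring_scheme \<Rightarrow> ('a \<Rightarrow> 'b \<Rightarrow> 'w) \<Rightarrow> ('a \<times> 'b) list \<Rightarrow> 'w"
  where "tensor_sum W f xs = foldr (\<lambda>(a, b) w. f a b \<oplus>\<^bsub>W\<^esub> w) xs \<zero>\<^bsub>W\<^esub>"

lemma tensor_sum_Nil [simp]: "tensor_sum W f [] = \<zero>\<^bsub>W\<^esub>"
  and tensor_sum_Cons [simp]: "tensor_sum W f ((a, b) # xs) = f a b \<oplus>\<^bsub>W\<^esub> tensor_sum W f xs"
  by (simp_all add: tensor_sum_def)

lemma sweedler_tensor_sum: "sweedler W t f = tensor_sum W f (tensor_rep t)"
  by (simp add: sweedler_def tensor_sum_def)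

lemma tensor_sum_cong:
  assumes "\<And>a b. (a, b) \<in> set xs \<Longrightarrow> f a b = g a b"
  shows "tensor_sum W f xs = tensor_sum W g xs"
  using assms by (induction xs) auto

lemma (in abelian_monoid) tensor_sum_closed:
  assumes "\<And>a b. (a, b) \<in> set xs \<Longrightarrow> f a b \<in> carrier G"
  shows "tensor_sum G f xs \<in> carrier G"
  using assms by (induction xs) auto

lemma (in abelian_monoid) tensor_sum_append:
  assumes "\<And>a b. (a, b) \<in> set xs \<union> set ys \<Longrightarrow> f a b \<in> carrier G"
  shows "tensor_sum G f (xs @ ys) = tensor_sum G f xs \<oplus> tensor_sum G f ys"
  using assms by (induction xs) (auto simp: a_assoc tensor_sum_closed)

lemma (in abelian_monoid) tensor_sum_add:
  assumes "\<And>a b. (a, b) \<in> set xs \<Longrightarrow> f a b \<in> carrier G"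
    and "\<And>a b. (a, b) \<in> set xs \<Longrightarrow> g a b \<in> carrier G"
  shows "tensor_sum G (\<lambda>a b. f a b \<oplus> g a b) xs = tensor_sum G f xs \<oplus> tensor_sum G g xs"
  using assms by (induction xs) (auto simp: a_ac tensor_sum_closed)

lemma tensor_sum_linear_map:
  assumes "module K V" "module K W" "linear_map K V W \<phi>"
    and "\<And>a b. (a, b) \<in> set xs \<Longrightarrow> f a b \<in> carrier V"
  shows "\<phi> (tensor_sum V f xs) = tensor_sum W (\<lambda>a b. \<phi> (f a b)) xs"
proof -
  interpret V: module K V by fact
  show ?thesis using assms(4)
    by (induction xs)
      (auto simp: linear_map_zero[OF assms(1-3)] linear_map_add[OF assms(3)] V.tensor_sum_closed)
qed

lemma listsD:
  assumes "xs \<in> lists (X \<times> Y)" "(a, b) \<in> set xs"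
  shows "a \<in> X" "b \<in> Y"
  using assms by (auto simp: in_lists_conv_set)

text \<open>Universal property of the tensor product at the level of lists: each generator of the
  congruence matches one law of \<open>f\<close> or of addition in \<open>W\<close>. Membership is
  carried along because splitting a sum over an append needs all summands in the carrier.\<close>

lemma tensor_sum_rel:
  assumes "module K A" "module K B" "module K W" "bilinear_map K A B W f"
    and "(xs, ys) \<in> tensor_rel K A B"
  shows "xs \<in> lists (carrier A \<times> carrier B) \<and> ys \<in> lists (carrier A \<times> carrier B) \<and>
    tensor_sum W f xs = tensor_sum W f ys"
proof -
  interpret A: module K A by fact
  interpret B: module K B by fact
  interpret W: module K W by fact
  note f = bilinear_mapD[OF assms(4)]
  note closed = bilinear_map_closed[OF assms(4)]
  show ?thesis using assms(5)
  proof induction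
    case (append xs xs' ys ys')
    then show ?case
      by (subst (1 2) W.tensor_sum_append) (auto intro!: closed dest: listsD)
  next
    case (commute xs ys)
    then show ?case
      by (subst (1 2) W.tensor_sum_append)
        (auto intro!: closed W.a_comm W.tensor_sum_closed dest: listsD)
  next
    case (add_left a a' b)
    then show ?case using linear_map_add[OF f(1)] by (simp add: closed W.a_assoc)
  next
    case (add_right a b b')
    then show ?case using linear_map_add[OF f(2)] by (simp add: closed W.a_assoc)
  next
    case (zero_left b)
    then show ?case using linear_map_zero[OF assms(1,3) f(1)] by simp
  next
    case (zero_right a)
    then show ?case using linear_map_zero[OF assms(2,3) f(2)] by simp
  next
    case (balanced c a b)
    then show ?case
      using linear_map_smult[OF f(1), of b c a] linear_map_smult[OF f(2), of a c b]
      by (simp add: closed)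
  qed auto
qed

section \<open>The module structure of A \<otimes> B\<close>

locale tensor_product = A: module K A + B: module K B
  for K :: "'k ring" and A :: "('k, 'a, 'x) module_scheme" and B :: "('k, 'b, 'y) module_scheme"
begin

abbreviation (input) "Rel \<equiv> tensor_rel K A B"
abbreviation (input) "L \<equiv> lists (carrier A \<times> carrier B)"
abbreviation (input) "cl \<equiv> tensor_class K A B"
abbreviation (input) "T \<equiv> tensor K A B"

lemma tensor_rel_lists:
  assumes "(xs, ys) \<in> Rel" shows "xs \<in> L \<and> ys \<in> L"
  using assms by induction auto

lemma equiv_tensor_rel: "equiv L Rel"
proof (rule equivI)
  show "Rel \<subseteq> L \<times> L" by (rule subrelI) (use tensor_rel_lists in blast)
  show "refl_on L Rel" by (auto simp: refl_on_def intro: tensor_rel.refl)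
  show "sym Rel" by (rule symI) (rule tensor_rel.sym)
  show "trans Rel" by (rule transI) (rule tensor_rel.trans)
qed

lemma tensor_class_eqI: "(xs, ys) \<in> Rel \<Longrightarrow> cl xs = cl ys"
  unfolding tensor_class_def by (rule equiv_class_eq[OF equiv_tensor_rel])

lemma tensor_class_closed: "xs \<in> L \<Longrightarrow> cl xs \<in> carrier T"
  by (auto simp: tensor_def tensor_class_def intro: quotientI)

text \<open>The access to the list chosen by \<open>tensor_rep\<close>: by reflexivity the class is
  inhabited, so the choice is congruent to any list defining the class.\<close>

lemma tensor_rep_rel: "xs \<in> L \<Longrightarrow> (xs, tensor_rep (cl xs)) \<in> Rel"
proof -
  assume "xs \<in> L"
  then have "xs \<in> cl xs" by (auto simp: tensor_class_def intro: tensor_rel.refl)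
  then have "tensor_rep (cl xs) \<in> cl xs" unfolding tensor_rep_def by (rule someI)
  then show ?thesis by (simp add: tensor_class_def)
qed

lemma tensor_rep:
  assumes "t \<in> carrier T"
  shows "tensor_rep t \<in> L" "cl (tensor_rep t) = t"
proof -
  obtain xs where xs: "xs \<in> L" "t = cl xs"
    using assms by (auto simp: tensor_def tensor_class_def elim!: quotientE)
  then have rel: "(xs, tensor_rep t) \<in> Rel" using tensor_rep_rel by simp
  then show "tensor_rep t \<in> L" using tensor_rel_lists by blast
  show "cl (tensor_rep t) = t" using tensor_class_eqI[OF rel] xs by simp
qed

lemma tensor_add_class:
  assumes "xs \<in> L" "ys \<in> L"
  shows "cl xs \<oplus>\<^bsub>T\<^esub> cl ys = cl (xs @ ys)"
proof -
  have "(xs @ ys, tensor_rep (cl xs) @ tensor_rep (cl ys)) \<in> Rel"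
    by (intro tensor_rel.append tensor_rep_rel assms)
  then show ?thesis by (simp add: tensor_def tensor_class_eqI)
qed

lemma tensor_zero_class: "\<zero>\<^bsub>T\<^esub> = cl []"
  by (simp add: tensor_def)

abbreviation (input) "sc c \<equiv> map (\<lambda>(a, b). (c \<odot>\<^bsub>A\<^esub> a, b))"

text \<open>Scalar multiplication scales the first components of a chosen list, so its value on a
  class is determined once scaling respects the congruence.\<close>

lemma smult_rel:
  assumes "c \<in> carrier K" "(xs, ys) \<in> Rel"
  shows "(sc c xs, sc c ys) \<in> Rel"
  using assms(2)
proof induction
  case (refl xs)
  then show ?case using assms(1) by (intro tensor_rel.refl) (induction xs, auto)
next
  case (append xs xs' ys ys')
  then show ?case by (auto intro: tensor_rel.append)
next
  case (trans xs ys zs)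
  then show ?case by (blast intro: tensor_rel.trans)
next
  case (commute xs ys)
  have "sc c zs \<in> L" if "zs \<in> L" for zs using that assms(1) by (induction zs) auto
  then show ?case using commute by (auto intro: tensor_rel.commute)
next
  case (add_left a a' b)
  then show ?case using assms(1) by (auto simp: A.smult_r_distr intro: tensor_rel.add_left)
next
  case (zero_left b)
  then show ?case using assms(1) by (auto intro: tensor_rel.zero_left)
next
  case (balanced d a b)
  \<comment> \<open>Balancing is applied at c a in place of a; the two scalars then trade places by
    commutativity of K.\<close>
  have "([(d \<odot>\<^bsub>A\<^esub> (c \<odot>\<^bsub>A\<^esub> a), b)], [(c \<odot>\<^bsub>A\<^esub> a, d \<odot>\<^bsub>B\<^esub> b)]) \<in> Rel"
    using balanced assms(1) by (intro tensor_rel.balanced) auto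
  moreover have "d \<odot>\<^bsub>A\<^esub> (c \<odot>\<^bsub>A\<^esub> a) = c \<odot>\<^bsub>A\<^esub> (d \<odot>\<^bsub>A\<^esub> a)"
    using balanced assms(1) by (simp add: A.smult_assoc1[symmetric] A.R.m_comm)
  ultimately show ?case by simp
qed (use assms(1) in \<open>auto intro: tensor_rel.intros\<close>)

lemma tensor_smult_class:
  assumes "c \<in> carrier K" "xs \<in> L"
  shows "c \<odot>\<^bsub>T\<^esub> cl xs = cl (sc c xs)"
  using smult_rel[OF assms(1) tensor_rep_rel[OF assms(2)]]
  by (simp add: tensor_def tensor_class_eqI)

lemma sc_lists: "\<lbrakk>c \<in> carrier K; xs \<in> L\<rbrakk> \<Longrightarrow> sc c xs \<in> L"
  by (induction xs) auto

lemma tensor_cases [consumes 1]: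
  assumes "t \<in> carrier T" obtains xs where "xs \<in> L" "t = cl xs"
  using tensor_rep[OF assms] by metis

lemma abelian_monoid_tensor: "abelian_monoid T"
proof (rule abelian_monoidI)
  show "x \<oplus>\<^bsub>T\<^esub> y \<in> carrier T" if "x \<in> carrier T" "y \<in> carrier T" for x y
    using that by (elim tensor_cases) (auto simp: tensor_add_class intro: tensor_class_closed)
  show "\<zero>\<^bsub>T\<^esub> \<in> carrier T" by (auto simp: tensor_zero_class intro: tensor_class_closed)
  show "x \<oplus>\<^bsub>T\<^esub> y \<oplus>\<^bsub>T\<^esub> z = x \<oplus>\<^bsub>T\<^esub> (y \<oplus>\<^bsub>T\<^esub> z)"
    if "x \<in> carrier T" "y \<in> carrier T" "z \<in> carrier T" for x y z
    using that by (elim tensor_cases) (auto simp: tensor_add_class)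
  show "\<zero>\<^bsub>T\<^esub> \<oplus>\<^bsub>T\<^esub> x = x" if "x \<in> carrier T" for x
    using that by (elim tensor_cases) (auto simp: tensor_add_class tensor_zero_class)
  show "x \<oplus>\<^bsub>T\<^esub> y = y \<oplus>\<^bsub>T\<^esub> x" if "x \<in> carrier T" "y \<in> carrier T" for x y
    using that
    by (elim tensor_cases) (auto simp: tensor_add_class intro!: tensor_class_eqI tensor_rel.commute)
qed

lemma pure_tensor_closed: "\<lbrakk>a \<in> carrier A; b \<in> carrier B\<rbrakk> \<Longrightarrow> pure_tensor K A B a b \<in> carrier T"
  by (simp add: pure_tensor_def tensor_class_closed)

lemma tensor_class_Cons:
  assumes "a \<in> carrier A" "b \<in> carrier B" "xs \<in> L"
  shows "cl ((a, b) # xs) = pure_tensor K A B a b \<oplus>\<^bsub>T\<^esub> cl xs"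
  using tensor_add_class[of "[(a, b)]" xs] assms by (simp add: pure_tensor_def)

text \<open>No case for scalar multiples arises: a class is given by a list, that is, by a finite
  sum of pure tensors whose scalars sit in the first components.\<close>

lemma tensor_induct [consumes 1, case_names zero pure add]:
  assumes "t \<in> carrier T"
    and "P \<zero>\<^bsub>T\<^esub>"
    and "\<And>a b. \<lbrakk>a \<in> carrier A; b \<in> carrier B\<rbrakk> \<Longrightarrow> P (pure_tensor K A B a b)"
    and "\<And>s t. \<lbrakk>s \<in> carrier T; t \<in> carrier T; P s; P t\<rbrakk> \<Longrightarrow> P (s \<oplus>\<^bsub>T\<^esub> t)"
  shows "P t"
proof -
  have "P (cl xs)" if "xs \<in> L" for xs
    using that
  proof (induction xs)
    case Nil
    then show ?case using assms(2) by (simp add: tensor_zero_class)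
  next
    case (Cons p xs)
    then show ?case
      by (cases p) (auto simp: tensor_class_Cons intro!: assms(3,4) pure_tensor_closed
          tensor_class_closed)
  qed
  with tensor_rep[OF assms(1)] show ?thesis by metis
qed

lemma module_tensor: "module K T"
proof -
  interpret T: abelian_monoid T by (rule abelian_monoid_tensor)
  have smult_closed: "c \<odot>\<^bsub>T\<^esub> t \<in> carrier T" if "c \<in> carrier K" "t \<in> carrier T" for c t
    using that(2)
    by (cases rule: tensor_cases)
      (auto simp: tensor_smult_class that(1) intro!: tensor_class_closed sc_lists)
  have smult_r: "c \<odot>\<^bsub>T\<^esub> (s \<oplus>\<^bsub>T\<^esub> t) = c \<odot>\<^bsub>T\<^esub> s \<oplus>\<^bsub>T\<^esub> c \<odot>\<^bsub>T\<^esub> t"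
    if "c \<in> carrier K" "s \<in> carrier T" "t \<in> carrier T" for c s t
    using that(2,3)
    by (elim tensor_cases)
      (use that(1) in \<open>auto simp: tensor_smult_class tensor_add_class sc_lists\<close>)
  have smult_zero: "c \<odot>\<^bsub>T\<^esub> \<zero>\<^bsub>T\<^esub> = \<zero>\<^bsub>T\<^esub>" if "c \<in> carrier K" for c
    using that by (simp add: tensor_zero_class tensor_smult_class)
  have smult_pure: "c \<odot>\<^bsub>T\<^esub> pure_tensor K A B a b = pure_tensor K A B (c \<odot>\<^bsub>A\<^esub> a) b"
    if "c \<in> carrier K" "a \<in> carrier A" "b \<in> carrier B" for c a b
    using that by (simp add: pure_tensor_def tensor_smult_class)
  have pure_add: "pure_tensor K A B (a \<oplus>\<^bsub>A\<^esub> a') b =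
      pure_tensor K A B a b \<oplus>\<^bsub>T\<^esub> pure_tensor K A B a' b"
    if "a \<in> carrier A" "a' \<in> carrier A" "b \<in> carrier B" for a a' b
    using tensor_class_eqI[OF tensor_rel.add_left] that
    by (simp add: pure_tensor_def tensor_add_class)
  have smult_l: "(c \<oplus>\<^bsub>K\<^esub> d) \<odot>\<^bsub>T\<^esub> t = c \<odot>\<^bsub>T\<^esub> t \<oplus>\<^bsub>T\<^esub> d \<odot>\<^bsub>T\<^esub> t"
    if cd: "c \<in> carrier K" "d \<in> carrier K" and "t \<in> carrier T" for c d t
    using that(3)
  proof (induction rule: tensor_induct)
    case (add s t)
    then show ?case using cd by (simp add: smult_r smult_closed T.a_ac)
  qed (use cd in \<open>simp_all add: smult_zero smult_pure A.smult_l_distr pure_add\<close>)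
  have smult_assoc: "(c \<otimes>\<^bsub>K\<^esub> d) \<odot>\<^bsub>T\<^esub> t = c \<odot>\<^bsub>T\<^esub> (d \<odot>\<^bsub>T\<^esub> t)"
    if cd: "c \<in> carrier K" "d \<in> carrier K" and "t \<in> carrier T" for c d t
    using that(3)
  proof (induction rule: tensor_induct)
    case (add s t)
    then show ?case using cd by (simp add: smult_r smult_closed)
  qed (use cd in \<open>simp_all add: smult_zero smult_pure A.smult_assoc1\<close>)
  have smult_one: "\<one>\<^bsub>K\<^esub> \<odot>\<^bsub>T\<^esub> t = t" if "t \<in> carrier T" for t
    using that by (induction rule: tensor_induct) (simp_all add: smult_zero smult_pure smult_r)
  have null: "\<zero>\<^bsub>K\<^esub> \<odot>\<^bsub>T\<^esub> t = \<zero>\<^bsub>T\<^esub>" if "t \<in> carrier T" for t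
    using that
  proof (induction rule: tensor_induct)
    case (pure a b)
    then show ?case
      using tensor_class_eqI[OF tensor_rel.zero_left, of b]
      by (simp add: smult_pure, simp add: pure_tensor_def tensor_zero_class)
  qed (simp_all add: smult_zero smult_r)
  \<comment> \<open>Formal sums contain no negatives; (-1) x serves as the inverse of x, because (-1
    + 1) x = 0 by \<open>null\<close>.\<close>
  have "abelian_group T"
  proof (rule abelian_groupI)
    show "\<exists>y\<in>carrier T. y \<oplus>\<^bsub>T\<^esub> x = \<zero>\<^bsub>T\<^esub>" if "x \<in> carrier T" for x
    proof
      show "(\<ominus>\<^bsub>K\<^esub> \<one>\<^bsub>K\<^esub>) \<odot>\<^bsub>T\<^esub> x \<in> carrier T" using that by (simp add: smult_closed)
      show "(\<ominus>\<^bsub>K\<^esub> \<one>\<^bsub>K\<^esub>) \<odot>\<^bsub>T\<^esub> x \<oplus>\<^bsub>T\<^esub> x = \<zero>\<^bsub>T\<^esub>"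
        using smult_l[of "\<ominus>\<^bsub>K\<^esub> \<one>\<^bsub>K\<^esub>" "\<one>\<^bsub>K\<^esub>" x] that by (simp add: smult_one null A.R.l_neg)
    qed
  qed (auto simp: T.a_ac)
  then show ?thesis
    by (intro moduleI A.R.is_cring smult_closed smult_l smult_r smult_assoc smult_one)
qed

lemma pure_tensor_bilinear: "bilinear_map K A B T (pure_tensor K A B)"
proof (intro bilinear_mapI linear_mapI)
  fix a b c
  assume abc: "a \<in> carrier A" "b \<in> carrier B" "c \<in> carrier K"
  show smult_left: "pure_tensor K A B (c \<odot>\<^bsub>A\<^esub> a) b = c \<odot>\<^bsub>T\<^esub> pure_tensor K A B a b"
    using abc by (simp add: pure_tensor_def tensor_smult_class)
  then show "pure_tensor K A B a (c \<odot>\<^bsub>B\<^esub> b) = c \<odot>\<^bsub>T\<^esub> pure_tensor K A B a b"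
    using tensor_class_eqI[OF tensor_rel.balanced, of c a b] abc by (simp add: pure_tensor_def)
next
  fix a a' b assume "a \<in> carrier A" "a' \<in> carrier A" "b \<in> carrier B"
  then show "pure_tensor K A B (a \<oplus>\<^bsub>A\<^esub> a') b =
      pure_tensor K A B a b \<oplus>\<^bsub>T\<^esub> pure_tensor K A B a' b"
    using tensor_class_eqI[OF tensor_rel.add_left]
    by (simp add: pure_tensor_def tensor_add_class)
next
  fix a b b' assume "a \<in> carrier A" "b \<in> carrier B" "b' \<in> carrier B"
  then show "pure_tensor K A B a (b \<oplus>\<^bsub>B\<^esub> b') =
      pure_tensor K A B a b \<oplus>\<^bsub>T\<^esub> pure_tensor K A B a b'"
    using tensor_class_eqI[OF tensor_rel.add_right]
    by (simp add: pure_tensor_def tensor_add_class)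
qed (rule pure_tensor_closed; assumption)+

section \<open>Linear maps out of A \<otimes> B as Sweedler sums\<close>

lemma linear_map_eq_on_tensor:
  assumes "module K W" "linear_map K T W f" "linear_map K T W g"
    and "\<And>a b. \<lbrakk>a \<in> carrier A; b \<in> carrier B\<rbrakk> \<Longrightarrow> f (pure_tensor K A B a b) =
        g (pure_tensor K A B a b)"
    and "t \<in> carrier T"
  shows "f t = g t"
  using assms(5)
  by (induction rule: tensor_induct)
    (simp_all add: assms(4) linear_map_zero[OF module_tensor assms(1)] assms(2,3)
      linear_map_add[OF assms(2)] linear_map_add[OF assms(3)])

text \<open>This removes the choice hidden in \<open>sweedler\<close>: \<open>tensor_rep\<close>
  returns a list congruent to \<open>xs\<close>, and \<open>tensor_sum_rel\<close> gives both the
  same sum.\<close>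

lemma sweedler_class:
  assumes "module K W" "bilinear_map K A B W F" "xs \<in> L"
  shows "sweedler W (cl xs) F = tensor_sum W F xs"
  using tensor_sum_rel[OF A.module_axioms B.module_axioms assms(1,2) tensor_rep_rel[OF assms(3)]]
  by (simp add: sweedler_tensor_sum)

lemma sweedler_pure:
  assumes "module K W" "bilinear_map K A B W F" "a \<in> carrier A" "b \<in> carrier B"
  shows "sweedler W (pure_tensor K A B a b) F = F a b"
proof -
  interpret W: module K W by fact
  show ?thesis
    using assms bilinear_map_closed[OF assms(2)] by (simp add: pure_tensor_def sweedler_class)
qed

lemma sweedler_linear:
  assumes "module K W" "bilinear_map K A B W F"
  shows "linear_map K T W (\<lambda>t. sweedler W t F)"
proof (rule linear_mapI)
  interpret W: module K W by fact
  have F: "F a b \<in> carrier W" if "xs \<in> L" "(a, b) \<in> set xs" for a b xs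
    using listsD[OF that] by (rule bilinear_map_closed[OF assms(2)])
  have closed: "tensor_sum W F xs \<in> carrier W" if "xs \<in> L" for xs
    using F that by (blast intro: W.tensor_sum_closed)
  fix s assume s: "s \<in> carrier T"
  then obtain xs where xs: "xs \<in> L" "s = cl xs" by (rule tensor_cases)
  show "sweedler W s F \<in> carrier W" using xs by (simp only: sweedler_class assms closed)
  show "sweedler W (s \<oplus>\<^bsub>T\<^esub> t) F = sweedler W s F \<oplus>\<^bsub>W\<^esub> sweedler W t F" if "t \<in> carrier T" for t
  proof -
    obtain ys where ys: "ys \<in> L" "t = cl ys" using \<open>t \<in> carrier T\<close> by (rule tensor_cases)
    have "tensor_sum W F (xs @ ys) = tensor_sum W F xs \<oplus>\<^bsub>W\<^esub> tensor_sum W F ys"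
      using F xs(1) ys(1) by (blast intro: W.tensor_sum_append)
    then show ?thesis using xs ys
      by (simp only: tensor_add_class sweedler_class assms append_in_lists_conv)
  qed
  show "sweedler W (c \<odot>\<^bsub>T\<^esub> s) F = c \<odot>\<^bsub>W\<^esub> sweedler W s F" if c: "c \<in> carrier K" for c
  proof -
    have "tensor_sum W F (sc c xs) = c \<odot>\<^bsub>W\<^esub> tensor_sum W F xs"
      using xs(1)
    proof (induction xs)
      case (Cons p xs)
      then obtain a b where "p = (a, b)" "a \<in> carrier A" "b \<in> carrier B" "xs \<in> L" by auto
      then show ?case
        using Cons.IH c closed[of xs]
        by (simp add: W.smult_r_distr bilinear_map_closed[OF assms(2)]
            linear_map_smult[OF bilinear_mapD(1)[OF assms(2)]])
    qed (use c in simp)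
    then show ?thesis using c xs by (simp only: tensor_smult_class sweedler_class assms sc_lists)
  qed
qed

lemma sweedler_cong:
  assumes "t \<in> carrier T" "\<And>a b. \<lbrakk>a \<in> carrier A; b \<in> carrier B\<rbrakk> \<Longrightarrow> F a b = G a b"
  shows "sweedler W t F = sweedler W t G"
  unfolding sweedler_tensor_sum
  by (rule tensor_sum_cong) (intro assms(2) listsD[OF tensor_rep(1)[OF assms(1)]])

lemma sweedler_closed:
  assumes "module K W" "t \<in> carrier T" "\<And>a b. \<lbrakk>a \<in> carrier A; b \<in> carrier B\<rbrakk> \<Longrightarrow> F a b \<in> carrier W"
  shows "sweedler W t F \<in> carrier W"
proof -
  interpret W: module K W by fact
  show ?thesis
    unfolding sweedler_tensor_sum
    by (rule W.tensor_sum_closed) (intro assms(3) listsD[OF tensor_rep(1)[OF assms(2)]])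
qed

text \<open>Both sums run over the same list \<open>tensor_rep t\<close>, so this is finite
  additivity of \<phi>.\<close>

lemma sweedler_push:
  assumes "module K V" "module K W" "linear_map K V W \<phi>" "t \<in> carrier T"
    and "\<And>a b. \<lbrakk>a \<in> carrier A; b \<in> carrier B\<rbrakk> \<Longrightarrow> F a b \<in> carrier V"
  shows "\<phi> (sweedler V t F) = sweedler W t (\<lambda>a b. \<phi> (F a b))"
  unfolding sweedler_tensor_sum
  by (rule tensor_sum_linear_map[OF assms(1-3)])
    (intro assms(5) listsD[OF tensor_rep(1)[OF assms(4)]])

lemma sweedler_linear_parameter:
  assumes "module K W" "t \<in> carrier T"
    and "\<And>a b. \<lbrakk>a \<in> carrier A; b \<in> carrier B\<rbrakk> \<Longrightarrow> linear_map K X W (\<lambda>x. F x a b)"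
  shows "linear_map K X W (\<lambda>x. sweedler W t (F x))"
proof (rule linear_mapI)
  interpret W: module K W by fact
  note F = linear_map_closed[OF assms(3)]
  fix x assume x: "x \<in> carrier X"
  show "sweedler W t (F x) \<in> carrier W"
    using assms x by (intro sweedler_closed) (auto intro: F)
  show "sweedler W t (F (x \<oplus>\<^bsub>X\<^esub> y)) = sweedler W t (F x) \<oplus>\<^bsub>W\<^esub> sweedler W t (F y)"
    if y: "y \<in> carrier X" for y
  proof -
    have "sweedler W t (F (x \<oplus>\<^bsub>X\<^esub> y)) = sweedler W t (\<lambda>a b. F x a b \<oplus>\<^bsub>W\<^esub> F y a b)"
      by (rule sweedler_cong[OF assms(2)]) (rule linear_map_add[OF assms(3) x y])
    also have "\<dots> = sweedler W t (F x) \<oplus>\<^bsub>W\<^esub> sweedler W t (F y)"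
      unfolding sweedler_tensor_sum
      by (rule W.tensor_sum_add; intro F x y) (rule listsD[OF tensor_rep(1)[OF assms(2)]];
          assumption)+
    finally show ?thesis .
  qed
  show "sweedler W t (F (c \<odot>\<^bsub>X\<^esub> x)) = c \<odot>\<^bsub>W\<^esub> sweedler W t (F x)" if c: "c \<in> carrier K" for c
  proof -
    have "linear_map K W W (\<lambda>w. c \<odot>\<^bsub>W\<^esub> w)"
      using c by (intro linear_mapI)
        (auto simp: W.smult_r_distr W.smult_assoc1[symmetric] A.R.m_comm)
    then have "c \<odot>\<^bsub>W\<^esub> sweedler W t (F x) = sweedler W t (\<lambda>a b. c \<odot>\<^bsub>W\<^esub> F x a b)"
      by (rule sweedler_push[OF assms(1,1) _ assms(2)]) (auto intro: F x)
    also have "\<dots> = sweedler W t (F (c \<odot>\<^bsub>X\<^esub> x))"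
      by (rule sweedler_cong[OF assms(2)])
        (rule linear_map_smult[OF assms(3) c x, symmetric])
    finally show ?thesis by simp
  qed
qed

end

section \<open>Calculus with Sweedler sums\<close>

text \<open>With the locale replaced by explicit \<open>module\<close> premises, the rules resolve
  against nested products such as H \<otimes> (N \<otimes> M).\<close>

lemmas module_tensor = tensor_product.module_tensor[OF tensor_product.intro]
  and pure_tensor_closed = tensor_product.pure_tensor_closed[OF tensor_product.intro]
  and pure_tensor_bilinear = tensor_product.pure_tensor_bilinear[OF tensor_product.intro]
  and linear_map_eq_on_tensor = tensor_product.linear_map_eq_on_tensor[OF tensor_product.intro]
  and sweedler_pure = tensor_product.sweedler_pure[OF tensor_product.intro]
  and sweedler_linear = tensor_product.sweedler_linear[OF tensor_product.intro]
  and sweedler_cong = tensor_product.sweedler_cong[OF tensor_product.intro]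
  and sweedler_closed = tensor_product.sweedler_closed[OF tensor_product.intro]
  and sweedler_push = tensor_product.sweedler_push[OF tensor_product.intro]
  and sweedler_linear_parameter = tensor_product.sweedler_linear_parameter[OF tensor_product.intro]

text \<open>
  The rules \<open>multilinear\<close> are syntax-directed: \<open>(assumption | rule multilinear)+\<close> discharges
  linearity in any variable of a nested Sweedler sum and membership in a carrier.
\<close>

named_theorems multilinear

lemma linear_map_id: "linear_map K A A (\<lambda>x. x)"
  by (simp add: linear_map_def)

lemma linear_map_pure_left:
  assumes "module K A" "module K B" "linear_map K X A f" "b \<in> carrier B"
  shows "linear_map K X (tensor K A B) (\<lambda>x. pure_tensor K A B (f x) b)"
  by (rule linear_map_compose[OF assms(3)])
    (rule bilinear_mapD(1)[OF pure_tensor_bilinear[OF assms(1,2)] assms(4)])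

lemma linear_map_pure_right:
  assumes "module K A" "module K B" "a \<in> carrier A" "linear_map K X B f"
  shows "linear_map K X (tensor K A B) (\<lambda>x. pure_tensor K A B a (f x))"
  by (rule linear_map_compose[OF assms(4)])
    (rule bilinear_mapD(2)[OF pure_tensor_bilinear[OF assms(1,2)] assms(3)])

lemma linear_map_sweedler:
  assumes "module K A" "module K B" "module K W"
    and "linear_map K X (tensor K A B) f" "bilinear_map K A B W F"
  shows "linear_map K X W (\<lambda>x. sweedler W (f x) F)"
  by (rule linear_map_compose[OF assms(4) sweedler_linear[OF assms(1-3,5)]])

lemma linear_map_smult_const:
  assumes "module K W" "c \<in> carrier K" "linear_map K X W f"
  shows "linear_map K X W (\<lambda>x. c \<odot>\<^bsub>W\<^esub> f x)"
proof -
  interpret W: module K W by fact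
  have "linear_map K W W (\<lambda>w. c \<odot>\<^bsub>W\<^esub> w)"
    using assms(2) by (intro linear_mapI)
      (auto simp: W.smult_r_distr W.smult_assoc1[symmetric] W.R.m_comm)
  then show ?thesis by (rule linear_map_compose[OF assms(3)])
qed

lemma smult_closed:
  "\<lbrakk>module K W; c \<in> carrier K; w \<in> carrier W\<rbrakk> \<Longrightarrow> c \<odot>\<^bsub>W\<^esub> w \<in> carrier W"
  by (rule module.smult_closed)

text \<open>The scalars are separated in reverse order for the counit of a tensor product of
  comodules: b belongs to the inner sum, which collapses first and must see its scalar
  outermost.\<close>

lemma smult_mult_commute:
  assumes "module K W" "a \<in> carrier K" "b \<in> carrier K" "w \<in> carrier W"
  shows "(a \<otimes>\<^bsub>K\<^esub> b) \<odot>\<^bsub>W\<^esub> w = b \<odot>\<^bsub>W\<^esub> (a \<odot>\<^bsub>W\<^esub> w)"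
proof -
  interpret module K W by fact
  show ?thesis using assms(2-4) by (simp add: smult_assoc1[symmetric] R.m_comm)
qed

text \<open>A variable of a multilinear expression occurs once, so it lies either in the tensor
  argument of \<open>sweedler\<close> or in its summand. \<open>linear_map_sweedler\<close> and
  \<open>sweedler_linear_parameter\<close> match exactly these two positions.\<close>

lemmas [multilinear] = linear_map_id linear_map_pure_left linear_map_pure_right
  sweedler_linear_parameter linear_map_sweedler linear_map_smult_const
  bilinear_mapI trilinear_mapI module_tensor pure_tensor_closed sweedler_closed smult_closed

text \<open>The identity of A \<otimes> B is the linear map induced by \<otimes>. This later turns a
  Sweedler sum over \<Delta>(h) back into the element \<Delta>(h).\<close>

lemma sweedler_pure_tensor:
  assumes [multilinear]: "module K A" "module K B" and t: "t \<in> carrier (tensor K A B)"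
  shows "sweedler (tensor K A B) t (pure_tensor K A B) = t"
proof (rule linear_map_eq_on_tensor[OF _ _ _ _ _ _ t])
  show "sweedler (tensor K A B) (pure_tensor K A B a b) (pure_tensor K A B) = pure_tensor K A B a b"
    if [multilinear]: "a \<in> carrier A" "b \<in> carrier B" for a b
    by (rule sweedler_pure) (assumption | rule multilinear)+
qed (assumption | rule multilinear)+

lemma tensor_sum_swap:
  assumes "abelian_monoid W"
    and "\<And>a b c d. \<lbrakk>(a, b) \<in> set xs; (c, d) \<in> set ys\<rbrakk> \<Longrightarrow> F a b c d \<in> carrier W"
  shows "tensor_sum W (\<lambda>a b. tensor_sum W (\<lambda>c d. F a b c d) ys) xs =
    tensor_sum W (\<lambda>c d. tensor_sum W (\<lambda>a b. F a b c d) xs) ys"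
  using assms(2)
proof (induction xs)
  interpret W: abelian_monoid W by fact
  case Nil
  show ?case by (induction ys) auto
next
  interpret W: abelian_monoid W by fact
  case (Cons p xs)
  obtain a b where p: "p = (a, b)" by (cases p)
  have "tensor_sum W (\<lambda>c d. F a b c d \<oplus>\<^bsub>W\<^esub> tensor_sum W (\<lambda>a b. F a b c d) xs) ys =
      tensor_sum W (\<lambda>c d. F a b c d) ys \<oplus>\<^bsub>W\<^esub>
      tensor_sum W (\<lambda>c d. tensor_sum W (\<lambda>a b. F a b c d) xs) ys"
    using Cons.prems p by (intro W.tensor_sum_add) (auto intro!: W.tensor_sum_closed)
  then show ?case using Cons p by auto
qed

text \<open>Fubini for finite sums: neither tensor depends on the variables of the other sum, so
  both lists are fixed.\<close>

lemma sweedler_swap: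
  assumes "module K A" "module K B" "module K C" "module K D" "module K W"
    and "s \<in> carrier (tensor K A B)" "t \<in> carrier (tensor K C D)"
    and "\<And>a b c d. \<lbrakk>a \<in> carrier A; b \<in> carrier B; c \<in> carrier C; d \<in> carrier D\<rbrakk> \<Longrightarrow>
      F a b c d \<in> carrier W"
  shows "sweedler W s (\<lambda>a b. sweedler W t (\<lambda>c d. F a b c d)) =
    sweedler W t (\<lambda>c d. sweedler W s (\<lambda>a b. F a b c d))"
proof -
  interpret W: module K W by fact
  have "tensor_rep s \<in> lists (carrier A \<times> carrier B)"
    using tensor_product.tensor_rep(1)[OF tensor_product.intro[OF assms(1,2)] assms(6)] .
  moreover have "tensor_rep t \<in> lists (carrier C \<times> carrier D)"
    using tensor_product.tensor_rep(1)[OF tensor_product.intro[OF assms(3,4)] assms(7)] .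
  ultimately show ?thesis
    unfolding sweedler_tensor_sum
    by (intro tensor_sum_swap W.abelian_monoid_axioms assms(8)) (auto dest: listsD)
qed

text \<open>Flattening of a sum over a tensor that is itself a sum: \<open>sweedler_push\<close> for
  the linear map induced by \<open>G\<close>.\<close>

lemma sweedler_sweedler:
  assumes "module K A" "module K B" "module K C" "module K D" "module K W"
    and "t \<in> carrier (tensor K A B)" "bilinear_map K C D W G"
    and "\<And>a b. \<lbrakk>a \<in> carrier A; b \<in> carrier B\<rbrakk> \<Longrightarrow> F a b \<in> carrier (tensor K C D)"
  shows "sweedler W (sweedler (tensor K C D) t F) G = sweedler W t (\<lambda>a b. sweedler W (F a b) G)"
  by (rule sweedler_push[OF assms(1,2) module_tensor[OF assms(3,4)] assms(5)
        sweedler_linear[OF assms(3-5,7)] assms(6,8)])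

text \<open>
  Both sides of a coassociativity law lie in \<open>A \<otimes> (B \<otimes> C)\<close>; they are evaluated on the linear map
  \<open>A \<otimes> (B \<otimes> C) \<rightarrow> W\<close> induced by a trilinear map \<open>F\<close>.
\<close>

context
  fixes K :: "'k ring" and A :: "('k, 'a, 'x) module_scheme" and B :: "('k, 'b, 'y) module_scheme"
    and C :: "('k, 'c, 'u) module_scheme" and W :: "('k, 'w, 'z) module_scheme"
    and F :: "'a \<Rightarrow> 'b \<Rightarrow> 'c \<Rightarrow> 'w"
  assumes modules: "module K A" "module K B" "module K C" "module K W"
    and F: "trilinear_map K A B C W F"
begin

lemma trilinear_eval_right:
  assumes [multilinear]: "module K Y" "s \<in> carrier (tensor K A Y)"
    "\<And>y. y \<in> carrier Y \<Longrightarrow> e y \<in> carrier (tensor K B C)"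
  shows "sweedler W (sweedler (tensor K A (tensor K B C)) s
        (\<lambda>a y. pure_tensor K A (tensor K B C) a (e y))) (\<lambda>a u. sweedler W u (F a)) =
    sweedler W s (\<lambda>a y. sweedler W (e y) (F a))"
proof -
  note [multilinear] = modules trilinear_mapD[OF F] linear_map_closed[OF trilinear_mapD(1)[OF F]]
  have "sweedler W (sweedler (tensor K A (tensor K B C)) s
        (\<lambda>a y. pure_tensor K A (tensor K B C) a (e y))) (\<lambda>a u. sweedler W u (F a)) =
    sweedler W s (\<lambda>a y. sweedler W (pure_tensor K A (tensor K B C) a (e y)) (\<lambda>a u.
        sweedler W u (F a)))"
    by (rule sweedler_sweedler) (assumption | rule multilinear)+
  also have "\<dots> = sweedler W s (\<lambda>a y. sweedler W (e y) (F a))"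
    by (rule sweedler_cong, rule multilinear, rule multilinear, rule multilinear, rule
        sweedler_pure)
      (assumption | rule multilinear)+
  finally show ?thesis .
qed

lemma trilinear_eval_left:
  assumes [multilinear]: "module K X" "s \<in> carrier (tensor K X C)"
    "\<And>x. x \<in> carrier X \<Longrightarrow> d x \<in> carrier (tensor K A B)"
  shows "sweedler W (sweedler (tensor K A (tensor K B C)) s
        (\<lambda>x c. sweedler (tensor K A (tensor K B C)) (d x)
          (\<lambda>a b. pure_tensor K A (tensor K B C) a (pure_tensor K B C b c))))
        (\<lambda>a u. sweedler W u (F a)) =
    sweedler W s (\<lambda>x c. sweedler W (d x) (\<lambda>a b. F a b c))"
proof -
  note [multilinear] = modules trilinear_mapD[OF F] linear_map_closed[OF trilinear_mapD(1)[OF F]]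
  let ?T = "tensor K A (tensor K B C)"
  let ?p = "\<lambda>a b c. pure_tensor K A (tensor K B C) a (pure_tensor K B C b c)"
  let ?\<Phi> = "\<lambda>t. sweedler W t (\<lambda>a u. sweedler W u (F a))"
  have "?\<Phi> (sweedler ?T s (\<lambda>x c. sweedler ?T (d x) (\<lambda>a b. ?p a b c))) =
      sweedler W s (\<lambda>x c. ?\<Phi> (sweedler ?T (d x) (\<lambda>a b. ?p a b c)))"
    by (rule sweedler_sweedler) (assumption | rule multilinear)+
  also have "\<dots> = sweedler W s (\<lambda>x c. sweedler W (d x) (\<lambda>a b. F a b c))"
  proof (rule sweedler_cong[OF assms(1) modules(3) assms(2)])
    fix x c assume [multilinear]: "x \<in> carrier X" "c \<in> carrier C"
    have "?\<Phi> (sweedler ?T (d x) (\<lambda>a b. ?p a b c)) = sweedler W (d x) (\<lambda>a b. ?\<Phi> (?p a b c))"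
      by (rule sweedler_sweedler) (assumption | rule multilinear)+
    also have "\<dots> = sweedler W (d x) (\<lambda>a b. F a b c)"
    proof (rule sweedler_cong[OF modules(1,2)])
      show "d x \<in> carrier (tensor K A B)" by (rule multilinear)+
      fix a b assume [multilinear]: "a \<in> carrier A" "b \<in> carrier B"
      have "?\<Phi> (?p a b c) = sweedler W (pure_tensor K B C b c) (F a)"
        by (rule sweedler_pure) (assumption | rule multilinear)+
      also have "\<dots> = F a b c"
        by (rule sweedler_pure) (assumption | rule multilinear)+
      finally show "?\<Phi> (?p a b c) = F a b c" .
    qed
    finally show "?\<Phi> (sweedler ?T (d x) (\<lambda>a b. ?p a b c)) = sweedler W (d x) (\<lambda>a b. F a b c)" .
  qed
  finally show ?thesis .
qed

end

section \<open>Hopf algebra identities in Sweedler form\<close>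

context unital_algebra
begin

lemma linear_map_mult_left:
  assumes "linear_map K X H f" "b \<in> carrier H"
  shows "linear_map K X H (\<lambda>x. f x \<otimes>\<^bsub>H\<^esub> b)"
  by (rule linear_map_compose[OF assms(1)], rule linear_mapI)
    (simp_all add: assms(2) l_distr smult_mult_left)

lemma linear_map_mult_right:
  assumes "a \<in> carrier H" "linear_map K X H f"
  shows "linear_map K X H (\<lambda>x. a \<otimes>\<^bsub>H\<^esub> f x)"
  by (rule linear_map_compose[OF assms(2)], rule linear_mapI)
    (simp_all add: assms(1) r_distr smult_mult_right)

lemmas [multilinear] = linear_map_mult_left linear_map_mult_right module_axioms m_closed one_closed

end

context coalgebra
begin

lemma linear_map_comult:
  "linear_map K X H f \<Longrightarrow> linear_map K X (tensor K H H) (\<lambda>x. comult H (f x))"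
  by (rule linear_map_compose[OF _ comult_linear])

lemma comult_closed: "h \<in> carrier H \<Longrightarrow> comult H h \<in> carrier (tensor K H H)"
  by (rule linear_map_closed[OF comult_linear])

lemma linear_map_counit:
  assumes "module K W" "linear_map K X H f" "w \<in> carrier W"
  shows "linear_map K X W (\<lambda>x. counit H (f x) \<odot>\<^bsub>W\<^esub> w)"
proof -
  interpret W: module K W by fact
  show ?thesis
    by (rule linear_map_compose[OF assms(2)], rule linear_mapI)
      (simp_all add: assms(3) counit_closed counit_add counit_smult W.smult_l_distr W.smult_assoc1)
qed

lemmas [multilinear] = linear_map_comult comult_closed linear_map_counit module_axioms counit_closed

lemma sweedler_coassoc:
  assumes [multilinear]: "module K W" "trilinear_map K H H H W F" "h \<in> carrier H"
  shows "sweedler W (comult H h) (\<lambda>x h3. sweedler W (comult H x) (\<lambda>h1 h2. F h1 h2 h3)) =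
    sweedler W (comult H h) (\<lambda>h1 x. sweedler W (comult H x) (F h1))"
proof -
  have "sweedler W (comult H h) (\<lambda>x h3. sweedler W (comult H x) (\<lambda>h1 h2. F h1 h2 h3)) =
    sweedler W (sweedler (tensor K H (tensor K H H)) (comult H h) (\<lambda>x h3.
        sweedler (tensor K H (tensor K H H)) (comult H x) (\<lambda>h1 h2.
          pure_tensor K H (tensor K H H) h1 (pure_tensor K H H h2 h3))))
      (\<lambda>a u. sweedler W u (F a))"
    by (rule trilinear_eval_left[symmetric]) (assumption | rule multilinear)+
  also have "\<dots> = sweedler W (sweedler (tensor K H (tensor K H H)) (comult H h) (\<lambda>h1 x.
          pure_tensor K H (tensor K H H) h1 (comult H x))) (\<lambda>a u. sweedler W u (F a))"
    by (simp only: coassoc assms(3))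
  also have "\<dots> = sweedler W (comult H h) (\<lambda>h1 x. sweedler W (comult H x) (F h1))"
    by (rule trilinear_eval_right) (assumption | rule multilinear)+
  finally show ?thesis .
qed

text \<open>The counit axiom lives in H; pushed through a linear \<open>G\<close>, it applies to a
  leg deep inside a multilinear expression.\<close>

lemma linear_sweedler_counit_left:
  assumes [multilinear]: "module K W" "linear_map K H W G" "h \<in> carrier H"
  shows "sweedler W (comult H h) (\<lambda>h1 h2. counit H h1 \<odot>\<^bsub>W\<^esub> G h2) = G h"
proof -
  have "G (sweedler H (comult H h) (\<lambda>h1 h2. counit H h1 \<odot>\<^bsub>H\<^esub> h2)) =
      sweedler W (comult H h) (\<lambda>h1 h2. G (counit H h1 \<odot>\<^bsub>H\<^esub> h2))"
    by (rule sweedler_push) (assumption | rule multilinear)+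
  also have "\<dots> = sweedler W (comult H h) (\<lambda>h1 h2. counit H h1 \<odot>\<^bsub>W\<^esub> G h2)"
    by (rule sweedler_cong, (rule multilinear)+, rule linear_map_smult[OF assms(2)])
      (assumption | rule multilinear)+
  finally show ?thesis by (simp add: counit_left assms(3))
qed

lemma linear_sweedler_counit_right:
  assumes [multilinear]: "module K W" "linear_map K H W G" "h \<in> carrier H"
  shows "sweedler W (comult H h) (\<lambda>h1 h2. counit H h2 \<odot>\<^bsub>W\<^esub> G h1) = G h"
proof -
  have "G (sweedler H (comult H h) (\<lambda>h1 h2. counit H h2 \<odot>\<^bsub>H\<^esub> h1)) =
      sweedler W (comult H h) (\<lambda>h1 h2. G (counit H h2 \<odot>\<^bsub>H\<^esub> h1))"
    by (rule sweedler_push) (assumption | rule multilinear)+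
  also have "\<dots> = sweedler W (comult H h) (\<lambda>h1 h2. counit H h2 \<odot>\<^bsub>W\<^esub> G h1)"
    by (rule sweedler_cong, (rule multilinear)+, rule linear_map_smult[OF assms(2)])
      (assumption | rule multilinear)+
  finally show ?thesis by (simp add: counit_right assms(3))
qed

end

text \<open>The product in H \<otimes> H is the class of the list of all products of entries of two
  representatives. \<open>sweedler_class\<close> allows that list itself to be summed, and the sum
  over it is a double sum.\<close>

lemma (in unital_algebra) sweedler_tensor_mult:
  assumes [multilinear]: "module K W" "bilinear_map K H H W F"
    "s \<in> carrier (tensor K H H)" "t \<in> carrier (tensor K H H)"
  shows "sweedler W (s \<otimes>\<^bsub>tensor K H H\<^esub> t) F =
    sweedler W s (\<lambda>a b. sweedler W t (\<lambda>c d. F (a \<otimes>\<^bsub>H\<^esub> c) (b \<otimes>\<^bsub>H\<^esub> d)))"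
proof -
  interpret HH: tensor_product K H H by (intro tensor_product.intro module_axioms)
  interpret W: module K W by fact
  note closed = bilinear_map_closed[OF assms(2)]
  let ?p = "\<lambda>xs ys. concat (map (\<lambda>x. map (\<lambda>y. (fst x \<otimes>\<^bsub>H\<^esub> fst y, snd x \<otimes>\<^bsub>H\<^esub> snd y)) ys) xs)"
  have *: "tensor_sum W F (map (\<lambda>y. (fst x \<otimes>\<^bsub>H\<^esub> fst y, snd x \<otimes>\<^bsub>H\<^esub> snd y)) ys) =
      tensor_sum W (\<lambda>c d. F (fst x \<otimes>\<^bsub>H\<^esub> c) (snd x \<otimes>\<^bsub>H\<^esub> d)) ys" for x ys
    by (induction ys) auto
  \<comment> \<open>Membership and value are proved together: the sum over a row followed by the
    remaining rows splits only once those rows are known to lie in the carriers.\<close>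
  have **: "?p xs ys \<in> lists (carrier H \<times> carrier H) \<and> tensor_sum W F (?p xs ys) =
      tensor_sum W (\<lambda>a b. tensor_sum W (\<lambda>c d. F (a \<otimes>\<^bsub>H\<^esub> c) (b \<otimes>\<^bsub>H\<^esub> d)) ys) xs"
    if "xs \<in> lists (carrier H \<times> carrier H)" "ys \<in> lists (carrier H \<times> carrier H)" for xs ys
    using that(1)
  proof (induction xs)
    case (Cons p xs)
    then obtain a b where p: "p = (a, b)" "a \<in> carrier H" "b \<in> carrier H" by auto
    have row: "map (\<lambda>y. (a \<otimes>\<^bsub>H\<^esub> fst y, b \<otimes>\<^bsub>H\<^esub> snd y)) ys \<in> lists (carrier H \<times> carrier H)"
      using that(2) p by (induction ys) auto
    have "tensor_sum W F (map (\<lambda>y. (a \<otimes>\<^bsub>H\<^esub> fst y, b \<otimes>\<^bsub>H\<^esub> snd y)) ys @ ?p xs ys) =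
        tensor_sum W F (map (\<lambda>y. (a \<otimes>\<^bsub>H\<^esub> fst y, b \<otimes>\<^bsub>H\<^esub> snd y)) ys) \<oplus>\<^bsub>W\<^esub> tensor_sum W F (?p xs ys)"
      using listsD[OF row] listsD[OF conjunct1[OF Cons.IH]]
      by (intro W.tensor_sum_append closed) blast+
    then show ?case using Cons.IH row p *[of p ys] by simp
  qed simp
  have "s \<otimes>\<^bsub>tensor K H H\<^esub> t = tensor_class K H H (?p (tensor_rep s) (tensor_rep t))"
    by (simp add: tensor_def)
  moreover note rep = HH.tensor_rep(1)[OF assms(3)] HH.tensor_rep(1)[OF assms(4)]
  ultimately show ?thesis
    using **[OF rep] HH.sweedler_class[OF assms(1,2)] by (simp only: sweedler_tensor_sum)
qed

context hopf_algebra
begin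

lemma comult_one: "comult H \<one>\<^bsub>H\<^esub> = pure_tensor K H H \<one>\<^bsub>H\<^esub> \<one>\<^bsub>H\<^esub>"
  using ring_hom_one[OF comult_hom] by (simp add: tensor_def)

lemma counit_one: "counit H \<one>\<^bsub>H\<^esub> = \<one>\<^bsub>K\<^esub>"
  by (rule ring_hom_one[OF counit_hom])

lemma counit_mult:
  "\<lbrakk>x \<in> carrier H; y \<in> carrier H\<rbrakk> \<Longrightarrow> counit H (x \<otimes>\<^bsub>H\<^esub> y) = counit H x \<otimes>\<^bsub>K\<^esub> counit H y"
  by (rule ring_hom_mult[OF counit_hom])

lemma sweedler_comult_mult:
  assumes "module K W" "bilinear_map K H H W F" "x \<in> carrier H" "y \<in> carrier H"
  shows "sweedler W (comult H (x \<otimes>\<^bsub>H\<^esub> y)) F =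
    sweedler W (comult H x) (\<lambda>x1 x2. sweedler W (comult H y) (\<lambda>y1 y2.
      F (x1 \<otimes>\<^bsub>H\<^esub> y1) (x2 \<otimes>\<^bsub>H\<^esub> y2)))"
  using sweedler_tensor_mult[OF assms(1,2) comult_closed comult_closed] assms(3,4)
  by (simp add: ring_hom_mult[OF comult_hom])

lemma linear_map_antipode: "linear_map K X H f \<Longrightarrow> linear_map K X H (\<lambda>x. antipode H (f x))"
  by (rule linear_map_compose[OF _ antipode_linear])

lemma antipode_closed: "h \<in> carrier H \<Longrightarrow> antipode H h \<in> carrier H"
  by (rule linear_map_closed[OF antipode_linear])

lemmas [multilinear] = linear_map_antipode antipode_closed

lemma linear_sweedler_antipode_left:
  assumes [multilinear]: "module K W" "linear_map K H W G" "h \<in> carrier H"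
  shows "sweedler W (comult H h) (\<lambda>h1 h2. G (antipode H h1 \<otimes>\<^bsub>H\<^esub> h2)) = counit H h \<odot>\<^bsub>W\<^esub> G \<one>\<^bsub>H\<^esub>"
proof -
  have "G (sweedler H (comult H h) (\<lambda>h1 h2. antipode H h1 \<otimes>\<^bsub>H\<^esub> h2)) =
      sweedler W (comult H h) (\<lambda>h1 h2. G (antipode H h1 \<otimes>\<^bsub>H\<^esub> h2))"
    by (rule sweedler_push) (assumption | rule multilinear)+
  then show ?thesis
    by (simp add: antipode_left assms(3) counit_closed linear_map_smult[OF assms(2)])
qed

lemma linear_sweedler_antipode_right:
  assumes [multilinear]: "module K W" "linear_map K H W G" "h \<in> carrier H"
  shows "sweedler W (comult H h) (\<lambda>h1 h2. G (h1 \<otimes>\<^bsub>H\<^esub> antipode H h2)) = counit H h \<odot>\<^bsub>W\<^esub> G \<one>\<^bsub>H\<^esub>"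
proof -
  have "G (sweedler H (comult H h) (\<lambda>h1 h2. h1 \<otimes>\<^bsub>H\<^esub> antipode H h2)) =
      sweedler W (comult H h) (\<lambda>h1 h2. G (h1 \<otimes>\<^bsub>H\<^esub> antipode H h2))"
    by (rule sweedler_push) (assumption | rule multilinear)+
  then show ?thesis
    by (simp add: antipode_right assms(3) counit_closed linear_map_smult[OF assms(2)])
qed

text \<open>The left antipode law at 1, where \<Delta>(1) = 1 \<otimes> 1 and \<epsilon>(1) =
  1.\<close>

lemma antipode_one: "antipode H \<one>\<^bsub>H\<^esub> = \<one>\<^bsub>H\<^esub>"
proof -
  have "sweedler H (comult H \<one>\<^bsub>H\<^esub>) (\<lambda>h1 h2. antipode H h1 \<otimes>\<^bsub>H\<^esub> h2) =
      antipode H \<one>\<^bsub>H\<^esub> \<otimes>\<^bsub>H\<^esub> \<one>\<^bsub>H\<^esub>"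
    unfolding comult_one by (rule sweedler_pure) (assumption | rule multilinear)+
  moreover have "sweedler H (comult H \<one>\<^bsub>H\<^esub>) (\<lambda>h1 h2. antipode H h1 \<otimes>\<^bsub>H\<^esub> h2) = \<one>\<^bsub>H\<^esub>"
    by (simp add: antipode_left counit_one)
  ultimately show ?thesis by (simp add: antipode_closed)
qed

text \<open>
  In the convolution algebra of linear maps \<open>H \<otimes> H \<rightarrow> H\<close>, the map \<open>x \<otimes> y \<mapsto> S(x y)\<close> is a left inverse
  and \<open>x \<otimes> y \<mapsto> S(y) S(x)\<close> is a right inverse of the multiplication.
\<close>

lemma antipode_mult:
  assumes [multilinear]: "x \<in> carrier H" "y \<in> carrier H"
  shows "antipode H (x \<otimes>\<^bsub>H\<^esub> y) = antipode H y \<otimes>\<^bsub>H\<^esub> antipode H x"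
proof -
  let ?S = "antipode H"
  \<comment> \<open>The summand of the triple convolution product: the left inverse on the first
    legs, the multiplication on the second legs, the right inverse on the third.\<close>
  let ?P = "\<lambda>x1 x2 x3 y1 y2 y3. ?S (x1 \<otimes>\<^bsub>H\<^esub> y1) \<otimes>\<^bsub>H\<^esub> ((x2 \<otimes>\<^bsub>H\<^esub> y2) \<otimes>\<^bsub>H\<^esub> (?S y3 \<otimes>\<^bsub>H\<^esub> ?S x3))"
  let ?sw = "\<lambda>h. sweedler H (comult H h)"
  \<comment> \<open>Second and third legs: the sum over v collapses first, since y2 S(y3) is
    enclosed between x2 and S(x3).\<close>
  have right: "?sw u (\<lambda>x2 x3. ?sw v (\<lambda>y2 y3. ?P x1 x2 x3 y1 y2 y3)) =
      counit H u \<odot>\<^bsub>H\<^esub> (counit H v \<odot>\<^bsub>H\<^esub> ?S (x1 \<otimes>\<^bsub>H\<^esub> y1))"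
    if [multilinear]: "u \<in> carrier H" "v \<in> carrier H" "x1 \<in> carrier H" "y1 \<in> carrier H" for u v
        x1 y1
  proof -
    have "?sw u (\<lambda>x2 x3. ?sw v (\<lambda>y2 y3. ?P x1 x2 x3 y1 y2 y3)) =
        ?sw u (\<lambda>x2 x3. counit H v \<odot>\<^bsub>H\<^esub> (?S (x1 \<otimes>\<^bsub>H\<^esub> y1) \<otimes>\<^bsub>H\<^esub> (x2 \<otimes>\<^bsub>H\<^esub> ?S x3)))"
    proof (rule sweedler_cong, (rule multilinear)+)
      fix x2 x3 assume [multilinear]: "x2 \<in> carrier H" "x3 \<in> carrier H"
      have "?sw v (\<lambda>y2 y3. ?P x1 x2 x3 y1 y2 y3) =
          ?sw v (\<lambda>y2 y3. ?S (x1 \<otimes>\<^bsub>H\<^esub> y1) \<otimes>\<^bsub>H\<^esub> (x2 \<otimes>\<^bsub>H\<^esub> (y2 \<otimes>\<^bsub>H\<^esub> ?S y3) \<otimes>\<^bsub>H\<^esub> ?S x3))"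
        by (rule sweedler_cong, (rule multilinear)+) (simp add: m_assoc antipode_closed that
            \<open>x2 \<in> carrier H\<close> \<open>x3 \<in> carrier H\<close>)
      also have "\<dots> = counit H v \<odot>\<^bsub>H\<^esub>
          (?S (x1 \<otimes>\<^bsub>H\<^esub> y1) \<otimes>\<^bsub>H\<^esub> (x2 \<otimes>\<^bsub>H\<^esub> \<one>\<^bsub>H\<^esub> \<otimes>\<^bsub>H\<^esub> ?S x3))"
        by (rule linear_sweedler_antipode_right) (assumption | rule multilinear)+
      finally show "?sw v (\<lambda>y2 y3. ?P x1 x2 x3 y1 y2 y3) =
          counit H v \<odot>\<^bsub>H\<^esub> (?S (x1 \<otimes>\<^bsub>H\<^esub> y1) \<otimes>\<^bsub>H\<^esub> (x2 \<otimes>\<^bsub>H\<^esub> ?S x3))"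
        using \<open>x2 \<in> carrier H\<close> by simp
    qed
    also have "\<dots> = counit H u \<odot>\<^bsub>H\<^esub> (counit H v \<odot>\<^bsub>H\<^esub> (?S (x1 \<otimes>\<^bsub>H\<^esub> y1) \<otimes>\<^bsub>H\<^esub> \<one>\<^bsub>H\<^esub>))"
      by (rule linear_sweedler_antipode_right) (assumption | rule multilinear)+
    finally show ?thesis using that by (simp add: antipode_closed)
  qed
  \<comment> \<open>First and second legs: x1 y1 and x2 y2 are the legs of \<Delta>(u v), so the
    left antipode law applies to the product u v.\<close>
  have left: "?sw u (\<lambda>x1 x2. ?sw v (\<lambda>y1 y2. ?P x1 x2 x3 y1 y2 y3)) =
      counit H u \<odot>\<^bsub>H\<^esub> (counit H v \<odot>\<^bsub>H\<^esub> (?S y3 \<otimes>\<^bsub>H\<^esub> ?S x3))"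
    if [multilinear]: "u \<in> carrier H" "v \<in> carrier H" "x3 \<in> carrier H" "y3 \<in> carrier H" for u v
        x3 y3
  proof -
    have "?sw u (\<lambda>x1 x2. ?sw v (\<lambda>y1 y2. ?P x1 x2 x3 y1 y2 y3)) =
        ?sw (u \<otimes>\<^bsub>H\<^esub> v) (\<lambda>a b. ?S a \<otimes>\<^bsub>H\<^esub> (b \<otimes>\<^bsub>H\<^esub> (?S y3 \<otimes>\<^bsub>H\<^esub> ?S x3)))"
      by (rule sweedler_comult_mult[symmetric]) (assumption | rule multilinear)+
    also have "\<dots> = ?sw (u \<otimes>\<^bsub>H\<^esub> v) (\<lambda>a b. ?S a \<otimes>\<^bsub>H\<^esub> b \<otimes>\<^bsub>H\<^esub> (?S y3 \<otimes>\<^bsub>H\<^esub> ?S x3))"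
      by (rule sweedler_cong, (rule multilinear)+) (simp add: m_assoc antipode_closed that)
    also have "\<dots> = counit H (u \<otimes>\<^bsub>H\<^esub> v) \<odot>\<^bsub>H\<^esub> (\<one>\<^bsub>H\<^esub> \<otimes>\<^bsub>H\<^esub> (?S y3 \<otimes>\<^bsub>H\<^esub> ?S x3))"
      by (rule linear_sweedler_antipode_left) (assumption | rule multilinear)+
    finally show ?thesis
      using that by (simp add: antipode_closed counit_mult counit_closed smult_assoc1)
  qed
  \<comment> \<open>Collapsing the last two legs of \<open>E\<close> leaves S(x y); after
    coassociativity in x and in y, collapsing the first two leaves S(y) S(x).\<close>
  define E where "E = ?sw x (\<lambda>x1 u. ?sw u (\<lambda>x2 x3. ?sw y (\<lambda>y1 v. ?sw v (\<lambda>y2 y3.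
    ?P x1 x2 x3 y1 y2 y3))))"
  have "E = ?sw x (\<lambda>x1 u. counit H u \<odot>\<^bsub>H\<^esub> ?S (x1 \<otimes>\<^bsub>H\<^esub> y))"
    unfolding E_def
  proof (rule sweedler_cong, (rule multilinear)+)
    fix x1 u assume [multilinear]: "x1 \<in> carrier H" "u \<in> carrier H"
    have "?sw u (\<lambda>x2 x3. ?sw y (\<lambda>y1 v. ?sw v (\<lambda>y2 y3. ?P x1 x2 x3 y1 y2 y3))) =
        ?sw y (\<lambda>y1 v. ?sw u (\<lambda>x2 x3. ?sw v (\<lambda>y2 y3. ?P x1 x2 x3 y1 y2 y3)))"
      by (rule sweedler_swap) (assumption | rule multilinear)+
    also have "\<dots> = ?sw y (\<lambda>y1 v. counit H u \<odot>\<^bsub>H\<^esub> (counit H v \<odot>\<^bsub>H\<^esub> ?S (x1 \<otimes>\<^bsub>H\<^esub> y1)))"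
      by (rule sweedler_cong, (rule multilinear)+, rule right) (assumption | rule multilinear)+
    also have "\<dots> = counit H u \<odot>\<^bsub>H\<^esub> ?sw y (\<lambda>y1 v. counit H v \<odot>\<^bsub>H\<^esub> ?S (x1 \<otimes>\<^bsub>H\<^esub> y1))"
      by (rule sweedler_push[symmetric]) (assumption | rule multilinear)+
    also have "?sw y (\<lambda>y1 v. counit H v \<odot>\<^bsub>H\<^esub> ?S (x1 \<otimes>\<^bsub>H\<^esub> y1)) = ?S (x1 \<otimes>\<^bsub>H\<^esub> y)"
      by (rule linear_sweedler_counit_right) (assumption | rule multilinear)+
    finally show "?sw u (\<lambda>x2 x3. ?sw y (\<lambda>y1 v. ?sw v (\<lambda>y2 y3. ?P x1 x2 x3 y1 y2 y3))) =
        counit H u \<odot>\<^bsub>H\<^esub> ?S (x1 \<otimes>\<^bsub>H\<^esub> y)" .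
  qed
  also have "\<dots> = ?S (x \<otimes>\<^bsub>H\<^esub> y)"
    by (rule linear_sweedler_counit_right) (assumption | rule multilinear)+
  finally have "E = ?S (x \<otimes>\<^bsub>H\<^esub> y)" .
  moreover have "E = ?sw x (\<lambda>u x3. ?sw u (\<lambda>x1 x2. ?sw y (\<lambda>y1 v. ?sw v (\<lambda>y2 y3.
      ?P x1 x2 x3 y1 y2 y3))))"
    unfolding E_def by (rule sweedler_coassoc[symmetric]) (assumption | rule multilinear)+
  moreover have "\<dots> = ?sw x (\<lambda>u x3. counit H u \<odot>\<^bsub>H\<^esub> (?S y \<otimes>\<^bsub>H\<^esub> ?S x3))"
  proof (rule sweedler_cong, (rule multilinear)+)
    fix u x3 assume [multilinear]: "u \<in> carrier H" "x3 \<in> carrier H"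
    have "?sw u (\<lambda>x1 x2. ?sw y (\<lambda>y1 v. ?sw v (\<lambda>y2 y3. ?P x1 x2 x3 y1 y2 y3))) =
        ?sw u (\<lambda>x1 x2. ?sw y (\<lambda>v y3. ?sw v (\<lambda>y1 y2. ?P x1 x2 x3 y1 y2 y3)))"
      by (rule sweedler_cong, (rule multilinear)+, rule sweedler_coassoc[symmetric])
        (assumption | rule multilinear)+
    also have "\<dots> = ?sw y (\<lambda>v y3. ?sw u (\<lambda>x1 x2. ?sw v (\<lambda>y1 y2. ?P x1 x2 x3 y1 y2 y3)))"
      by (rule sweedler_swap) (assumption | rule multilinear)+
    also have "\<dots> = ?sw y (\<lambda>v y3. counit H u \<odot>\<^bsub>H\<^esub> (counit H v \<odot>\<^bsub>H\<^esub> (?S y3 \<otimes>\<^bsub>H\<^esub> ?S x3)))"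
      by (rule sweedler_cong, (rule multilinear)+, rule left) (assumption | rule multilinear)+
    also have "\<dots> = counit H u \<odot>\<^bsub>H\<^esub> ?sw y (\<lambda>v y3. counit H v \<odot>\<^bsub>H\<^esub> (?S y3 \<otimes>\<^bsub>H\<^esub> ?S x3))"
      by (rule sweedler_push[symmetric]) (assumption | rule multilinear)+
    also have "?sw y (\<lambda>v y3. counit H v \<odot>\<^bsub>H\<^esub> (?S y3 \<otimes>\<^bsub>H\<^esub> ?S x3)) = ?S y \<otimes>\<^bsub>H\<^esub> ?S x3"
      by (rule linear_sweedler_counit_left) (assumption | rule multilinear)+
    finally show "?sw u (\<lambda>x1 x2. ?sw y (\<lambda>y1 v. ?sw v (\<lambda>y2 y3. ?P x1 x2 x3 y1 y2 y3))) =
        counit H u \<odot>\<^bsub>H\<^esub> (?S y \<otimes>\<^bsub>H\<^esub> ?S x3)" .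
  qed
  moreover have "\<dots> = ?S y \<otimes>\<^bsub>H\<^esub> ?S x"
    by (rule linear_sweedler_counit_left) (assumption | rule multilinear)+
  ultimately show ?thesis by simp
qed

text \<open>
  The scheme \<open>h\<^sup>(\<^sup>1\<^sup>) \<otimes> h\<^sup>(\<^sup>2\<^sup>) \<otimes> c(h\<^sup>(\<^sup>3\<^sup>), h\<^sup>(\<^sup>4\<^sup>)) \<otimes> h\<^sup>(\<^sup>5\<^sup>) \<otimes> h\<^sup>(\<^sup>6\<^sup>) =
  h\<^sup>(\<^sup>1\<^sup>) \<otimes> h\<^sup>(\<^sup>2\<^sup>) \<otimes> 1 \<otimes> h\<^sup>(\<^sup>3\<^sup>) \<otimes> h\<^sup>(\<^sup>4\<^sup>)\<close> common to the four types: \<open>c(x, y)\<close> is \<open>S(x) y\<close>,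
  \<open>S\<^sup>-\<^sup>1(y) x\<close>, \<open>y S\<^sup>-\<^sup>1(x)\<close> or \<open>x S(y)\<close>.
\<close>

lemma sweedler_cancel:
  assumes [multilinear]: "module K W" "h \<in> carrier H"
    and c: "bilinear_map K H H H c"
      "\<And>h. h \<in> carrier H \<Longrightarrow> sweedler H (comult H h) c = counit H h \<odot>\<^bsub>H\<^esub> \<one>\<^bsub>H\<^esub>"
    and F: "\<And>b z p q. \<lbrakk>b \<in> carrier H; z \<in> carrier H; p \<in> carrier H; q \<in> carrier H\<rbrakk> \<Longrightarrow>
        linear_map K H W (\<lambda>a. F a b z p q)"
      "\<And>a z p q. \<lbrakk>a \<in> carrier H; z \<in> carrier H; p \<in> carrier H; q \<in> carrier H\<rbrakk> \<Longrightarrow>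
        linear_map K H W (\<lambda>b. F a b z p q)"
      "\<And>a b p q. \<lbrakk>a \<in> carrier H; b \<in> carrier H; p \<in> carrier H; q \<in> carrier H\<rbrakk> \<Longrightarrow>
        linear_map K H W (\<lambda>z. F a b z p q)"
      "\<And>a b z q. \<lbrakk>a \<in> carrier H; b \<in> carrier H; z \<in> carrier H; q \<in> carrier H\<rbrakk> \<Longrightarrow>
        linear_map K H W (\<lambda>p. F a b z p q)"
      "\<And>a b z p. \<lbrakk>a \<in> carrier H; b \<in> carrier H; z \<in> carrier H; p \<in> carrier H\<rbrakk> \<Longrightarrow>
        linear_map K H W (\<lambda>q. F a b z p q)"
  shows "sweedler W (comult H h) (\<lambda>h1 h2.
      sweedler3 H W h1 (\<lambda>a1 a2 a3. sweedler3 H W h2 (\<lambda>b1 b2 b3. F a1 a2 (c a3 b1) b2 b3))) =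
    sweedler3 H W h (\<lambda>h1 h2 h3. sweedler W (comult H h2) (\<lambda>p q. F h1 p \<one>\<^bsub>H\<^esub> q h3))"
proof -
  note [multilinear] = F linear_map_closed[OF F(1)] bilinear_mapD[OF c(1)]
    bilinear_map_closed[OF c(1)]
  \<comment> \<open>The legs a3 and b1 reach \<open>F\<close> only through \<open>c\<close>, so
    linearity in them is that of \<open>c\<close> followed by that of the third slot of
    \<open>F\<close>.\<close>
  note [multilinear] = linear_map_compose[OF bilinear_mapD(1)[OF c(1)] F(3)]
    linear_map_compose[OF bilinear_mapD(2)[OF c(1)] F(3)]
  let ?sw = "\<lambda>h. sweedler W (comult H h)"
  \<comment> \<open>With the first two legs frozen, the arguments of \<open>?G\<close> are the third
    leg and the element from which all later legs are split off.\<close>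
  let ?G = "\<lambda>a1 a2 a3 y. ?sw y (\<lambda>b1 z. ?sw z (\<lambda>b2 b3. F a1 a2 (c a3 b1) b2 b3))"
  have cancel: "?sw x (?G a1 a2) = ?sw x (F a1 a2 \<one>\<^bsub>H\<^esub>)"
    if [multilinear]: "x \<in> carrier H" "a1 \<in> carrier H" "a2 \<in> carrier H" for x a1 a2
  proof -
    let ?R = "\<lambda>z w. ?sw w (\<lambda>b2 b3. F a1 a2 z b2 b3)"
    \<comment> \<open>Coassociativity brings the third and fourth legs under one \<Delta>(y), as the
      law for \<open>c\<close> requires; the resulting \<epsilon>(y) is absorbed by the other leg
      w.\<close>
    have "?sw x (?G a1 a2) = ?sw x (\<lambda>y w. ?sw y (\<lambda>a3 b1. ?R (c a3 b1) w))"
      by (rule sweedler_coassoc[symmetric]) (assumption | rule multilinear)+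
    also have "\<dots> = ?sw x (\<lambda>y w. counit H y \<odot>\<^bsub>W\<^esub> ?R \<one>\<^bsub>H\<^esub> w)"
    proof (rule sweedler_cong, (rule multilinear)+)
      fix y w assume [multilinear]: "y \<in> carrier H" "w \<in> carrier H"
      have R: "linear_map K H W (\<lambda>z. ?R z w)" by (assumption | rule multilinear)+
      have "?sw y (\<lambda>a3 b1. ?R (c a3 b1) w) = ?R (sweedler H (comult H y) c) w"
        by (rule sweedler_push[OF _ _ _ _ R, symmetric]) (assumption | rule multilinear)+
      also have "\<dots> = counit H y \<odot>\<^bsub>W\<^esub> ?R \<one>\<^bsub>H\<^esub> w"
        using \<open>y \<in> carrier H\<close> by (simp add: c(2) linear_map_smult[OF R] counit_closed)
      finally show "?sw y (\<lambda>a3 b1. ?R (c a3 b1) w) = counit H y \<odot>\<^bsub>W\<^esub> ?R \<one>\<^bsub>H\<^esub> w" .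
    qed
    also have "\<dots> = ?R \<one>\<^bsub>H\<^esub> x"
      by (rule linear_sweedler_counit_left) (assumption | rule multilinear)+
    finally show ?thesis .
  qed
  \<comment> \<open>Rebracketing into two single legs and a last element that carries the other
    four, to which \<open>cancel\<close> applies.\<close>
  have "?sw h (\<lambda>h1 h2. ?sw h1 (\<lambda>a1 x. ?sw x (\<lambda>a2 a3. ?G a1 a2 a3 h2))) =
      ?sw h (\<lambda>a1 x. ?sw x (\<lambda>u h2. ?sw u (\<lambda>a2 a3. ?G a1 a2 a3 h2)))"
    by (rule sweedler_coassoc) (assumption | rule multilinear)+
  also have "\<dots> = ?sw h (\<lambda>a1 x. ?sw x (\<lambda>a2 y. ?sw y (?G a1 a2)))"
    by (rule sweedler_cong, (rule multilinear)+, rule sweedler_coassoc) (assumption | rule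
        multilinear)+
  also have "\<dots> = ?sw h (\<lambda>a1 x. ?sw x (\<lambda>a2 y. ?sw y (F a1 a2 \<one>\<^bsub>H\<^esub>)))"
    by (rule sweedler_cong, (rule multilinear)+, rule sweedler_cong)
      (assumption | rule multilinear cancel)+
  \<comment> \<open>Of the four legs left, the middle two are grouped under h2, because the action
    of h2 on a tensor product splits h2 once more.\<close>
  also have "\<dots> = ?sw h (\<lambda>h1 x. ?sw x (\<lambda>h2 h3. ?sw h2 (\<lambda>p q. F h1 p \<one>\<^bsub>H\<^esub> q h3)))"
    by (rule sweedler_cong, (rule multilinear)+, rule sweedler_coassoc[symmetric])
      (assumption | rule multilinear)+
  finally show ?thesis by (simp only: sweedler3_def)
qed

end

section \<open>The inverse of the antipode\<close>

locale hopf_algebra_bij = hopf_algebra +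
  assumes bij_antipode: "bij_betw (antipode H) (carrier H) (carrier H)"
begin

lemma antipode_antipode_inv: "h \<in> carrier H \<Longrightarrow> antipode H (antipode_inv H h) = h"
  unfolding antipode_inv_def by (rule bij_betw_inv_into_right[OF bij_antipode])

lemma antipode_inv_closed: "h \<in> carrier H \<Longrightarrow> antipode_inv H h \<in> carrier H"
  unfolding antipode_inv_def
  by (metis bij_antipode bij_betw_imp_surj_on inv_into_into)

lemma antipode_injD:
  "\<lbrakk>antipode H x = antipode H y; x \<in> carrier H; y \<in> carrier H\<rbrakk> \<Longrightarrow> x = y"
  by (metis bij_antipode bij_betw_imp_inj_on inj_onD)

text \<open>S is injective and linear, so the two sides may be compared after S has been applied to
  them.\<close>

lemma antipode_inv_linear: "linear_map K H H (antipode_inv H)"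
proof (rule linear_mapI)
  fix x assume x: "x \<in> carrier H"
  show "antipode_inv H x \<in> carrier H" using x by (rule antipode_inv_closed)
  show "antipode_inv H (x \<oplus>\<^bsub>H\<^esub> y) = antipode_inv H x \<oplus>\<^bsub>H\<^esub> antipode_inv H y" if "y \<in> carrier H" for y
    by (rule antipode_injD)
      (simp_all add: x that antipode_antipode_inv antipode_inv_closed linear_map_add[OF
          antipode_linear])
  show "antipode_inv H (c \<odot>\<^bsub>H\<^esub> x) = c \<odot>\<^bsub>H\<^esub> antipode_inv H x" if "c \<in> carrier K" for c
    by (rule antipode_injD)
      (simp_all add: x that antipode_antipode_inv antipode_inv_closed linear_map_smult[OF
          antipode_linear])
qed

lemma linear_map_antipode_inv:
  "linear_map K X H f \<Longrightarrow> linear_map K X H (\<lambda>x. antipode_inv H (f x))"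
  by (rule linear_map_compose[OF _ antipode_inv_linear])

lemmas [multilinear] = linear_map_antipode_inv antipode_inv_closed

lemma antipode_inv_left:
  assumes [multilinear]: "h \<in> carrier H"
  shows "sweedler H (comult H h) (\<lambda>h1 h2. antipode_inv H h2 \<otimes>\<^bsub>H\<^esub> h1) = counit H h \<odot>\<^bsub>H\<^esub> \<one>\<^bsub>H\<^esub>"
proof (rule antipode_injD)
  have "antipode H (sweedler H (comult H h) (\<lambda>h1 h2. antipode_inv H h2 \<otimes>\<^bsub>H\<^esub> h1)) =
      sweedler H (comult H h) (\<lambda>h1 h2. antipode H (antipode_inv H h2 \<otimes>\<^bsub>H\<^esub> h1))"
    by (rule sweedler_push) (assumption | rule multilinear)+
  \<comment> \<open>S(S^-1(h2) h1) = S(h1) h2: reversing the product restores the order of the legs,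
    and the left law for S applies.\<close>
  also have "\<dots> = sweedler H (comult H h) (\<lambda>h1 h2. antipode H h1 \<otimes>\<^bsub>H\<^esub> h2)"
    by (rule sweedler_cong, (rule multilinear)+)
      (simp add: antipode_mult antipode_antipode_inv antipode_inv_closed)
  finally show "antipode H (sweedler H (comult H h) (\<lambda>h1 h2. antipode_inv H h2 \<otimes>\<^bsub>H\<^esub> h1)) =
      antipode H (counit H h \<odot>\<^bsub>H\<^esub> \<one>\<^bsub>H\<^esub>)"
    using assms by (simp add: antipode_left linear_map_smult[OF antipode_linear] counit_closed
        antipode_one)
qed (assumption | rule multilinear)+

lemma antipode_inv_right:
  assumes [multilinear]: "h \<in> carrier H"
  shows "sweedler H (comult H h) (\<lambda>h1 h2. h2 \<otimes>\<^bsub>H\<^esub> antipode_inv H h1) = counit H h \<odot>\<^bsub>H\<^esub> \<one>\<^bsub>H\<^esub>"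
proof (rule antipode_injD)
  have "antipode H (sweedler H (comult H h) (\<lambda>h1 h2. h2 \<otimes>\<^bsub>H\<^esub> antipode_inv H h1)) =
      sweedler H (comult H h) (\<lambda>h1 h2. antipode H (h2 \<otimes>\<^bsub>H\<^esub> antipode_inv H h1))"
    by (rule sweedler_push) (assumption | rule multilinear)+
  \<comment> \<open>S(h2 S^-1(h1)) = h1 S(h2), which leads to the right law for S.\<close>
  also have "\<dots> = sweedler H (comult H h) (\<lambda>h1 h2. h1 \<otimes>\<^bsub>H\<^esub> antipode H h2)"
    by (rule sweedler_cong, (rule multilinear)+)
      (simp add: antipode_mult antipode_antipode_inv antipode_inv_closed)
  finally show "antipode H (sweedler H (comult H h) (\<lambda>h1 h2. h2 \<otimes>\<^bsub>H\<^esub> antipode_inv H h1)) =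
      antipode H (counit H h \<odot>\<^bsub>H\<^esub> \<one>\<^bsub>H\<^esub>)"
    using assms by (simp add: antipode_right linear_map_smult[OF antipode_linear] counit_closed
        antipode_one)
qed (assumption | rule multilinear)+

end

section \<open>Tensor products of modules\<close>

context left_module
begin

lemma linear_map_act_left:
  "\<lbrakk>linear_map K X H f; m \<in> carrier M\<rbrakk> \<Longrightarrow> linear_map K X M (\<lambda>x. act (f x) m)"
  by (rule linear_map_compose[OF _ act_linear_left])

lemma linear_map_act_right:
  "\<lbrakk>h \<in> carrier H; linear_map K X M f\<rbrakk> \<Longrightarrow> linear_map K X M (\<lambda>x. act h (f x))"
  by (rule linear_map_compose[OF _ act_linear_right])

lemma act_closed: "\<lbrakk>h \<in> carrier H; m \<in> carrier M\<rbrakk> \<Longrightarrow> act h m \<in> carrier M"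
  by (rule linear_map_closed[OF act_linear_right])

lemmas [multilinear] = linear_map_act_left linear_map_act_right act_closed M.module_axioms

end

context right_module
begin

lemma linear_map_act_left:
  "\<lbrakk>linear_map K X M f; h \<in> carrier H\<rbrakk> \<Longrightarrow> linear_map K X M (\<lambda>x. act (f x) h)"
  by (rule linear_map_compose[OF _ act_linear_left])

lemma linear_map_act_right:
  "\<lbrakk>m \<in> carrier M; linear_map K X H f\<rbrakk> \<Longrightarrow> linear_map K X M (\<lambda>x. act m (f x))"
  by (rule linear_map_compose[OF _ act_linear_right])

lemma act_closed: "\<lbrakk>m \<in> carrier M; h \<in> carrier H\<rbrakk> \<Longrightarrow> act m h \<in> carrier M"
  by (rule linear_map_closed[OF act_linear_left])

lemmas [multilinear] = linear_map_act_left linear_map_act_right act_closed M.module_axioms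

end

context hopf_algebra
begin

text \<open>
  \<open>\<rho>\<close> is an action of \<open>H \<otimes> H\<close> on \<open>V\<close>, here restricted along the comultiplication.
  Exchanging the two arguments of \<open>\<rho>\<close> yields the opposite comultiplication.
\<close>

lemma left_module_comult:
  assumes [multilinear]: "module K V"
    and \<rho>: "trilinear_map K H H V V \<rho>"
    and one: "\<And>v. v \<in> carrier V \<Longrightarrow> \<rho> \<one>\<^bsub>H\<^esub> \<one>\<^bsub>H\<^esub> v = v"
    and mult: "\<And>g1 g2 h1 h2 v. \<lbrakk>g1 \<in> carrier H; g2 \<in> carrier H; h1 \<in> carrier H; h2 \<in> carrier H;
      v \<in> carrier V\<rbrakk> \<Longrightarrow> \<rho> (g1 \<otimes>\<^bsub>H\<^esub> h1) (g2 \<otimes>\<^bsub>H\<^esub> h2) v = \<rho> g1 g2 (\<rho> h1 h2 v)"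
  shows "left_module K H V (\<lambda>h v. sweedler V (comult H h) (\<lambda>h1 h2. \<rho> h1 h2 v))"
proof (intro left_module.intro left_module_axioms.intro unital_algebra_axioms assms(1))
  note [multilinear] = trilinear_mapD[OF \<rho>] linear_map_closed[OF trilinear_mapD(1)[OF \<rho>]]
  show "linear_map K V V (\<lambda>v. sweedler V (comult H h) (\<lambda>h1 h2. \<rho> h1 h2 v))"
    if "h \<in> carrier H" for h
    using that by - (assumption | rule multilinear)+
  fix v assume v [multilinear]: "v \<in> carrier V"
  show "linear_map K H V (\<lambda>h. sweedler V (comult H h) (\<lambda>h1 h2. \<rho> h1 h2 v))"
    by (assumption | rule multilinear)+
  have "sweedler V (comult H \<one>\<^bsub>H\<^esub>) (\<lambda>h1 h2. \<rho> h1 h2 v) = \<rho> \<one>\<^bsub>H\<^esub> \<one>\<^bsub>H\<^esub> v"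
    unfolding comult_one by (rule sweedler_pure) (assumption | rule multilinear)+
  with one v show "sweedler V (comult H \<one>\<^bsub>H\<^esub>) (\<lambda>h1 h2. \<rho> h1 h2 v) = v" by simp
  fix g h assume [multilinear]: "g \<in> carrier H" "h \<in> carrier H"
  have "sweedler V (comult H (g \<otimes>\<^bsub>H\<^esub> h)) (\<lambda>h1 h2. \<rho> h1 h2 v) =
      sweedler V (comult H g) (\<lambda>g1 g2. sweedler V (comult H h) (\<lambda>h1 h2.
        \<rho> (g1 \<otimes>\<^bsub>H\<^esub> h1) (g2 \<otimes>\<^bsub>H\<^esub> h2) v))"
    by (rule sweedler_comult_mult) (assumption | rule multilinear)+
  also have "\<dots> = sweedler V (comult H g) (\<lambda>g1 g2. sweedler V (comult H h) (\<lambda>h1 h2.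
        \<rho> g1 g2 (\<rho> h1 h2 v)))"
    by (rule sweedler_cong, (rule multilinear)+, rule sweedler_cong)
      (assumption | rule multilinear mult)+
  also have "\<dots> = sweedler V (comult H g) (\<lambda>g1 g2.
      \<rho> g1 g2 (sweedler V (comult H h) (\<lambda>h1 h2. \<rho> h1 h2 v)))"
    by (rule sweedler_cong, (rule multilinear)+, rule sweedler_push[symmetric])
      (assumption | rule multilinear)+
  finally show "sweedler V (comult H (g \<otimes>\<^bsub>H\<^esub> h)) (\<lambda>h1 h2. \<rho> h1 h2 v) =
      sweedler V (comult H g) (\<lambda>g1 g2.
        \<rho> g1 g2 (sweedler V (comult H h) (\<lambda>h1 h2. \<rho> h1 h2 v)))" .
qed

lemma right_module_comult:
  assumes [multilinear]: "module K V"
    and \<rho>: "trilinear_map K H H V V \<rho>"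
    and one: "\<And>v. v \<in> carrier V \<Longrightarrow> \<rho> \<one>\<^bsub>H\<^esub> \<one>\<^bsub>H\<^esub> v = v"
    and mult: "\<And>g1 g2 h1 h2 v. \<lbrakk>g1 \<in> carrier H; g2 \<in> carrier H; h1 \<in> carrier H; h2 \<in> carrier H;
      v \<in> carrier V\<rbrakk> \<Longrightarrow> \<rho> (g1 \<otimes>\<^bsub>H\<^esub> h1) (g2 \<otimes>\<^bsub>H\<^esub> h2) v = \<rho> h1 h2 (\<rho> g1 g2 v)"
  shows "right_module K H V (\<lambda>v h. sweedler V (comult H h) (\<lambda>h1 h2. \<rho> h1 h2 v))"
proof (intro right_module.intro right_module_axioms.intro unital_algebra_axioms assms(1))
  note [multilinear] = trilinear_mapD[OF \<rho>] linear_map_closed[OF trilinear_mapD(1)[OF \<rho>]]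
  show "linear_map K V V (\<lambda>v. sweedler V (comult H h) (\<lambda>h1 h2. \<rho> h1 h2 v))"
    if "h \<in> carrier H" for h
    using that by - (assumption | rule multilinear)+
  fix v assume v [multilinear]: "v \<in> carrier V"
  show "linear_map K H V (\<lambda>h. sweedler V (comult H h) (\<lambda>h1 h2. \<rho> h1 h2 v))"
    by (assumption | rule multilinear)+
  have "sweedler V (comult H \<one>\<^bsub>H\<^esub>) (\<lambda>h1 h2. \<rho> h1 h2 v) = \<rho> \<one>\<^bsub>H\<^esub> \<one>\<^bsub>H\<^esub> v"
    unfolding comult_one by (rule sweedler_pure) (assumption | rule multilinear)+
  with one v show "sweedler V (comult H \<one>\<^bsub>H\<^esub>) (\<lambda>h1 h2. \<rho> h1 h2 v) = v" by simp
  fix g h assume [multilinear]: "g \<in> carrier H" "h \<in> carrier H"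
  have "sweedler V (comult H (g \<otimes>\<^bsub>H\<^esub> h)) (\<lambda>h1 h2. \<rho> h1 h2 v) =
      sweedler V (comult H g) (\<lambda>g1 g2. sweedler V (comult H h) (\<lambda>h1 h2.
        \<rho> (g1 \<otimes>\<^bsub>H\<^esub> h1) (g2 \<otimes>\<^bsub>H\<^esub> h2) v))"
    by (rule sweedler_comult_mult) (assumption | rule multilinear)+
  also have "\<dots> = sweedler V (comult H g) (\<lambda>g1 g2. sweedler V (comult H h) (\<lambda>h1 h2.
        \<rho> h1 h2 (\<rho> g1 g2 v)))"
    by (rule sweedler_cong, (rule multilinear)+, rule sweedler_cong)
      (assumption | rule multilinear mult)+
  \<comment> \<open>Under a right action g acts before h, so the sum over \<Delta>(g) has to become
    the inner one before \<rho> h1 h2 can be taken out of it.\<close>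
  also have "\<dots> = sweedler V (comult H h) (\<lambda>h1 h2. sweedler V (comult H g) (\<lambda>g1 g2.
        \<rho> h1 h2 (\<rho> g1 g2 v)))"
    by (rule sweedler_swap) (assumption | rule multilinear)+
  also have "\<dots> = sweedler V (comult H h) (\<lambda>h1 h2.
      \<rho> h1 h2 (sweedler V (comult H g) (\<lambda>g1 g2. \<rho> g1 g2 v)))"
    by (rule sweedler_cong, (rule multilinear)+, rule sweedler_push[symmetric])
      (assumption | rule multilinear)+
  finally show "sweedler V (comult H (g \<otimes>\<^bsub>H\<^esub> h)) (\<lambda>h1 h2. \<rho> h1 h2 v) =
      sweedler V (comult H h) (\<lambda>h1 h2.
        \<rho> h1 h2 (sweedler V (comult H g) (\<lambda>g1 g2. \<rho> g1 g2 v)))" .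
qed

end

section \<open>Left modules\<close>

locale tensor_left_modules =
  hopf_algebra K H + A: left_module K H A actA + B: left_module K H B actB
  for K :: "'k ring" and H :: "('k, 'h) hopf"
    and A :: "('k, 'a) module" and actA and B :: "('k, 'b) module" and actB
begin

text \<open>The action of g \<otimes> h, curried so that the legs of \<Delta> can be inserted in
  either order; one proof of the module laws then serves both the plain and the swapped
  action.\<close>

definition "act2 g h t = sweedler (tensor K A B) t (\<lambda>x y. pure_tensor K A B (actA g x) (actB h y))"

lemma act2_trilinear: "trilinear_map K H H (tensor K A B) (tensor K A B) act2"
  unfolding act2_def by (assumption | rule multilinear)+

lemma act2_pure:
  assumes [multilinear]: "g \<in> carrier H" "h \<in> carrier H" "x \<in> carrier A" "y \<in> carrier B"
  shows "act2 g h (pure_tensor K A B x y) = pure_tensor K A B (actA g x) (actB h y)"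
  unfolding act2_def by (rule sweedler_pure) (assumption | rule multilinear)+

lemmas [multilinear] = trilinear_mapD[OF act2_trilinear]
  linear_map_compose[OF _ trilinear_mapD(1)[OF act2_trilinear]]
  linear_map_compose[OF _ trilinear_mapD(2)[OF act2_trilinear]]
  linear_map_compose[OF _ trilinear_mapD(3)[OF act2_trilinear]]
  linear_map_closed[OF trilinear_mapD(1)[OF act2_trilinear]]

lemma act2_one:
  assumes "t \<in> carrier (tensor K A B)"
  shows "act2 \<one>\<^bsub>H\<^esub> \<one>\<^bsub>H\<^esub> t = t"
proof (rule linear_map_eq_on_tensor[OF _ _ _ _ _ _ assms])
  show "act2 \<one>\<^bsub>H\<^esub> \<one>\<^bsub>H\<^esub> (pure_tensor K A B x y) = pure_tensor K A B x y"
    if "x \<in> carrier A" "y \<in> carrier B" for x y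
    using that by (simp add: act2_pure A.act_one B.act_one)
qed (assumption | rule multilinear)+

lemma act2_mult:
  assumes [multilinear]: "g1 \<in> carrier H" "g2 \<in> carrier H" "h1 \<in> carrier H" "h2 \<in> carrier H"
    and t: "t \<in> carrier (tensor K A B)"
  shows "act2 (g1 \<otimes>\<^bsub>H\<^esub> h1) (g2 \<otimes>\<^bsub>H\<^esub> h2) t = act2 g1 g2 (act2 h1 h2 t)"
proof (rule linear_map_eq_on_tensor[OF _ _ _ _ _ _ t])
  show "act2 (g1 \<otimes>\<^bsub>H\<^esub> h1) (g2 \<otimes>\<^bsub>H\<^esub> h2) (pure_tensor K A B x y) =
      act2 g1 g2 (act2 h1 h2 (pure_tensor K A B x y))"
    if "x \<in> carrier A" "y \<in> carrier B" for x y
    using that assms(1-4)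
    by (simp add: act2_pure A.act_mult B.act_mult A.act_closed B.act_closed)
qed (assumption | rule multilinear)+

lemma tensor_left_act_eq:
  "tensor_left_act K H A B actA actB =
    (\<lambda>h t. sweedler (tensor K A B) (comult H h) (\<lambda>h1 h2. act2 h1 h2 t))"
  by (intro ext) (simp add: tensor_left_act_def act2_def)

lemma tensor_left_act_swap_eq:
  "tensor_left_act_swap K H A B actA actB =
    (\<lambda>h t. sweedler (tensor K A B) (comult H h) (\<lambda>h1 h2. act2 h2 h1 t))"
  by (intro ext) (simp add: tensor_left_act_swap_def act2_def)

lemma left_module_tensor: "left_module K H (tensor K A B) (tensor_left_act K H A B actA actB)"
  unfolding tensor_left_act_eq
  by (rule left_module_comult) (assumption | rule act2_one act2_mult multilinear)+

lemma left_module_tensor_swap: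
  "left_module K H (tensor K A B) (tensor_left_act_swap K H A B actA actB)"
  unfolding tensor_left_act_swap_eq
  by (rule left_module_comult) (assumption | rule act2_one act2_mult multilinear)+

lemma tensor_left_act_pure:
  assumes [multilinear]: "h \<in> carrier H" "x \<in> carrier A" "y \<in> carrier B"
  shows "tensor_left_act K H A B actA actB h (pure_tensor K A B x y) =
    sweedler (tensor K A B) (comult H h) (\<lambda>h1 h2. pure_tensor K A B (actA h1 x) (actB h2 y))"
  unfolding tensor_left_act_eq
  by (rule sweedler_cong) (assumption | rule act2_pure multilinear)+

lemma tensor_left_act_swap_pure:
  assumes [multilinear]: "h \<in> carrier H" "x \<in> carrier A" "y \<in> carrier B"
  shows "tensor_left_act_swap K H A B actA actB h (pure_tensor K A B x y) =
    sweedler (tensor K A B) (comult H h) (\<lambda>h1 h2. pure_tensor K A B (actA h2 x) (actB h1 y))"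
  unfolding tensor_left_act_swap_eq
  by (rule sweedler_cong) (assumption | rule act2_pure multilinear)+

end

section \<open>Right modules\<close>

locale tensor_right_modules =
  hopf_algebra K H + A: right_module K H A actA + B: right_module K H B actB
  for K :: "'k ring" and H :: "('k, 'h) hopf"
    and A :: "('k, 'a) module" and actA and B :: "('k, 'b) module" and actB
begin

definition "act2 g h t = sweedler (tensor K A B) t (\<lambda>x y. pure_tensor K A B (actA x g) (actB y h))"

lemma act2_trilinear: "trilinear_map K H H (tensor K A B) (tensor K A B) act2"
  unfolding act2_def by (assumption | rule multilinear)+

lemma act2_pure:
  assumes [multilinear]: "g \<in> carrier H" "h \<in> carrier H" "x \<in> carrier A" "y \<in> carrier B"
  shows "act2 g h (pure_tensor K A B x y) = pure_tensor K A B (actA x g) (actB y h)"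
  unfolding act2_def by (rule sweedler_pure) (assumption | rule multilinear)+

lemmas [multilinear] = trilinear_mapD[OF act2_trilinear]
  linear_map_compose[OF _ trilinear_mapD(1)[OF act2_trilinear]]
  linear_map_compose[OF _ trilinear_mapD(2)[OF act2_trilinear]]
  linear_map_compose[OF _ trilinear_mapD(3)[OF act2_trilinear]]
  linear_map_closed[OF trilinear_mapD(1)[OF act2_trilinear]]

lemma act2_one:
  assumes "t \<in> carrier (tensor K A B)"
  shows "act2 \<one>\<^bsub>H\<^esub> \<one>\<^bsub>H\<^esub> t = t"
proof (rule linear_map_eq_on_tensor[OF _ _ _ _ _ _ assms])
  show "act2 \<one>\<^bsub>H\<^esub> \<one>\<^bsub>H\<^esub> (pure_tensor K A B x y) = pure_tensor K A B x y"
    if "x \<in> carrier A" "y \<in> carrier B" for x y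
    using that by (simp add: act2_pure A.act_one B.act_one)
qed (assumption | rule multilinear)+

lemma act2_mult:
  assumes [multilinear]: "g1 \<in> carrier H" "g2 \<in> carrier H" "h1 \<in> carrier H" "h2 \<in> carrier H"
    and t: "t \<in> carrier (tensor K A B)"
  shows "act2 (g1 \<otimes>\<^bsub>H\<^esub> h1) (g2 \<otimes>\<^bsub>H\<^esub> h2) t = act2 h1 h2 (act2 g1 g2 t)"
proof (rule linear_map_eq_on_tensor[OF _ _ _ _ _ _ t])
  show "act2 (g1 \<otimes>\<^bsub>H\<^esub> h1) (g2 \<otimes>\<^bsub>H\<^esub> h2) (pure_tensor K A B x y) =
      act2 h1 h2 (act2 g1 g2 (pure_tensor K A B x y))"
    if "x \<in> carrier A" "y \<in> carrier B" for x y
    using that assms(1-4)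
    by (simp add: act2_pure A.act_mult B.act_mult A.act_closed B.act_closed)
qed (assumption | rule multilinear)+

lemma tensor_right_act_eq:
  "tensor_right_act K H A B actA actB =
    (\<lambda>t h. sweedler (tensor K A B) (comult H h) (\<lambda>h1 h2. act2 h1 h2 t))"
  by (intro ext) (simp add: tensor_right_act_def act2_def)

lemma tensor_right_act_swap_eq:
  "tensor_right_act_swap K H A B actA actB =
    (\<lambda>t h. sweedler (tensor K A B) (comult H h) (\<lambda>h1 h2. act2 h2 h1 t))"
  by (intro ext) (simp add: tensor_right_act_swap_def act2_def)

lemma right_module_tensor: "right_module K H (tensor K A B) (tensor_right_act K H A B actA actB)"
  unfolding tensor_right_act_eq
  by (rule right_module_comult) (assumption | rule act2_one act2_mult multilinear)+

lemma right_module_tensor_swap: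
  "right_module K H (tensor K A B) (tensor_right_act_swap K H A B actA actB)"
  unfolding tensor_right_act_swap_eq
  by (rule right_module_comult) (assumption | rule act2_one act2_mult multilinear)+

lemma tensor_right_act_pure:
  assumes [multilinear]: "h \<in> carrier H" "x \<in> carrier A" "y \<in> carrier B"
  shows "tensor_right_act K H A B actA actB (pure_tensor K A B x y) h =
    sweedler (tensor K A B) (comult H h) (\<lambda>h1 h2. pure_tensor K A B (actA x h1) (actB y h2))"
  unfolding tensor_right_act_eq
  by (rule sweedler_cong) (assumption | rule act2_pure multilinear)+

lemma tensor_right_act_swap_pure:
  assumes [multilinear]: "h \<in> carrier H" "x \<in> carrier A" "y \<in> carrier B"
  shows "tensor_right_act_swap K H A B actA actB (pure_tensor K A B x y) h =
    sweedler (tensor K A B) (comult H h) (\<lambda>h1 h2. pure_tensor K A B (actA x h2) (actB y h1))"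
  unfolding tensor_right_act_swap_eq
  by (rule sweedler_cong) (assumption | rule act2_pure multilinear)+

end

section \<open>Tensor products of comodules\<close>

context left_comodule
begin

lemma linear_map_coact:
  "linear_map K X M f \<Longrightarrow> linear_map K X (tensor K H M) (\<lambda>x. coact (f x))"
  by (rule linear_map_compose[OF _ coact_linear])

lemma coact_closed: "m \<in> carrier M \<Longrightarrow> coact m \<in> carrier (tensor K H M)"
  by (rule linear_map_closed[OF coact_linear])

lemmas [multilinear] = linear_map_coact coact_closed M.module_axioms

lemma sweedler_coact_coassoc:
  assumes [multilinear]: "module K W" "trilinear_map K H H M W F" "m \<in> carrier M"
  shows "sweedler W (coact m) (\<lambda>x m0. sweedler W (comult H x) (\<lambda>h1 h2. F h1 h2 m0)) =
    sweedler W (coact m) (\<lambda>h1 x. sweedler W (coact x) (F h1))"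
proof -
  have "sweedler W (coact m) (\<lambda>x m0. sweedler W (comult H x) (\<lambda>h1 h2. F h1 h2 m0)) =
    sweedler W (sweedler (tensor K H (tensor K H M)) (coact m) (\<lambda>x m0.
        sweedler (tensor K H (tensor K H M)) (comult H x) (\<lambda>h1 h2.
          pure_tensor K H (tensor K H M) h1 (pure_tensor K H M h2 m0))))
      (\<lambda>a u. sweedler W u (F a))"
    by (rule trilinear_eval_left[symmetric]) (assumption | rule multilinear)+
  also have "\<dots> = sweedler W (sweedler (tensor K H (tensor K H M)) (coact m) (\<lambda>h1 x.
          pure_tensor K H (tensor K H M) h1 (coact x))) (\<lambda>a u. sweedler W u (F a))"
    by (simp only: coact_coassoc assms(3))
  also have "\<dots> = sweedler W (coact m) (\<lambda>h1 x. sweedler W (coact x) (F h1))"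
    by (rule trilinear_eval_right) (assumption | rule multilinear)+
  finally show ?thesis .
qed

lemma linear_sweedler_coact_counit:
  assumes [multilinear]: "module K W" "linear_map K M W G" "m \<in> carrier M"
  shows "sweedler W (coact m) (\<lambda>h m0. counit H h \<odot>\<^bsub>W\<^esub> G m0) = G m"
proof -
  have "G (sweedler M (coact m) (\<lambda>h m0. counit H h \<odot>\<^bsub>M\<^esub> m0)) =
      sweedler W (coact m) (\<lambda>h m0. G (counit H h \<odot>\<^bsub>M\<^esub> m0))"
    by (rule sweedler_push) (assumption | rule multilinear)+
  also have "\<dots> = sweedler W (coact m) (\<lambda>h m0. counit H h \<odot>\<^bsub>W\<^esub> G m0)"
    by (rule sweedler_cong, (rule multilinear)+, rule linear_map_smult[OF assms(2)])
      (assumption | rule multilinear)+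
  finally show ?thesis by (simp add: coact_counit assms(3))
qed

end

context right_comodule
begin

lemma linear_map_coact:
  "linear_map K X M f \<Longrightarrow> linear_map K X (tensor K M H) (\<lambda>x. coact (f x))"
  by (rule linear_map_compose[OF _ coact_linear])

lemma coact_closed: "m \<in> carrier M \<Longrightarrow> coact m \<in> carrier (tensor K M H)"
  by (rule linear_map_closed[OF coact_linear])

lemmas [multilinear] = linear_map_coact coact_closed M.module_axioms

lemma sweedler_coact_coassoc:
  assumes [multilinear]: "module K W" "trilinear_map K M H H W F" "m \<in> carrier M"
  shows "sweedler W (coact m) (\<lambda>x h2. sweedler W (coact x) (\<lambda>m0 h1. F m0 h1 h2)) =
    sweedler W (coact m) (\<lambda>m0 x. sweedler W (comult H x) (F m0))"
proof -
  have "sweedler W (coact m) (\<lambda>x h2. sweedler W (coact x) (\<lambda>m0 h1. F m0 h1 h2)) =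
    sweedler W (sweedler (tensor K M (tensor K H H)) (coact m) (\<lambda>x h2.
        sweedler (tensor K M (tensor K H H)) (coact x) (\<lambda>m0 h1.
          pure_tensor K M (tensor K H H) m0 (pure_tensor K H H h1 h2))))
      (\<lambda>a u. sweedler W u (F a))"
    by (rule trilinear_eval_left[symmetric]) (assumption | rule multilinear)+
  also have "\<dots> = sweedler W (sweedler (tensor K M (tensor K H H)) (coact m) (\<lambda>m0 x.
          pure_tensor K M (tensor K H H) m0 (comult H x))) (\<lambda>a u. sweedler W u (F a))"
    by (simp only: coact_coassoc assms(3))
  also have "\<dots> = sweedler W (coact m) (\<lambda>m0 x. sweedler W (comult H x) (F m0))"
    by (rule trilinear_eval_right) (assumption | rule multilinear)+
  finally show ?thesis .
qed

lemma linear_sweedler_coact_counit: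
  assumes [multilinear]: "module K W" "linear_map K M W G" "m \<in> carrier M"
  shows "sweedler W (coact m) (\<lambda>m0 h. counit H h \<odot>\<^bsub>W\<^esub> G m0) = G m"
proof -
  have "G (sweedler M (coact m) (\<lambda>m0 h. counit H h \<odot>\<^bsub>M\<^esub> m0)) =
      sweedler W (coact m) (\<lambda>m0 h. G (counit H h \<odot>\<^bsub>M\<^esub> m0))"
    by (rule sweedler_push) (assumption | rule multilinear)+
  also have "\<dots> = sweedler W (coact m) (\<lambda>m0 h. counit H h \<odot>\<^bsub>W\<^esub> G m0)"
    by (rule sweedler_cong, (rule multilinear)+, rule linear_map_smult[OF assms(2)])
      (assumption | rule multilinear)+
  finally show ?thesis by (simp add: coact_counit assms(3))
qed

end

section \<open>Left comodules\<close>

locale tensor_left_comodules =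
  hopf_algebra K H + A: left_comodule K H A coactA + B: left_comodule K H B coactB
  for K :: "'k ring" and H :: "('k, 'h) hopf"
    and A :: "('k, 'a) module" and coactA and B :: "('k, 'b) module" and coactB
begin

abbreviation (input) "T \<equiv> tensor K A B"
abbreviation (input) "HT \<equiv> tensor K H T"
abbreviation (input) "p \<equiv> pure_tensor K A B"
abbreviation (input) "\<delta> \<equiv> tensor_left_coact K H A B coactA coactB"

lemma tensor_coact_linear: "linear_map K T HT \<delta>"
  unfolding tensor_left_coact_def by (assumption | rule multilinear)+

lemma linear_map_tensor_coact:
  "linear_map K X T f \<Longrightarrow> linear_map K X HT (\<lambda>x. \<delta> (f x))"
  by (rule linear_map_compose[OF _ tensor_coact_linear])

lemma tensor_coact_closed: "t \<in> carrier T \<Longrightarrow> \<delta> t \<in> carrier HT"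
  by (rule linear_map_closed[OF tensor_coact_linear])

lemmas [multilinear] = linear_map_tensor_coact tensor_coact_closed

lemma tensor_coact_pure:
  assumes [multilinear]: "x \<in> carrier A" "y \<in> carrier B"
  shows "\<delta> (p x y) = sweedler HT (coactA x) (\<lambda>x1' x0. sweedler HT (coactB y) (\<lambda>y1' y0.
    pure_tensor K H T (x1' \<otimes>\<^bsub>H\<^esub> y1') (p x0 y0)))"
  unfolding tensor_left_coact_def by (rule sweedler_pure) (assumption | rule multilinear)+

text \<open>The map \<phi> is arbitrary because \<delta> occurs in two positions: as the tensor of a
  Sweedler sum, and inside the second factor of a pure tensor in the coassociativity law.\<close>

lemma linear_tensor_coact_pure:
  assumes [multilinear]: "module K W" "linear_map K HT W \<phi>" "x \<in> carrier A" "y \<in> carrier B"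
  shows "\<phi> (\<delta> (p x y)) = sweedler W (coactA x) (\<lambda>x1' x0. sweedler W (coactB y) (\<lambda>y1' y0.
    \<phi> (pure_tensor K H T (x1' \<otimes>\<^bsub>H\<^esub> y1') (p x0 y0))))"
proof -
  have "\<phi> (\<delta> (p x y)) = sweedler W (coactA x) (\<lambda>x1' x0. \<phi> (sweedler HT (coactB y) (\<lambda>y1' y0.
      pure_tensor K H T (x1' \<otimes>\<^bsub>H\<^esub> y1') (p x0 y0))))"
    unfolding tensor_coact_pure[OF assms(3,4)]
    by (rule sweedler_push) (assumption | rule multilinear)+
  also have "\<dots> = sweedler W (coactA x) (\<lambda>x1' x0. sweedler W (coactB y) (\<lambda>y1' y0.
      \<phi> (pure_tensor K H T (x1' \<otimes>\<^bsub>H\<^esub> y1') (p x0 y0))))"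
    by (rule sweedler_cong, (rule multilinear)+, rule sweedler_push) (assumption | rule
        multilinear)+
  finally show ?thesis .
qed

lemma sweedler_tensor_coact_pure:
  assumes [multilinear]: "module K W" "bilinear_map K H T W G" "x \<in> carrier A" "y \<in> carrier B"
  shows "sweedler W (\<delta> (p x y)) G = sweedler W (coactA x) (\<lambda>x1' x0.
    sweedler W (coactB y) (\<lambda>y1' y0. G (x1' \<otimes>\<^bsub>H\<^esub> y1') (p x0 y0)))"
proof -
  have "sweedler W (\<delta> (p x y)) G = sweedler W (coactA x) (\<lambda>x1' x0.
      sweedler W (coactB y) (\<lambda>y1' y0.
        sweedler W (pure_tensor K H T (x1' \<otimes>\<^bsub>H\<^esub> y1') (p x0 y0)) G))"
    by (rule linear_tensor_coact_pure) (assumption | rule multilinear)+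
  also have "\<dots> = sweedler W (coactA x) (\<lambda>x1' x0.
    sweedler W (coactB y) (\<lambda>y1' y0. G (x1' \<otimes>\<^bsub>H\<^esub> y1') (p x0 y0)))"
    by (rule sweedler_cong, (rule multilinear)+, rule sweedler_cong, (rule multilinear)+,
        rule sweedler_pure) (assumption | rule multilinear)+
  finally show ?thesis .
qed

lemma tensor_coact_counit:
  assumes "t \<in> carrier T"
  shows "sweedler T (\<delta> t) (\<lambda>h w. counit H h \<odot>\<^bsub>T\<^esub> w) = t"
proof (rule linear_map_eq_on_tensor[OF _ _ _ _ _ _ assms])
  fix x y assume [multilinear]: "x \<in> carrier A" "y \<in> carrier B"
  have "sweedler T (\<delta> (p x y)) (\<lambda>h w. counit H h \<odot>\<^bsub>T\<^esub> w) =
      sweedler T (coactA x) (\<lambda>x1' x0. sweedler T (coactB y) (\<lambda>y1' y0.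
        counit H (x1' \<otimes>\<^bsub>H\<^esub> y1') \<odot>\<^bsub>T\<^esub> p x0 y0))"
    by (rule sweedler_tensor_coact_pure) (assumption | rule multilinear)+
  also have "\<dots> = sweedler T (coactA x) (\<lambda>x1' x0. sweedler T (coactB y) (\<lambda>y1' y0.
        counit H y1' \<odot>\<^bsub>T\<^esub> (counit H x1' \<odot>\<^bsub>T\<^esub> p x0 y0)))"
    by (rule sweedler_cong, (rule multilinear)+, rule sweedler_cong, (rule multilinear)+)
      (simp add: counit_mult counit_closed smult_mult_commute pure_tensor_closed
        module_tensor A.M.module_axioms B.M.module_axioms)
  also have "\<dots> = sweedler T (coactA x) (\<lambda>x1' x0. counit H x1' \<odot>\<^bsub>T\<^esub> p x0 y)"
    by (rule sweedler_cong, (rule multilinear)+, rule B.linear_sweedler_coact_counit)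
      (assumption | rule multilinear)+
  also have "\<dots> = p x y"
    by (rule A.linear_sweedler_coact_counit) (assumption | rule multilinear)+
  finally show "sweedler T (\<delta> (p x y)) (\<lambda>h w. counit H h \<odot>\<^bsub>T\<^esub> w) = p x y" .
qed (assumption | rule multilinear)+

text \<open>Multiplicativity of \<Delta> splits the comultiplication of n1 m1 into those of n1 and
  m1; the coassociativity laws of the two comodules then apply separately.\<close>

lemma tensor_coact_coassoc:
  assumes "t \<in> carrier T"
  shows "sweedler (tensor K H HT) (\<delta> t) (\<lambda>x w. sweedler (tensor K H HT) (comult H x) (\<lambda>h1 h2.
      pure_tensor K H HT h1 (pure_tensor K H T h2 w))) =
    sweedler (tensor K H HT) (\<delta> t) (\<lambda>h1 x. pure_tensor K H HT h1 (\<delta> x))"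
proof (rule linear_map_eq_on_tensor[OF _ _ _ _ _ _ assms])
  let ?V = "tensor K H HT"
  let ?F = "\<lambda>a b x y. pure_tensor K H HT a (pure_tensor K H T b (p x y))"
  fix n m assume [multilinear]: "n \<in> carrier A" "m \<in> carrier B"
  let ?l = "sweedler ?V (\<delta> (p n m)) (\<lambda>x w. sweedler ?V (comult H x) (\<lambda>h1 h2.
      pure_tensor K H HT h1 (pure_tensor K H T h2 w)))"
  have "?l = sweedler ?V (coactA n) (\<lambda>n1 n0. sweedler ?V (coactB m) (\<lambda>m1 m0.
      sweedler ?V (comult H (n1 \<otimes>\<^bsub>H\<^esub> m1)) (\<lambda>h1 h2. ?F h1 h2 n0 m0)))"
    by (rule sweedler_tensor_coact_pure) (assumption | rule multilinear)+
  also have "\<dots> = sweedler ?V (coactA n) (\<lambda>n1 n0. sweedler ?V (coactB m) (\<lambda>m1 m0.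
      sweedler ?V (comult H n1) (\<lambda>a1 a2. sweedler ?V (comult H m1) (\<lambda>b1 b2.
        ?F (a1 \<otimes>\<^bsub>H\<^esub> b1) (a2 \<otimes>\<^bsub>H\<^esub> b2) n0 m0))))"
    by (rule sweedler_cong, (rule multilinear)+, rule sweedler_cong, (rule multilinear)+,
        rule sweedler_comult_mult) (assumption | rule multilinear)+
  \<comment> \<open>The sum over the coaction of m moves inward, so that \<Delta>(n1) stands
    directly under the coaction of n, as coassociativity of A requires.\<close>
  also have "\<dots> = sweedler ?V (coactA n) (\<lambda>n1 n0. sweedler ?V (comult H n1) (\<lambda>a1 a2.
      sweedler ?V (coactB m) (\<lambda>m1 m0. sweedler ?V (comult H m1) (\<lambda>b1 b2.
        ?F (a1 \<otimes>\<^bsub>H\<^esub> b1) (a2 \<otimes>\<^bsub>H\<^esub> b2) n0 m0))))"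
    by (rule sweedler_cong, (rule multilinear)+, rule sweedler_swap)
      (assumption | rule multilinear)+
  also have "\<dots> = sweedler ?V (coactA n) (\<lambda>a1 n'. sweedler ?V (coactA n') (\<lambda>a2 n0.
      sweedler ?V (coactB m) (\<lambda>m1 m0. sweedler ?V (comult H m1) (\<lambda>b1 b2.
        ?F (a1 \<otimes>\<^bsub>H\<^esub> b1) (a2 \<otimes>\<^bsub>H\<^esub> b2) n0 m0))))"
    by (rule A.sweedler_coact_coassoc) (assumption | rule multilinear)+
  also have "\<dots> = sweedler ?V (coactA n) (\<lambda>a1 n'. sweedler ?V (coactA n') (\<lambda>a2 n0.
      sweedler ?V (coactB m) (\<lambda>b1 m'. sweedler ?V (coactB m') (\<lambda>b2 m0.
        ?F (a1 \<otimes>\<^bsub>H\<^esub> b1) (a2 \<otimes>\<^bsub>H\<^esub> b2) n0 m0))))"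
    by (rule sweedler_cong, (rule multilinear)+, rule sweedler_cong, (assumption | rule
        multilinear)+,
        rule B.sweedler_coact_coassoc) (assumption | rule multilinear)+
  also have "\<dots> = sweedler ?V (coactA n) (\<lambda>a1 n'. sweedler ?V (coactB m) (\<lambda>b1 m'.
      sweedler ?V (coactA n') (\<lambda>a2 n0. sweedler ?V (coactB m') (\<lambda>b2 m0.
        ?F (a1 \<otimes>\<^bsub>H\<^esub> b1) (a2 \<otimes>\<^bsub>H\<^esub> b2) n0 m0))))"
    by (rule sweedler_cong, (rule multilinear)+, rule sweedler_swap)
      (assumption | rule multilinear)+
  also have "\<dots> = sweedler ?V (coactA n) (\<lambda>a1 n'. sweedler ?V (coactB m) (\<lambda>b1 m'.
      pure_tensor K H HT (a1 \<otimes>\<^bsub>H\<^esub> b1) (\<delta> (p n' m'))))"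
    by (rule sweedler_cong, (rule multilinear)+, rule sweedler_cong, (rule multilinear)+,
        rule linear_tensor_coact_pure[symmetric]) (assumption | rule multilinear)+
  also have "\<dots> = sweedler ?V (\<delta> (p n m)) (\<lambda>h1 x. pure_tensor K H HT h1 (\<delta> x))"
    by (rule sweedler_tensor_coact_pure[symmetric]) (assumption | rule multilinear)+
  finally show "?l = sweedler ?V (\<delta> (p n m)) (\<lambda>h1 x. pure_tensor K H HT h1 (\<delta> x))" .
qed (assumption | rule multilinear)+

lemma left_comodule_tensor: "left_comodule K H T \<delta>"
  by (intro left_comodule.intro left_comodule_axioms.intro coalgebra_axioms tensor_coact_linear
      tensor_coact_coassoc tensor_coact_counit) (rule multilinear)+

end

section \<open>Right comodules\<close>

locale tensor_right_comodules =
  hopf_algebra K H + A: right_comodule K H A coactA + B: right_comodule K H B coactB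
  for K :: "'k ring" and H :: "('k, 'h) hopf"
    and A :: "('k, 'a) module" and coactA and B :: "('k, 'b) module" and coactB
begin

abbreviation (input) "T \<equiv> tensor K A B"
abbreviation (input) "TH \<equiv> tensor K T H"
abbreviation (input) "p \<equiv> pure_tensor K A B"
abbreviation (input) "\<delta> \<equiv> tensor_right_coact K H A B coactA coactB"

lemma tensor_coact_linear: "linear_map K T TH \<delta>"
  unfolding tensor_right_coact_def by (assumption | rule multilinear)+

lemma linear_map_tensor_coact:
  "linear_map K X T f \<Longrightarrow> linear_map K X TH (\<lambda>x. \<delta> (f x))"
  by (rule linear_map_compose[OF _ tensor_coact_linear])

lemma tensor_coact_closed: "t \<in> carrier T \<Longrightarrow> \<delta> t \<in> carrier TH"
  by (rule linear_map_closed[OF tensor_coact_linear])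

lemmas [multilinear] = linear_map_tensor_coact tensor_coact_closed

lemma tensor_coact_pure:
  assumes [multilinear]: "x \<in> carrier A" "y \<in> carrier B"
  shows "\<delta> (p x y) = sweedler TH (coactA x) (\<lambda>x0 x1. sweedler TH (coactB y) (\<lambda>y0 y1.
    pure_tensor K T H (p x0 y0) (x1 \<otimes>\<^bsub>H\<^esub> y1)))"
  unfolding tensor_right_coact_def by (rule sweedler_pure) (assumption | rule multilinear)+

lemma sweedler_tensor_coact_pure:
  assumes [multilinear]: "module K W" "bilinear_map K T H W G" "x \<in> carrier A" "y \<in> carrier B"
  shows "sweedler W (\<delta> (p x y)) G = sweedler W (coactA x) (\<lambda>x0 x1.
    sweedler W (coactB y) (\<lambda>y0 y1. G (p x0 y0) (x1 \<otimes>\<^bsub>H\<^esub> y1)))"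
proof -
  have "sweedler W (\<delta> (p x y)) G = sweedler W (coactA x) (\<lambda>x0 x1.
      sweedler W (sweedler TH (coactB y) (\<lambda>y0 y1.
        pure_tensor K T H (p x0 y0) (x1 \<otimes>\<^bsub>H\<^esub> y1))) G)"
    unfolding tensor_coact_pure[OF assms(3,4)]
    by (rule sweedler_sweedler) (assumption | rule multilinear)+
  also have "\<dots> = sweedler W (coactA x) (\<lambda>x0 x1. sweedler W (coactB y) (\<lambda>y0 y1.
      sweedler W (pure_tensor K T H (p x0 y0) (x1 \<otimes>\<^bsub>H\<^esub> y1)) G))"
    by (rule sweedler_cong, (rule multilinear)+, rule sweedler_sweedler)
      (assumption | rule multilinear)+
  also have "\<dots> = sweedler W (coactA x) (\<lambda>x0 x1.
      sweedler W (coactB y) (\<lambda>y0 y1. G (p x0 y0) (x1 \<otimes>\<^bsub>H\<^esub> y1)))"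
    by (rule sweedler_cong, (rule multilinear)+, rule sweedler_cong, (rule multilinear)+,
        rule sweedler_pure) (assumption | rule multilinear)+
  finally show ?thesis .
qed

lemma tensor_coact_counit:
  assumes "t \<in> carrier T"
  shows "sweedler T (\<delta> t) (\<lambda>w h. counit H h \<odot>\<^bsub>T\<^esub> w) = t"
proof (rule linear_map_eq_on_tensor[OF _ _ _ _ _ _ assms])
  fix x y assume [multilinear]: "x \<in> carrier A" "y \<in> carrier B"
  have "sweedler T (\<delta> (p x y)) (\<lambda>w h. counit H h \<odot>\<^bsub>T\<^esub> w) =
      sweedler T (coactA x) (\<lambda>x0 x1. sweedler T (coactB y) (\<lambda>y0 y1.
        counit H (x1 \<otimes>\<^bsub>H\<^esub> y1) \<odot>\<^bsub>T\<^esub> p x0 y0))"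
    by (rule sweedler_tensor_coact_pure) (assumption | rule multilinear)+
  also have "\<dots> = sweedler T (coactA x) (\<lambda>x0 x1. sweedler T (coactB y) (\<lambda>y0 y1.
        counit H y1 \<odot>\<^bsub>T\<^esub> (counit H x1 \<odot>\<^bsub>T\<^esub> p x0 y0)))"
    by (rule sweedler_cong, (rule multilinear)+, rule sweedler_cong, (rule multilinear)+)
      (simp add: counit_mult counit_closed smult_mult_commute pure_tensor_closed
        module_tensor A.M.module_axioms B.M.module_axioms)
  also have "\<dots> = sweedler T (coactA x) (\<lambda>x0 x1. counit H x1 \<odot>\<^bsub>T\<^esub> p x0 y)"
    by (rule sweedler_cong, (rule multilinear)+, rule B.linear_sweedler_coact_counit)
      (assumption | rule multilinear)+
  also have "\<dots> = p x y"
    by (rule A.linear_sweedler_coact_counit) (assumption | rule multilinear)+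
  finally show "sweedler T (\<delta> (p x y)) (\<lambda>w h. counit H h \<odot>\<^bsub>T\<^esub> w) = p x y" .
qed (assumption | rule multilinear)+

text \<open>Here the iterated coaction comes first, so the argument runs in the opposite direction:
  the comultiplications of x and y arise from the two coassociativity laws and are merged into
  \<Delta>(x y) at the end.\<close>

lemma tensor_coact_coassoc:
  assumes "t \<in> carrier T"
  shows "sweedler (tensor K T (tensor K H H)) (\<delta> t) (\<lambda>x h2.
      sweedler (tensor K T (tensor K H H)) (\<delta> x) (\<lambda>w h1.
        pure_tensor K T (tensor K H H) w (pure_tensor K H H h1 h2))) =
    sweedler (tensor K T (tensor K H H)) (\<delta> t) (\<lambda>w x.
      pure_tensor K T (tensor K H H) w (comult H x))"
proof (rule linear_map_eq_on_tensor[OF _ _ _ _ _ _ assms])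
  let ?V = "tensor K T (tensor K H H)"
  let ?q = "pure_tensor K T (tensor K H H)"
  let ?F = "\<lambda>x y a b. ?q (p x y) (pure_tensor K H H a b)"
  fix n m assume [multilinear]: "n \<in> carrier A" "m \<in> carrier B"
  let ?l = "sweedler ?V (\<delta> (p n m)) (\<lambda>x h2. sweedler ?V (\<delta> x) (\<lambda>w h1.
      ?q w (pure_tensor K H H h1 h2)))"
  have "?l = sweedler ?V (coactA n) (\<lambda>n' n2. sweedler ?V (coactB m) (\<lambda>m' m2.
      sweedler ?V (\<delta> (p n' m')) (\<lambda>w h1. ?q w (pure_tensor K H H h1 (n2 \<otimes>\<^bsub>H\<^esub> m2)))))"
    by (rule sweedler_tensor_coact_pure) (assumption | rule multilinear)+
  also have "\<dots> = sweedler ?V (coactA n) (\<lambda>n' n2. sweedler ?V (coactB m) (\<lambda>m' m2.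
      sweedler ?V (coactA n') (\<lambda>n0 n1. sweedler ?V (coactB m') (\<lambda>m0 m1.
        ?F n0 m0 (n1 \<otimes>\<^bsub>H\<^esub> m1) (n2 \<otimes>\<^bsub>H\<^esub> m2)))))"
    by (rule sweedler_cong, (rule multilinear)+, rule sweedler_cong, (rule multilinear)+,
        rule sweedler_tensor_coact_pure) (assumption | rule multilinear)+
  also have "\<dots> = sweedler ?V (coactA n) (\<lambda>n' n2. sweedler ?V (coactA n') (\<lambda>n0 n1.
      sweedler ?V (coactB m) (\<lambda>m' m2. sweedler ?V (coactB m') (\<lambda>m0 m1.
        ?F n0 m0 (n1 \<otimes>\<^bsub>H\<^esub> m1) (n2 \<otimes>\<^bsub>H\<^esub> m2)))))"
    by (rule sweedler_cong, (rule multilinear)+, rule sweedler_swap)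
      (assumption | rule multilinear)+
  also have "\<dots> = sweedler ?V (coactA n) (\<lambda>n0 x. sweedler ?V (comult H x) (\<lambda>n1 n2.
      sweedler ?V (coactB m) (\<lambda>m' m2. sweedler ?V (coactB m') (\<lambda>m0 m1.
        ?F n0 m0 (n1 \<otimes>\<^bsub>H\<^esub> m1) (n2 \<otimes>\<^bsub>H\<^esub> m2)))))"
    by (rule A.sweedler_coact_coassoc) (assumption | rule multilinear)+
  also have "\<dots> = sweedler ?V (coactA n) (\<lambda>n0 x. sweedler ?V (comult H x) (\<lambda>n1 n2.
      sweedler ?V (coactB m) (\<lambda>m0 y. sweedler ?V (comult H y) (\<lambda>m1 m2.
        ?F n0 m0 (n1 \<otimes>\<^bsub>H\<^esub> m1) (n2 \<otimes>\<^bsub>H\<^esub> m2)))))"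
    by (rule sweedler_cong, (rule multilinear)+, rule sweedler_cong, (assumption | rule
        multilinear)+,
        rule B.sweedler_coact_coassoc) (assumption | rule multilinear)+
  also have "\<dots> = sweedler ?V (coactA n) (\<lambda>n0 x. sweedler ?V (coactB m) (\<lambda>m0 y.
      sweedler ?V (comult H x) (\<lambda>n1 n2. sweedler ?V (comult H y) (\<lambda>m1 m2.
        ?F n0 m0 (n1 \<otimes>\<^bsub>H\<^esub> m1) (n2 \<otimes>\<^bsub>H\<^esub> m2)))))"
    by (rule sweedler_cong, (rule multilinear)+, rule sweedler_swap)
      (assumption | rule multilinear)+
  also have "\<dots> = sweedler ?V (coactA n) (\<lambda>n0 x. sweedler ?V (coactB m) (\<lambda>m0 y.
      sweedler ?V (comult H (x \<otimes>\<^bsub>H\<^esub> y)) (\<lambda>h1 h2. ?F n0 m0 h1 h2)))"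
    by (rule sweedler_cong, (rule multilinear)+, rule sweedler_cong, (rule multilinear)+,
        rule sweedler_comult_mult[symmetric]) (assumption | rule multilinear)+
  \<comment> \<open>The sum over \<Delta>(x y) is drawn into the second factor of the pure tensor,
    where it is \<Delta>(x y) itself by \<open>sweedler_pure_tensor\<close>.\<close>
  also have "\<dots> = sweedler ?V (coactA n) (\<lambda>n0 x. sweedler ?V (coactB m) (\<lambda>m0 y.
      ?q (p n0 m0) (sweedler (tensor K H H) (comult H (x \<otimes>\<^bsub>H\<^esub> y)) (pure_tensor K H H))))"
    by (rule sweedler_cong, (rule multilinear)+, rule sweedler_cong, (rule multilinear)+,
        rule sweedler_push[symmetric]) (assumption | rule multilinear)+
  also have "\<dots> = sweedler ?V (coactA n) (\<lambda>n0 x. sweedler ?V (coactB m) (\<lambda>m0 y.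
      ?q (p n0 m0) (comult H (x \<otimes>\<^bsub>H\<^esub> y))))"
    by (rule sweedler_cong, (rule multilinear)+, rule sweedler_cong, (rule multilinear)+)
      (simp add: sweedler_pure_tensor comult_closed module_axioms)
  also have "\<dots> = sweedler ?V (\<delta> (p n m)) (\<lambda>w x. ?q w (comult H x))"
    by (rule sweedler_tensor_coact_pure[symmetric]) (assumption | rule multilinear)+
  finally show "?l = sweedler ?V (\<delta> (p n m)) (\<lambda>w x. ?q w (comult H x))" .
qed (assumption | rule multilinear)+

lemma right_comodule_tensor: "right_comodule K H T \<delta>"
  by (intro right_comodule.intro right_comodule_axioms.intro coalgebra_axioms tensor_coact_linear
      tensor_coact_coassoc tensor_coact_counit) (rule multilinear)+

end

section \<open>Yetter-Drinfeld and anti-Yetter-Drinfeld modules\<close>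

context coalgebra
begin

lemma sweedler3_closed:
  assumes [multilinear]: "module K W" "h \<in> carrier H"
    and F [multilinear]: "\<And>h1 h2 h3. \<lbrakk>h1 \<in> carrier H; h2 \<in> carrier H; h3 \<in> carrier H\<rbrakk> \<Longrightarrow>
      F h1 h2 h3 \<in> carrier W"
  shows "sweedler3 H W h F \<in> carrier W"
  unfolding sweedler3_def by (assumption | rule multilinear)+

lemma sweedler3_linear_parameter:
  assumes [multilinear]: "module K W" "h \<in> carrier H"
    and F [multilinear]: "\<And>h1 h2 h3. \<lbrakk>h1 \<in> carrier H; h2 \<in> carrier H; h3 \<in> carrier H\<rbrakk> \<Longrightarrow>
      linear_map K X W (\<lambda>x. F x h1 h2 h3)"
  shows "linear_map K X W (\<lambda>x. sweedler3 H W h (F x))"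
  unfolding sweedler3_def by (assumption | rule multilinear)+

lemmas [multilinear] = sweedler3_closed sweedler3_linear_parameter

lemma sweedler3_cong:
  assumes [multilinear]: "h \<in> carrier H"
    and "\<And>h1 h2 h3. \<lbrakk>h1 \<in> carrier H; h2 \<in> carrier H; h3 \<in> carrier H\<rbrakk> \<Longrightarrow> F h1 h2 h3 = G h1 h2 h3"
  shows "sweedler3 H W h F = sweedler3 H W h G"
  unfolding sweedler3_def
  by (rule sweedler_cong, (rule multilinear)+, rule sweedler_cong) (assumption | rule multilinear
      assms(2))+

lemma sweedler_sweedler3_swap:
  assumes [multilinear]: "module K A" "module K B" "module K W" "t \<in> carrier (tensor K A B)"
    "h \<in> carrier H"
    and F [multilinear]: "\<And>a b h1 h2 h3. \<lbrakk>a \<in> carrier A; b \<in> carrier B; h1 \<in> carrier H;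
      h2 \<in> carrier H; h3 \<in> carrier H\<rbrakk> \<Longrightarrow> F a b h1 h2 h3 \<in> carrier W"
  shows "sweedler W t (\<lambda>a b. sweedler3 H W h (F a b)) =
    sweedler3 H W h (\<lambda>h1 h2 h3. sweedler W t (\<lambda>a b. F a b h1 h2 h3))"
proof -
  have "sweedler W t (\<lambda>a b. sweedler3 H W h (F a b)) =
      sweedler W (comult H h) (\<lambda>h1 x. sweedler W t (\<lambda>a b.
        sweedler W (comult H x) (F a b h1)))"
    unfolding sweedler3_def by (rule sweedler_swap) (assumption | rule multilinear)+
  also have "\<dots> = sweedler3 H W h (\<lambda>h1 h2 h3. sweedler W t (\<lambda>a b. F a b h1 h2 h3))"
    unfolding sweedler3_def by (rule sweedler_cong, (rule multilinear)+, rule sweedler_swap)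
      (assumption | rule multilinear)+
  finally show ?thesis .
qed

text \<open>Needed for the two types with a swapped action, in which the first tensor factor
  receives the later legs of h.\<close>

lemma sweedler3_swap:
  assumes [multilinear]: "module K W" "g \<in> carrier H" "h \<in> carrier H"
    and F [multilinear]: "\<And>a1 a2 a3 b1 b2 b3. \<lbrakk>a1 \<in> carrier H; a2 \<in> carrier H; a3 \<in> carrier H;
      b1 \<in> carrier H; b2 \<in> carrier H; b3 \<in> carrier H\<rbrakk> \<Longrightarrow> F a1 a2 a3 b1 b2 b3 \<in> carrier W"
  shows "sweedler3 H W g (\<lambda>a1 a2 a3. sweedler3 H W h (F a1 a2 a3)) =
    sweedler3 H W h (\<lambda>b1 b2 b3. sweedler3 H W g (\<lambda>a1 a2 a3. F a1 a2 a3 b1 b2 b3))"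
proof -
  have "sweedler3 H W g (\<lambda>a1 a2 a3. sweedler3 H W h (F a1 a2 a3)) =
      sweedler W (comult H g) (\<lambda>a1 x. sweedler3 H W h (\<lambda>b1 b2 b3.
        sweedler W (comult H x) (\<lambda>a2 a3. F a1 a2 a3 b1 b2 b3)))"
    unfolding sweedler3_def[of _ _ g]
    by (rule sweedler_cong, (rule multilinear)+, rule sweedler_sweedler3_swap)
      (assumption | rule multilinear)+
  also have "\<dots> = sweedler3 H W h (\<lambda>b1 b2 b3. sweedler3 H W g (\<lambda>a1 a2 a3. F a1 a2 a3 b1 b2 b3))"
    unfolding sweedler3_def[of _ _ g]
    by (rule sweedler_sweedler3_swap) (assumption | rule multilinear)+
  finally show ?thesis .
qed

text \<open>The inner tensor has the shape of the right-hand side of every (anti-)Yetter-Drinfeld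
  condition; \<open>f\<close> and \<open>g\<close> stand for its two components, in the order given
  by the side of the coaction.\<close>

lemma sweedler_sweedler3_pure:
  assumes [multilinear]: "module K A" "module K B" "module K C" "module K D" "module K W"
    "t \<in> carrier (tensor K C D)" "h \<in> carrier H"
    and G [multilinear]: "bilinear_map K A B W G"
    and [multilinear]: "\<And>h1 h2 h3 c d. \<lbrakk>h1 \<in> carrier H; h2 \<in> carrier H; h3 \<in> carrier H; c \<in>
        carrier C;
      d \<in> carrier D\<rbrakk> \<Longrightarrow> f h1 h2 h3 c d \<in> carrier A"
      "\<And>h1 h2 h3 c d. \<lbrakk>h1 \<in> carrier H; h2 \<in> carrier H; h3 \<in> carrier H; c \<in> carrier C;
      d \<in> carrier D\<rbrakk> \<Longrightarrow> g h1 h2 h3 c d \<in> carrier B"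
  shows "sweedler W (sweedler3 H (tensor K A B) h (\<lambda>h1 h2 h3. sweedler (tensor K A B) t (\<lambda>c d.
      pure_tensor K A B (f h1 h2 h3 c d) (g h1 h2 h3 c d)))) G =
    sweedler3 H W h (\<lambda>h1 h2 h3. sweedler W t (\<lambda>c d. G (f h1 h2 h3 c d) (g h1 h2 h3 c d)))"
proof -
  let ?p = "\<lambda>h1 h2 h3 c d. pure_tensor K A B (f h1 h2 h3 c d) (g h1 h2 h3 c d)"
  let ?T = "tensor K A B"
  have "sweedler W (sweedler3 H ?T h (\<lambda>h1 h2 h3. sweedler ?T t (?p h1 h2 h3))) G =
      sweedler W (comult H h) (\<lambda>h1 x.
        sweedler W (sweedler ?T (comult H x) (\<lambda>h2 h3. sweedler ?T t (?p h1 h2 h3))) G)"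
    unfolding sweedler3_def by (rule sweedler_sweedler) (assumption | rule multilinear)+
  also have "\<dots> = sweedler3 H W h (\<lambda>h1 h2 h3. sweedler W (sweedler ?T t (?p h1 h2 h3)) G)"
    unfolding sweedler3_def by (rule sweedler_cong, (rule multilinear)+, rule sweedler_sweedler)
      (assumption | rule multilinear)+
  also have "\<dots> = sweedler3 H W h (\<lambda>h1 h2 h3. sweedler W t (\<lambda>c d. sweedler W (?p h1 h2 h3 c d) G))"
    by (rule sweedler3_cong, rule multilinear, rule sweedler_sweedler)
      (assumption | rule multilinear)+
  also have "\<dots> = sweedler3 H W h (\<lambda>h1 h2 h3. sweedler W t (\<lambda>c d. G (f h1 h2 h3 c d) (g h1 h2 h3 c
      d)))"
    by (rule sweedler3_cong, rule multilinear, rule sweedler_cong, (rule multilinear)+,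
        rule sweedler_pure) (assumption | rule multilinear)+
  finally show ?thesis .
qed

end

text \<open>
  The common core of the four compatibility conditions: \<open>L\<close> is the left-hand side after both
  (anti-)Yetter-Drinfeld conditions have been used, \<open>R\<close> the right-hand side, and \<open>E\<close> is \<open>L\<close> with
  the two inner antipode factors collected in a single argument.
\<close>

lemma (in hopf_algebra) sweedler_cancel_tensor:
  assumes [multilinear]: "module K A" "module K B" "module K C" "module K D" "module K W"
    "h \<in> carrier H" "s \<in> carrier (tensor K A B)" "t \<in> carrier (tensor K C D)"
    and c: "bilinear_map K H H H c"
      "\<And>h. h \<in> carrier H \<Longrightarrow> sweedler H (comult H h) c = counit H h \<odot>\<^bsub>H\<^esub> \<one>\<^bsub>H\<^esub>"
    and E [multilinear]: "\<And>u v x y b z p q. \<lbrakk>u \<in> carrier A; v \<in> carrier B; x \<in> carrier C;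
        y \<in> carrier D; b \<in> carrier H; z \<in> carrier H; p \<in> carrier H; q \<in> carrier H\<rbrakk> \<Longrightarrow>
        linear_map K H W (\<lambda>a. E u v x y a b z p q)"
      "\<And>u v x y a z p q. \<lbrakk>u \<in> carrier A; v \<in> carrier B; x \<in> carrier C; y \<in> carrier D;
        a \<in> carrier H; z \<in> carrier H; p \<in> carrier H; q \<in> carrier H\<rbrakk> \<Longrightarrow>
        linear_map K H W (\<lambda>b. E u v x y a b z p q)"
      "\<And>u v x y a b p q. \<lbrakk>u \<in> carrier A; v \<in> carrier B; x \<in> carrier C; y \<in> carrier D;
        a \<in> carrier H; b \<in> carrier H; p \<in> carrier H; q \<in> carrier H\<rbrakk> \<Longrightarrow>
        linear_map K H W (\<lambda>z. E u v x y a b z p q)"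
      "\<And>u v x y a b z q. \<lbrakk>u \<in> carrier A; v \<in> carrier B; x \<in> carrier C; y \<in> carrier D;
        a \<in> carrier H; b \<in> carrier H; z \<in> carrier H; q \<in> carrier H\<rbrakk> \<Longrightarrow>
        linear_map K H W (\<lambda>p. E u v x y a b z p q)"
      "\<And>u v x y a b z p. \<lbrakk>u \<in> carrier A; v \<in> carrier B; x \<in> carrier C; y \<in> carrier D;
        a \<in> carrier H; b \<in> carrier H; z \<in> carrier H; p \<in> carrier H\<rbrakk> \<Longrightarrow>
        linear_map K H W (\<lambda>q. E u v x y a b z p q)"
    and L: "\<And>u v x y a1 a2 a3 b1 b2 b3. \<lbrakk>u \<in> carrier A; v \<in> carrier B; x \<in> carrier C; y \<in> carrier D;
        a1 \<in> carrier H; a2 \<in> carrier H; a3 \<in> carrier H; b1 \<in> carrier H; b2 \<in> carrier H;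
        b3 \<in> carrier H\<rbrakk> \<Longrightarrow> L a1 a2 a3 b1 b2 b3 u v x y = E u v x y a1 a2 (c a3 b1) b2 b3"
    and R: "\<And>u v x y h1 h2 h3. \<lbrakk>u \<in> carrier A; v \<in> carrier B; x \<in> carrier C; y \<in> carrier D;
        h1 \<in> carrier H; h2 \<in> carrier H; h3 \<in> carrier H\<rbrakk> \<Longrightarrow>
        R h1 h2 h3 u v x y = sweedler W (comult H h2) (\<lambda>p q. E u v x y h1 p \<one>\<^bsub>H\<^esub> q h3)"
  shows "sweedler W (comult H h) (\<lambda>h1 h2. sweedler3 H W h1 (\<lambda>a1 a2 a3. sweedler3 H W h2 (\<lambda>b1 b2 b3.
      sweedler W s (\<lambda>u v. sweedler W t (L a1 a2 a3 b1 b2 b3 u v))))) =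
    sweedler3 H W h (\<lambda>h1 h2 h3. sweedler W s (\<lambda>u v. sweedler W t (R h1 h2 h3 u v)))"
proof -
  note [multilinear] = linear_map_closed[OF E(1)] bilinear_map_closed[OF c(1)]
  \<comment> \<open>The sums over \<open>s\<close> and \<open>t\<close> become part of the summand,
    so that \<open>sweedler_cancel\<close> sees only the five slots filled by legs of h.\<close>
  let ?F = "\<lambda>a b z p q. sweedler W s (\<lambda>u v. sweedler W t (\<lambda>x y. E u v x y a b z p q))"
  have "sweedler W (comult H h) (\<lambda>h1 h2. sweedler3 H W h1 (\<lambda>a1 a2 a3. sweedler3 H W h2 (\<lambda>b1 b2 b3.
      sweedler W s (\<lambda>u v. sweedler W t (L a1 a2 a3 b1 b2 b3 u v))))) =
    sweedler W (comult H h) (\<lambda>h1 h2. sweedler3 H W h1 (\<lambda>a1 a2 a3. sweedler3 H W h2 (\<lambda>b1 b2 b3.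
      ?F a1 a2 (c a3 b1) b2 b3)))"
    by (rule sweedler_cong, (rule multilinear)+, rule sweedler3_cong, assumption,
        rule sweedler3_cong, assumption, rule sweedler_cong, (rule multilinear)+,
        rule sweedler_cong, (rule multilinear)+, rule L)
  also have "\<dots> = sweedler3 H W h (\<lambda>h1 h2 h3. sweedler W (comult H h2) (\<lambda>p q. ?F h1 p \<one>\<^bsub>H\<^esub> q h3))"
    by (rule sweedler_cancel) (assumption | rule c multilinear)+
  \<comment> \<open>The splitting of h2 moves inward past \<open>s\<close> and then
    \<open>t\<close>, to the place where \<open>R\<close> contains the action of h2 on a pure
    tensor.\<close>
  also have "\<dots> = sweedler3 H W h (\<lambda>h1 h2 h3. sweedler W s (\<lambda>u v. sweedler W (comult H h2) (\<lambda>p q.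
      sweedler W t (\<lambda>x y. E u v x y h1 p \<one>\<^bsub>H\<^esub> q h3))))"
    by (rule sweedler3_cong, rule multilinear, rule sweedler_swap) (assumption | rule multilinear)+
  also have "\<dots> = sweedler3 H W h (\<lambda>h1 h2 h3. sweedler W s (\<lambda>u v. sweedler W t (\<lambda>x y.
      sweedler W (comult H h2) (\<lambda>p q. E u v x y h1 p \<one>\<^bsub>H\<^esub> q h3))))"
    by (rule sweedler3_cong, rule multilinear, rule sweedler_cong, (rule multilinear)+,
        rule sweedler_swap) (assumption | rule multilinear)+
  also have "\<dots> = sweedler3 H W h (\<lambda>h1 h2 h3. sweedler W s (\<lambda>u v. sweedler W t (R h1 h2 h3 u v)))"
    by (rule sweedler3_cong, rule multilinear, rule sweedler_cong, (rule multilinear)+,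
        rule sweedler_cong, (rule multilinear)+, rule R[symmetric])
  finally show ?thesis .
qed

text \<open>In the coaction of a tensor product, coact (act h n) appears under a summand that
  carries the other factor; \<open>G\<close> stands for that summand.\<close>

lemma (in YD_left_left) sweedler_coact_act:
  assumes [multilinear]: "module K W" "bilinear_map K H N W G" "h \<in> carrier H" "n \<in> carrier N"
  shows "sweedler W (coact (act h n)) G = sweedler3 H W h (\<lambda>h1 h2 h3.
    sweedler W (coact n) (\<lambda>n1' n0. G (h1 \<otimes>\<^bsub>H\<^esub> n1' \<otimes>\<^bsub>H\<^esub> antipode H h3) (act h2 n0)))"
  unfolding YD[OF assms(3,4)] by (rule sweedler_sweedler3_pure) (assumption | rule multilinear)+

text \<open>The premise \<open>hopf_algebra_bij\<close> gives membership of
  \<open>antipode_inv H h3\<close> in H, on which the linearity conditions for the summand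
  depend.\<close>

lemma (in aYD_left_left) sweedler_coact_act:
  assumes "hopf_algebra_bij K H"
  assumes [multilinear]: "module K W" "bilinear_map K H M W G" "h \<in> carrier H" "m \<in> carrier M"
  shows "sweedler W (coact (act h m)) G = sweedler3 H W h (\<lambda>h1 h2 h3.
    sweedler W (coact m) (\<lambda>m1' m0. G (h1 \<otimes>\<^bsub>H\<^esub> m1' \<otimes>\<^bsub>H\<^esub> antipode_inv H h3) (act h2 m0)))"
proof -
  interpret hopf_algebra_bij K H by fact
  show ?thesis
    unfolding aYD[OF assms(4,5)] by (rule sweedler_sweedler3_pure) (assumption | rule multilinear)+
qed

section \<open>Compatibility in the left-left type\<close>

lemma aYD_left_left_tensor:
  assumes "hopf_algebra_bij K H" "YD_left_left K H N actN coactN"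
    "aYD_left_left K H M actM coactM"
  shows "aYD_left_left K H (tensor K N M) (tensor_left_act K H N M actN actM)
    (tensor_left_coact K H N M coactN coactM)"
proof -
  interpret H: hopf_algebra_bij K H by fact
  interpret N: YD_left_left K H N actN coactN by fact
  interpret M: aYD_left_left K H M actM coactM by fact
  interpret tensor_left_modules K H N actN M actM ..
  interpret tensor_left_comodules K H N coactN M coactM ..
  interpret NM: left_module K H "tensor K N M" "tensor_left_act K H N M actN actM"
    by (rule left_module_tensor)
  interpret NM: left_comodule K H "tensor K N M" "tensor_left_coact K H N M coactN coactM"
    by (rule left_comodule_tensor)
  let ?T = "tensor K N M"
  let ?W = "tensor K H ?T"
  let ?\<alpha> = "tensor_left_act K H N M actN actM"
  let ?\<delta> = "tensor_left_coact K H N M coactN coactM"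
  let ?p = "pure_tensor K N M"
  let ?q = "pure_tensor K H ?T"
  let ?S = "antipode H"
  let ?S' = "antipode_inv H"
  have pure: "?\<delta> (?\<alpha> h (?p n m)) = sweedler3 H ?W h (\<lambda>h1 h2 h3.
      sweedler ?W (?\<delta> (?p n m)) (\<lambda>x w. ?q (h1 \<otimes>\<^bsub>H\<^esub> x \<otimes>\<^bsub>H\<^esub> ?S' h3) (?\<alpha> h2 w)))"
    if [multilinear]: "h \<in> carrier H" "n \<in> carrier N" "m \<in> carrier M" for h n m
  proof -
    \<comment> \<open>The legs a of h1 belong to n, the legs b of h2 to m. Up to bracketing, S(a3)
      and b1 are neighbours between n1 and m1.\<close>
    let ?L = "\<lambda>a1 a2 a3 b1 b2 b3 n1 n0 m1 m0.
      ?q ((a1 \<otimes>\<^bsub>H\<^esub> n1 \<otimes>\<^bsub>H\<^esub> ?S a3) \<otimes>\<^bsub>H\<^esub> (b1 \<otimes>\<^bsub>H\<^esub> m1 \<otimes>\<^bsub>H\<^esub> ?S' b3)) (?p (actN a2 n0) (actM b2 m0))"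
    have "?\<delta> (?\<alpha> h (?p n m)) =
        sweedler ?W (comult H h) (\<lambda>h1 h2. ?\<delta> (?p (actN h1 n) (actM h2 m)))"
      unfolding tensor_left_act_pure[OF that]
      by (rule sweedler_push) (assumption | rule multilinear)+
    also have "\<dots> = sweedler ?W (comult H h) (\<lambda>h1 h2. sweedler3 H ?W h1 (\<lambda>a1 a2 a3.
        sweedler3 H ?W h2 (\<lambda>b1 b2 b3. sweedler ?W (coactN n) (\<lambda>n1 n0.
          sweedler ?W (coactM m) (?L a1 a2 a3 b1 b2 b3 n1 n0)))))"
    proof (rule sweedler_cong, (rule multilinear)+)
      fix h1 h2 assume [multilinear]: "h1 \<in> carrier H" "h2 \<in> carrier H"
      have "?\<delta> (?p (actN h1 n) (actM h2 m)) = sweedler ?W (coactN (actN h1 n)) (\<lambda>x1 x0.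
          sweedler ?W (coactM (actM h2 m)) (\<lambda>y1 y0. ?q (x1 \<otimes>\<^bsub>H\<^esub> y1) (?p x0 y0)))"
        by (rule tensor_coact_pure) (rule multilinear)+
      also have "\<dots> = sweedler3 H ?W h1 (\<lambda>a1 a2 a3. sweedler ?W (coactN n) (\<lambda>n1 n0.
          sweedler ?W (coactM (actM h2 m)) (\<lambda>y1 y0.
            ?q ((a1 \<otimes>\<^bsub>H\<^esub> n1 \<otimes>\<^bsub>H\<^esub> ?S a3) \<otimes>\<^bsub>H\<^esub> y1) (?p (actN a2 n0) y0))))"
        by (rule N.sweedler_coact_act) (assumption | rule multilinear)+
      also have "\<dots> = sweedler3 H ?W h1 (\<lambda>a1 a2 a3. sweedler ?W (coactN n) (\<lambda>n1 n0.
          sweedler3 H ?W h2 (\<lambda>b1 b2 b3. sweedler ?W (coactM m) (?L a1 a2 a3 b1 b2 b3 n1 n0))))"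
        by (rule H.sweedler3_cong, rule multilinear, rule sweedler_cong, (rule multilinear)+,
            rule M.sweedler_coact_act) (assumption | rule assms(1) multilinear)+
      \<comment> \<open>All splittings of h are moved outside the coaction sums, the shape that
        \<open>sweedler_cancel_tensor\<close> expects.\<close>
      also have "\<dots> = sweedler3 H ?W h1 (\<lambda>a1 a2 a3. sweedler3 H ?W h2 (\<lambda>b1 b2 b3.
          sweedler ?W (coactN n) (\<lambda>n1 n0. sweedler ?W (coactM m) (?L a1 a2 a3 b1 b2 b3 n1 n0))))"
        by (rule H.sweedler3_cong, rule multilinear, rule H.sweedler_sweedler3_swap)
          (assumption | rule multilinear)+
      finally show "?\<delta> (?p (actN h1 n) (actM h2 m)) = sweedler3 H ?W h1 (\<lambda>a1 a2 a3.
          sweedler3 H ?W h2 (\<lambda>b1 b2 b3. sweedler ?W (coactN n) (\<lambda>n1 n0.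
            sweedler ?W (coactM m) (?L a1 a2 a3 b1 b2 b3 n1 n0))))" .
    qed
    also have "\<dots> = sweedler3 H ?W h (\<lambda>h1 h2 h3. sweedler ?W (coactN n) (\<lambda>n1 n0.
        sweedler ?W (coactM m) (\<lambda>m1 m0.
          ?q (h1 \<otimes>\<^bsub>H\<^esub> (n1 \<otimes>\<^bsub>H\<^esub> m1) \<otimes>\<^bsub>H\<^esub> ?S' h3) (?\<alpha> h2 (?p n0 m0)))))"
    \<comment> \<open>The slots a, b, z, p, q of \<open>E\<close> receive the legs 1, 2, then S(h3)
      h4, then 5 and 6. Linearity in each slot, the law for \<open>c\<close> and the rebracketing of
      \<open>?L\<close> are left to the closing method.\<close>
    proof (rule H.sweedler_cancel_tensor[where c = "\<lambda>x y. ?S x \<otimes>\<^bsub>H\<^esub> y"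
          and E = "\<lambda>n1 n0 m1 m0 a b z p q.
            ?q (a \<otimes>\<^bsub>H\<^esub> n1 \<otimes>\<^bsub>H\<^esub> z \<otimes>\<^bsub>H\<^esub> m1 \<otimes>\<^bsub>H\<^esub> ?S' q) (?p (actN b n0) (actM p m0))"])
      fix n1 n0 m1 m0 h1 h2 h3
      assume mem [multilinear]: "n1 \<in> carrier H" "n0 \<in> carrier N" "m1 \<in> carrier H" "m0 \<in> carrier M"
        "h1 \<in> carrier H" "h2 \<in> carrier H" "h3 \<in> carrier H"
      have "?q (h1 \<otimes>\<^bsub>H\<^esub> (n1 \<otimes>\<^bsub>H\<^esub> m1) \<otimes>\<^bsub>H\<^esub> ?S' h3) (?\<alpha> h2 (?p n0 m0)) =
          sweedler ?W (comult H h2) (\<lambda>p q.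
            ?q (h1 \<otimes>\<^bsub>H\<^esub> (n1 \<otimes>\<^bsub>H\<^esub> m1) \<otimes>\<^bsub>H\<^esub> ?S' h3) (?p (actN p n0) (actM q m0)))"
        unfolding tensor_left_act_pure[OF mem(6,2,4)]
        by (rule sweedler_push) (assumption | rule multilinear)+
      \<comment> \<open>A factor 1 is inserted between n1 and m1 to match \<open>E\<close> at z =
        1.\<close>
      then show "?q (h1 \<otimes>\<^bsub>H\<^esub> (n1 \<otimes>\<^bsub>H\<^esub> m1) \<otimes>\<^bsub>H\<^esub> ?S' h3) (?\<alpha> h2 (?p n0 m0)) =
          sweedler ?W (comult H h2) (\<lambda>p q.
            ?q (h1 \<otimes>\<^bsub>H\<^esub> n1 \<otimes>\<^bsub>H\<^esub> \<one>\<^bsub>H\<^esub> \<otimes>\<^bsub>H\<^esub> m1 \<otimes>\<^bsub>H\<^esub> ?S' h3) (?p (actN p n0) (actM q m0)))"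
        using mem by (simp add: H.m_assoc H.antipode_inv_closed)
    qed (assumption | rule multilinear H.antipode_left
        | simp add: H.m_assoc H.antipode_closed H.antipode_inv_closed)+
    also have "\<dots> = sweedler3 H ?W h (\<lambda>h1 h2 h3. sweedler ?W (?\<delta> (?p n m)) (\<lambda>x w.
        ?q (h1 \<otimes>\<^bsub>H\<^esub> x \<otimes>\<^bsub>H\<^esub> ?S' h3) (?\<alpha> h2 w)))"
      by (rule H.sweedler3_cong, rule multilinear, rule sweedler_tensor_coact_pure[symmetric])
        (assumption | rule multilinear)+
    finally show ?thesis .
  qed
  show ?thesis
  proof (intro aYD_left_left.intro aYD_left_left_axioms.intro H.hopf_algebra_axioms
      NM.left_module_axioms NM.left_comodule_axioms)
    fix h t assume [multilinear]: "h \<in> carrier H" and t: "t \<in> carrier ?T"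
    show "?\<delta> (?\<alpha> h t) = sweedler3 H ?W h (\<lambda>h1 h2 h3.
        sweedler ?W (?\<delta> t) (\<lambda>x w. ?q (h1 \<otimes>\<^bsub>H\<^esub> x \<otimes>\<^bsub>H\<^esub> ?S' h3) (?\<alpha> h2 w)))"
      by (rule linear_map_eq_on_tensor[OF _ _ _ _ _ _ t]) (assumption | rule pure multilinear)+
  qed
qed

section \<open>The conditions of the other three types under a bilinear summand\<close>

lemma (in YD_left_right) sweedler_coact_act:
  assumes "hopf_algebra_bij K H"
  assumes [multilinear]: "module K W" "bilinear_map K N H W G" "h \<in> carrier H" "n \<in> carrier N"
  shows "sweedler W (coact (act h n)) G = sweedler3 H W h (\<lambda>h1 h2 h3.
    sweedler W (coact n) (\<lambda>n0 n1. G (act h2 n0) (h3 \<otimes>\<^bsub>H\<^esub> n1 \<otimes>\<^bsub>H\<^esub> antipode_inv H h1)))"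
proof -
  interpret hopf_algebra_bij K H by fact
  show ?thesis
    unfolding YD[OF assms(4,5)] by (rule sweedler_sweedler3_pure) (assumption | rule multilinear)+
qed

lemma (in aYD_left_right) sweedler_coact_act:
  assumes [multilinear]: "module K W" "bilinear_map K M H W G" "h \<in> carrier H" "m \<in> carrier M"
  shows "sweedler W (coact (act h m)) G = sweedler3 H W h (\<lambda>h1 h2 h3.
    sweedler W (coact m) (\<lambda>m0 m1. G (act h2 m0) (h3 \<otimes>\<^bsub>H\<^esub> m1 \<otimes>\<^bsub>H\<^esub> antipode H h1)))"
  unfolding aYD[OF assms(3,4)] by (rule sweedler_sweedler3_pure) (assumption | rule multilinear)+

lemma (in YD_right_left) sweedler_coact_act:
  assumes "hopf_algebra_bij K H"
  assumes [multilinear]: "module K W" "bilinear_map K H N W G" "h \<in> carrier H" "n \<in> carrier N"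
  shows "sweedler W (coact (act n h)) G = sweedler3 H W h (\<lambda>h1 h2 h3.
    sweedler W (coact n) (\<lambda>n1' n0. G (antipode_inv H h3 \<otimes>\<^bsub>H\<^esub> n1' \<otimes>\<^bsub>H\<^esub> h1) (act n0 h2)))"
proof -
  interpret hopf_algebra_bij K H by fact
  show ?thesis
    unfolding YD[OF assms(4,5)] by (rule sweedler_sweedler3_pure) (assumption | rule multilinear)+
qed

lemma (in aYD_right_left) sweedler_coact_act:
  assumes [multilinear]: "module K W" "bilinear_map K H M W G" "h \<in> carrier H" "m \<in> carrier M"
  shows "sweedler W (coact (act m h)) G = sweedler3 H W h (\<lambda>h1 h2 h3.
    sweedler W (coact m) (\<lambda>m1' m0. G (antipode H h3 \<otimes>\<^bsub>H\<^esub> m1' \<otimes>\<^bsub>H\<^esub> h1) (act m0 h2)))"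
  unfolding aYD[OF assms(3,4)] by (rule sweedler_sweedler3_pure) (assumption | rule multilinear)+

lemma (in YD_right_right) sweedler_coact_act:
  assumes [multilinear]: "module K W" "bilinear_map K N H W G" "h \<in> carrier H" "n \<in> carrier N"
  shows "sweedler W (coact (act n h)) G = sweedler3 H W h (\<lambda>h1 h2 h3.
    sweedler W (coact n) (\<lambda>n0 n1. G (act n0 h2) (antipode H h1 \<otimes>\<^bsub>H\<^esub> n1 \<otimes>\<^bsub>H\<^esub> h3)))"
  unfolding YD[OF assms(3,4)] by (rule sweedler_sweedler3_pure) (assumption | rule multilinear)+

lemma (in aYD_right_right) sweedler_coact_act:
  assumes "hopf_algebra_bij K H"
  assumes [multilinear]: "module K W" "bilinear_map K M H W G" "h \<in> carrier H" "m \<in> carrier M"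
  shows "sweedler W (coact (act m h)) G = sweedler3 H W h (\<lambda>h1 h2 h3.
    sweedler W (coact m) (\<lambda>m0 m1. G (act m0 h2) (antipode_inv H h1 \<otimes>\<^bsub>H\<^esub> m1 \<otimes>\<^bsub>H\<^esub> h3)))"
proof -
  interpret hopf_algebra_bij K H by fact
  show ?thesis
    unfolding aYD[OF assms(4,5)] by (rule sweedler_sweedler3_pure) (assumption | rule multilinear)+
qed

section \<open>Compatibility in the left-right type\<close>

lemma aYD_left_right_tensor:
  assumes "hopf_algebra_bij K H" "YD_left_right K H N actN coactN"
    "aYD_left_right K H M actM coactM"
  shows "aYD_left_right K H (tensor K N M) (tensor_left_act_swap K H N M actN actM)
    (tensor_right_coact K H N M coactN coactM)"
proof -
  interpret H: hopf_algebra_bij K H by fact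
  interpret N: YD_left_right K H N actN coactN by fact
  interpret M: aYD_left_right K H M actM coactM by fact
  interpret tensor_left_modules K H N actN M actM ..
  interpret tensor_right_comodules K H N coactN M coactM ..
  let ?T = "tensor K N M"
  let ?W = "tensor K ?T H"
  let ?\<alpha> = "tensor_left_act_swap K H N M actN actM"
  let ?\<delta> = "tensor_right_coact K H N M coactN coactM"
  let ?p = "pure_tensor K N M"
  let ?q = "pure_tensor K ?T H"
  let ?S = "antipode H"
  let ?S' = "antipode_inv H"
  interpret NM: left_module K H ?T ?\<alpha>
    by (rule left_module_tensor_swap)
  interpret NM: right_comodule K H ?T ?\<delta>
    by (rule right_comodule_tensor)
  have pure: "?\<delta> (?\<alpha> h (?p n m)) = sweedler3 H ?W h (\<lambda>h1 h2 h3.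
      sweedler ?W (?\<delta> (?p n m)) (\<lambda>w x. ?q (?\<alpha> h2 w) (h3 \<otimes>\<^bsub>H\<^esub> x \<otimes>\<^bsub>H\<^esub> ?S h1)))"
    if [multilinear]: "h \<in> carrier H" "n \<in> carrier N" "m \<in> carrier M" for h n m
  proof -
    \<comment> \<open>By the swapped action n receives the legs b of h2. The neighbours in the
      middle are S^-1(b1) and a3, the legs 4 and 3 of h.\<close>
    let ?L = "\<lambda>a1 a2 a3 b1 b2 b3 n0 n1 m0 m1.
      ?q (?p (actN b2 n0) (actM a2 m0)) ((b3 \<otimes>\<^bsub>H\<^esub> n1 \<otimes>\<^bsub>H\<^esub> ?S' b1) \<otimes>\<^bsub>H\<^esub> (a3 \<otimes>\<^bsub>H\<^esub> m1 \<otimes>\<^bsub>H\<^esub> ?S a1))"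
    have "?\<delta> (?\<alpha> h (?p n m)) =
        sweedler ?W (comult H h) (\<lambda>h1 h2. ?\<delta> (?p (actN h2 n) (actM h1 m)))"
      unfolding tensor_left_act_swap_pure[OF that]
      by (rule sweedler_push) (assumption | rule multilinear)+
    also have "\<dots> = sweedler ?W (comult H h) (\<lambda>h1 h2. sweedler3 H ?W h1 (\<lambda>a1 a2 a3.
        sweedler3 H ?W h2 (\<lambda>b1 b2 b3. sweedler ?W (coactN n) (\<lambda>n0 n1.
          sweedler ?W (coactM m) (?L a1 a2 a3 b1 b2 b3 n0 n1)))))"
    proof (rule sweedler_cong, (rule multilinear)+)
      fix h1 h2 assume [multilinear]: "h1 \<in> carrier H" "h2 \<in> carrier H"
      have "?\<delta> (?p (actN h2 n) (actM h1 m)) = sweedler ?W (coactN (actN h2 n)) (\<lambda>x0 x1.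
          sweedler ?W (coactM (actM h1 m)) (\<lambda>y0 y1. ?q (?p x0 y0) (x1 \<otimes>\<^bsub>H\<^esub> y1)))"
        by (rule tensor_coact_pure) (rule multilinear)+
      also have "\<dots> = sweedler3 H ?W h2 (\<lambda>b1 b2 b3. sweedler ?W (coactN n) (\<lambda>n0 n1.
          sweedler ?W (coactM (actM h1 m)) (\<lambda>y0 y1.
            ?q (?p (actN b2 n0) y0) ((b3 \<otimes>\<^bsub>H\<^esub> n1 \<otimes>\<^bsub>H\<^esub> ?S' b1) \<otimes>\<^bsub>H\<^esub> y1))))"
        by (rule N.sweedler_coact_act) (assumption | rule assms(1) multilinear)+
      also have "\<dots> = sweedler3 H ?W h2 (\<lambda>b1 b2 b3. sweedler ?W (coactN n) (\<lambda>n0 n1.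
          sweedler3 H ?W h1 (\<lambda>a1 a2 a3. sweedler ?W (coactM m) (?L a1 a2 a3 b1 b2 b3 n0 n1))))"
        by (rule H.sweedler3_cong, rule multilinear, rule sweedler_cong, (rule multilinear)+,
            rule M.sweedler_coact_act) (assumption | rule multilinear)+
      also have "\<dots> = sweedler3 H ?W h2 (\<lambda>b1 b2 b3. sweedler3 H ?W h1 (\<lambda>a1 a2 a3.
          sweedler ?W (coactN n) (\<lambda>n0 n1. sweedler ?W (coactM m) (?L a1 a2 a3 b1 b2 b3 n0 n1))))"
        by (rule H.sweedler3_cong, rule multilinear, rule H.sweedler_sweedler3_swap)
          (assumption | rule multilinear)+
      \<comment> \<open>The coaction of n was expanded first and left the legs of h2 outermost; the
        cancellation expects those of h1 there.\<close>
      also have "\<dots> = sweedler3 H ?W h1 (\<lambda>a1 a2 a3. sweedler3 H ?W h2 (\<lambda>b1 b2 b3.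
          sweedler ?W (coactN n) (\<lambda>n0 n1. sweedler ?W (coactM m) (?L a1 a2 a3 b1 b2 b3 n0 n1))))"
        by (rule H.sweedler3_swap) (assumption | rule multilinear)+
      finally show "?\<delta> (?p (actN h2 n) (actM h1 m)) = sweedler3 H ?W h1 (\<lambda>a1 a2 a3.
        sweedler3 H ?W h2 (\<lambda>b1 b2 b3. sweedler ?W (coactN n) (\<lambda>n0 n1.
          sweedler ?W (coactM m) (?L a1 a2 a3 b1 b2 b3 n0 n1))))" .
    qed
    also have "\<dots> = sweedler3 H ?W h (\<lambda>h1 h2 h3. sweedler ?W (coactN n) (\<lambda>n0 n1.
        sweedler ?W (coactM m) (\<lambda>m0 m1.
          ?q (?\<alpha> h2 (?p n0 m0)) (h3 \<otimes>\<^bsub>H\<^esub> (n1 \<otimes>\<^bsub>H\<^esub> m1) \<otimes>\<^bsub>H\<^esub> ?S h1))))"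
    \<comment> \<open>In \<open>c\<close> the argument x is leg 3 and y is leg 4, hence S^-1(y) x.
      Legs 5 and 6 sit in the slots e and d, on the side of n.\<close>
    proof (rule H.sweedler_cancel_tensor[where c = "\<lambda>x y. ?S' y \<otimes>\<^bsub>H\<^esub> x"
          and E = "\<lambda>n0 n1 m0 m1 a b z e d.
            ?q (?p (actN e n0) (actM b m0)) (d \<otimes>\<^bsub>H\<^esub> n1 \<otimes>\<^bsub>H\<^esub> z \<otimes>\<^bsub>H\<^esub> m1 \<otimes>\<^bsub>H\<^esub> ?S a)"])
      fix n0 n1 m0 m1 h1 h2 h3
      assume mem [multilinear]: "n0 \<in> carrier N" "n1 \<in> carrier H" "m0 \<in> carrier M" "m1 \<in> carrier H"
        "h1 \<in> carrier H" "h2 \<in> carrier H" "h3 \<in> carrier H"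
      have "?q (?\<alpha> h2 (?p n0 m0)) (h3 \<otimes>\<^bsub>H\<^esub> (n1 \<otimes>\<^bsub>H\<^esub> m1) \<otimes>\<^bsub>H\<^esub> ?S h1) =
          sweedler ?W (comult H h2) (\<lambda>p r.
            ?q (?p (actN r n0) (actM p m0)) (h3 \<otimes>\<^bsub>H\<^esub> (n1 \<otimes>\<^bsub>H\<^esub> m1) \<otimes>\<^bsub>H\<^esub> ?S h1))"
        unfolding tensor_left_act_swap_pure[OF mem(6,1,3)]
        by (rule sweedler_push) (assumption | rule multilinear)+
      then show "?q (?\<alpha> h2 (?p n0 m0)) (h3 \<otimes>\<^bsub>H\<^esub> (n1 \<otimes>\<^bsub>H\<^esub> m1) \<otimes>\<^bsub>H\<^esub> ?S h1) =
          sweedler ?W (comult H h2) (\<lambda>p r.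
            ?q (?p (actN r n0) (actM p m0)) (h3 \<otimes>\<^bsub>H\<^esub> n1 \<otimes>\<^bsub>H\<^esub> \<one>\<^bsub>H\<^esub> \<otimes>\<^bsub>H\<^esub> m1 \<otimes>\<^bsub>H\<^esub> ?S h1))"
        using mem by (simp add: H.m_assoc H.antipode_closed H.antipode_inv_closed)
    qed (assumption | rule multilinear H.antipode_inv_left
        | simp add: H.m_assoc H.antipode_closed H.antipode_inv_closed)+
    also have "\<dots> = sweedler3 H ?W h (\<lambda>h1 h2 h3. sweedler ?W (?\<delta> (?p n m)) (\<lambda>w x.
        ?q (?\<alpha> h2 w) (h3 \<otimes>\<^bsub>H\<^esub> x \<otimes>\<^bsub>H\<^esub> ?S h1)))"
      by (rule H.sweedler3_cong, rule multilinear, rule sweedler_tensor_coact_pure[symmetric])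
        (assumption | rule multilinear)+
    finally show ?thesis .
  qed
  show ?thesis
  proof (intro aYD_left_right.intro aYD_left_right_axioms.intro H.hopf_algebra_axioms
      NM.left_module_axioms NM.right_comodule_axioms)
    fix h t assume [multilinear]: "h \<in> carrier H" and t: "t \<in> carrier ?T"
    show "?\<delta> (?\<alpha> h t) = sweedler3 H ?W h (\<lambda>h1 h2 h3.
        sweedler ?W (?\<delta> t) (\<lambda>w x. ?q (?\<alpha> h2 w) (h3 \<otimes>\<^bsub>H\<^esub> x \<otimes>\<^bsub>H\<^esub> ?S h1)))"
      by (rule linear_map_eq_on_tensor[OF _ _ _ _ _ _ t]) (assumption | rule pure multilinear)+
  qed
qed

section \<open>Compatibility in the right-left type\<close>

lemma aYD_right_left_tensor:
  assumes "hopf_algebra_bij K H" "YD_right_left K H N actN coactN"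
    "aYD_right_left K H M actM coactM"
  shows "aYD_right_left K H (tensor K M N) (tensor_right_act_swap K H M N actM actN)
    (tensor_left_coact K H M N coactM coactN)"
proof -
  interpret H: hopf_algebra_bij K H by fact
  interpret N: YD_right_left K H N actN coactN by fact
  interpret M: aYD_right_left K H M actM coactM by fact
  interpret tensor_right_modules K H M actM N actN ..
  interpret tensor_left_comodules K H M coactM N coactN ..
  let ?T = "tensor K M N"
  let ?W = "tensor K H ?T"
  let ?\<alpha> = "tensor_right_act_swap K H M N actM actN"
  let ?\<delta> = "tensor_left_coact K H M N coactM coactN"
  let ?p = "pure_tensor K M N"
  let ?q = "pure_tensor K H ?T"
  let ?S = "antipode H"
  let ?S' = "antipode_inv H"
  interpret MN: right_module K H ?T ?\<alpha>
    by (rule right_module_tensor_swap)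
  interpret MN: left_comodule K H ?T ?\<delta>
    by (rule left_comodule_tensor)
  have pure: "?\<delta> (?\<alpha> (?p m n) h) = sweedler3 H ?W h (\<lambda>h1 h2 h3.
      sweedler ?W (?\<delta> (?p m n)) (\<lambda>x w. ?q (?S h3 \<otimes>\<^bsub>H\<^esub> x \<otimes>\<^bsub>H\<^esub> h1) (?\<alpha> w h2)))"
    if [multilinear]: "h \<in> carrier H" "m \<in> carrier M" "n \<in> carrier N" for h m n
  proof -
    \<comment> \<open>M is the first factor and receives the later legs b; the neighbours are b1 and
      S^-1(a3), that is, h4 S^-1(h3).\<close>
    let ?L = "\<lambda>a1 a2 a3 b1 b2 b3 m1 m0 n1 n0.
      ?q ((?S b3 \<otimes>\<^bsub>H\<^esub> m1 \<otimes>\<^bsub>H\<^esub> b1) \<otimes>\<^bsub>H\<^esub> (?S' a3 \<otimes>\<^bsub>H\<^esub> n1 \<otimes>\<^bsub>H\<^esub> a1)) (?p (actM m0 b2) (actN n0 a2))"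
    have "?\<delta> (?\<alpha> (?p m n) h) =
        sweedler ?W (comult H h) (\<lambda>h1 h2. ?\<delta> (?p (actM m h2) (actN n h1)))"
      unfolding tensor_right_act_swap_pure[OF that]
      by (rule sweedler_push) (assumption | rule multilinear)+
    also have "\<dots> = sweedler ?W (comult H h) (\<lambda>h1 h2. sweedler3 H ?W h1 (\<lambda>a1 a2 a3.
        sweedler3 H ?W h2 (\<lambda>b1 b2 b3. sweedler ?W (coactM m) (\<lambda>m1 m0.
          sweedler ?W (coactN n) (?L a1 a2 a3 b1 b2 b3 m1 m0)))))"
    proof (rule sweedler_cong, (rule multilinear)+)
      fix h1 h2 assume [multilinear]: "h1 \<in> carrier H" "h2 \<in> carrier H"
      have "?\<delta> (?p (actM m h2) (actN n h1)) = sweedler ?W (coactM (actM m h2)) (\<lambda>x1 x0.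
          sweedler ?W (coactN (actN n h1)) (\<lambda>y1 y0. ?q (x1 \<otimes>\<^bsub>H\<^esub> y1) (?p x0 y0)))"
        by (rule tensor_coact_pure) (rule multilinear)+
      also have "\<dots> = sweedler3 H ?W h2 (\<lambda>b1 b2 b3. sweedler ?W (coactM m) (\<lambda>m1 m0.
          sweedler ?W (coactN (actN n h1)) (\<lambda>y1 y0.
            ?q ((?S b3 \<otimes>\<^bsub>H\<^esub> m1 \<otimes>\<^bsub>H\<^esub> b1) \<otimes>\<^bsub>H\<^esub> y1) (?p (actM m0 b2) y0))))"
        by (rule M.sweedler_coact_act) (assumption | rule multilinear)+
      also have "\<dots> = sweedler3 H ?W h2 (\<lambda>b1 b2 b3. sweedler ?W (coactM m) (\<lambda>m1 m0.
          sweedler3 H ?W h1 (\<lambda>a1 a2 a3. sweedler ?W (coactN n) (?L a1 a2 a3 b1 b2 b3 m1 m0))))"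
        by (rule H.sweedler3_cong, rule multilinear, rule sweedler_cong, (rule multilinear)+,
            rule N.sweedler_coact_act) (assumption | rule assms(1) multilinear)+
      also have "\<dots> = sweedler3 H ?W h2 (\<lambda>b1 b2 b3. sweedler3 H ?W h1 (\<lambda>a1 a2 a3.
          sweedler ?W (coactM m) (\<lambda>m1 m0. sweedler ?W (coactN n) (?L a1 a2 a3 b1 b2 b3 m1 m0))))"
        by (rule H.sweedler3_cong, rule multilinear, rule H.sweedler_sweedler3_swap)
          (assumption | rule multilinear)+
      \<comment> \<open>The coaction of m was expanded first, so the legs of h1 have to be brought
        back to the outside.\<close>
      also have "\<dots> = sweedler3 H ?W h1 (\<lambda>a1 a2 a3. sweedler3 H ?W h2 (\<lambda>b1 b2 b3.
          sweedler ?W (coactM m) (\<lambda>m1 m0. sweedler ?W (coactN n) (?L a1 a2 a3 b1 b2 b3 m1 m0))))"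
        by (rule H.sweedler3_swap) (assumption | rule multilinear)+
      finally show "?\<delta> (?p (actM m h2) (actN n h1)) = sweedler3 H ?W h1 (\<lambda>a1 a2 a3.
        sweedler3 H ?W h2 (\<lambda>b1 b2 b3. sweedler ?W (coactM m) (\<lambda>m1 m0.
          sweedler ?W (coactN n) (?L a1 a2 a3 b1 b2 b3 m1 m0))))" .
    qed
    also have "\<dots> = sweedler3 H ?W h (\<lambda>h1 h2 h3. sweedler ?W (coactM m) (\<lambda>m1 m0.
        sweedler ?W (coactN n) (\<lambda>n1 n0.
          ?q (?S h3 \<otimes>\<^bsub>H\<^esub> (m1 \<otimes>\<^bsub>H\<^esub> n1) \<otimes>\<^bsub>H\<^esub> h1) (?\<alpha> (?p m0 n0) h2))))"
    proof (rule H.sweedler_cancel_tensor[where c = "\<lambda>x y. y \<otimes>\<^bsub>H\<^esub> ?S' x"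
          and E = "\<lambda>m1 m0 n1 n0 a b z e d.
            ?q (?S d \<otimes>\<^bsub>H\<^esub> m1 \<otimes>\<^bsub>H\<^esub> z \<otimes>\<^bsub>H\<^esub> n1 \<otimes>\<^bsub>H\<^esub> a) (?p (actM m0 e) (actN n0 b))"])
      fix m1 m0 n1 n0 h1 h2 h3
      assume mem [multilinear]: "m1 \<in> carrier H" "m0 \<in> carrier M" "n1 \<in> carrier H" "n0 \<in> carrier N"
        "h1 \<in> carrier H" "h2 \<in> carrier H" "h3 \<in> carrier H"
      have "?q (?S h3 \<otimes>\<^bsub>H\<^esub> (m1 \<otimes>\<^bsub>H\<^esub> n1) \<otimes>\<^bsub>H\<^esub> h1) (?\<alpha> (?p m0 n0) h2) =
          sweedler ?W (comult H h2) (\<lambda>p r.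
            ?q (?S h3 \<otimes>\<^bsub>H\<^esub> (m1 \<otimes>\<^bsub>H\<^esub> n1) \<otimes>\<^bsub>H\<^esub> h1) (?p (actM m0 r) (actN n0 p)))"
        unfolding tensor_right_act_swap_pure[OF mem(6,2,4)]
        by (rule sweedler_push) (assumption | rule multilinear)+
      then show "?q (?S h3 \<otimes>\<^bsub>H\<^esub> (m1 \<otimes>\<^bsub>H\<^esub> n1) \<otimes>\<^bsub>H\<^esub> h1) (?\<alpha> (?p m0 n0) h2) =
          sweedler ?W (comult H h2) (\<lambda>p r.
            ?q (?S h3 \<otimes>\<^bsub>H\<^esub> m1 \<otimes>\<^bsub>H\<^esub> \<one>\<^bsub>H\<^esub> \<otimes>\<^bsub>H\<^esub> n1 \<otimes>\<^bsub>H\<^esub> h1) (?p (actM m0 r) (actN n0 p)))"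
        using mem by (simp add: H.m_assoc H.antipode_closed H.antipode_inv_closed)
    qed (assumption | rule multilinear H.antipode_inv_right
        | simp add: H.m_assoc H.antipode_closed H.antipode_inv_closed)+
    also have "\<dots> = sweedler3 H ?W h (\<lambda>h1 h2 h3. sweedler ?W (?\<delta> (?p m n)) (\<lambda>x w.
        ?q (?S h3 \<otimes>\<^bsub>H\<^esub> x \<otimes>\<^bsub>H\<^esub> h1) (?\<alpha> w h2)))"
      by (rule H.sweedler3_cong, rule multilinear, rule sweedler_tensor_coact_pure[symmetric])
        (assumption | rule multilinear)+
    finally show ?thesis .
  qed
  show ?thesis
  proof (intro aYD_right_left.intro aYD_right_left_axioms.intro H.hopf_algebra_axioms
      MN.right_module_axioms MN.left_comodule_axioms)
    fix h t assume [multilinear]: "h \<in> carrier H" and t: "t \<in> carrier ?T"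
    show "?\<delta> (?\<alpha> t h) = sweedler3 H ?W h (\<lambda>h1 h2 h3.
        sweedler ?W (?\<delta> t) (\<lambda>x w. ?q (?S h3 \<otimes>\<^bsub>H\<^esub> x \<otimes>\<^bsub>H\<^esub> h1) (?\<alpha> w h2)))"
      by (rule linear_map_eq_on_tensor[OF _ _ _ _ _ _ t]) (assumption | rule pure multilinear)+
  qed
qed

section \<open>Compatibility in the right-right type\<close>

lemma aYD_right_right_tensor:
  assumes "hopf_algebra_bij K H" "YD_right_right K H N actN coactN"
    "aYD_right_right K H M actM coactM"
  shows "aYD_right_right K H (tensor K M N) (tensor_right_act K H M N actM actN)
    (tensor_right_coact K H M N coactM coactN)"
proof -
  interpret H: hopf_algebra_bij K H by fact
  interpret N: YD_right_right K H N actN coactN by fact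
  interpret M: aYD_right_right K H M actM coactM by fact
  interpret tensor_right_modules K H M actM N actN ..
  interpret tensor_right_comodules K H M coactM N coactN ..
  let ?T = "tensor K M N"
  let ?W = "tensor K ?T H"
  let ?\<alpha> = "tensor_right_act K H M N actM actN"
  let ?\<delta> = "tensor_right_coact K H M N coactM coactN"
  let ?p = "pure_tensor K M N"
  let ?q = "pure_tensor K ?T H"
  let ?S = "antipode H"
  let ?S' = "antipode_inv H"
  interpret MN: right_module K H ?T ?\<alpha>
    by (rule right_module_tensor)
  interpret MN: right_comodule K H ?T ?\<delta>
    by (rule right_comodule_tensor)
  have pure: "?\<delta> (?\<alpha> (?p m n) h) = sweedler3 H ?W h (\<lambda>h1 h2 h3.
      sweedler ?W (?\<delta> (?p m n)) (\<lambda>w x. ?q (?\<alpha> w h2) (?S' h1 \<otimes>\<^bsub>H\<^esub> x \<otimes>\<^bsub>H\<^esub> h3)))"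
    if [multilinear]: "h \<in> carrier H" "m \<in> carrier M" "n \<in> carrier N" for h m n
  proof -
    \<comment> \<open>M is the first factor and receives the earlier legs a: its last leg a3 meets
      S(b1) from n, while S^-1(a1) stays at the outer left end.\<close>
    let ?L = "\<lambda>a1 a2 a3 b1 b2 b3 m0 m1 n0 n1.
      ?q (?p (actM m0 a2) (actN n0 b2)) ((?S' a1 \<otimes>\<^bsub>H\<^esub> m1 \<otimes>\<^bsub>H\<^esub> a3) \<otimes>\<^bsub>H\<^esub> (?S b1 \<otimes>\<^bsub>H\<^esub> n1 \<otimes>\<^bsub>H\<^esub> b3))"
    have "?\<delta> (?\<alpha> (?p m n) h) =
        sweedler ?W (comult H h) (\<lambda>h1 h2. ?\<delta> (?p (actM m h1) (actN n h2)))"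
      unfolding tensor_right_act_pure[OF that]
      by (rule sweedler_push) (assumption | rule multilinear)+
    also have "\<dots> = sweedler ?W (comult H h) (\<lambda>h1 h2. sweedler3 H ?W h1 (\<lambda>a1 a2 a3.
        sweedler3 H ?W h2 (\<lambda>b1 b2 b3. sweedler ?W (coactM m) (\<lambda>m0 m1.
          sweedler ?W (coactN n) (?L a1 a2 a3 b1 b2 b3 m0 m1)))))"
    proof (rule sweedler_cong, (rule multilinear)+)
      fix h1 h2 assume [multilinear]: "h1 \<in> carrier H" "h2 \<in> carrier H"
      have "?\<delta> (?p (actM m h1) (actN n h2)) = sweedler ?W (coactM (actM m h1)) (\<lambda>x0 x1.
          sweedler ?W (coactN (actN n h2)) (\<lambda>y0 y1. ?q (?p x0 y0) (x1 \<otimes>\<^bsub>H\<^esub> y1)))"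
        by (rule tensor_coact_pure) (rule multilinear)+
      also have "\<dots> = sweedler3 H ?W h1 (\<lambda>a1 a2 a3. sweedler ?W (coactM m) (\<lambda>m0 m1.
          sweedler ?W (coactN (actN n h2)) (\<lambda>y0 y1.
            ?q (?p (actM m0 a2) y0) ((?S' a1 \<otimes>\<^bsub>H\<^esub> m1 \<otimes>\<^bsub>H\<^esub> a3) \<otimes>\<^bsub>H\<^esub> y1))))"
        by (rule M.sweedler_coact_act) (assumption | rule assms(1) multilinear)+
      also have "\<dots> = sweedler3 H ?W h1 (\<lambda>a1 a2 a3. sweedler ?W (coactM m) (\<lambda>m0 m1.
          sweedler3 H ?W h2 (\<lambda>b1 b2 b3. sweedler ?W (coactN n) (?L a1 a2 a3 b1 b2 b3 m0 m1))))"
        by (rule H.sweedler3_cong, rule multilinear, rule sweedler_cong, (rule multilinear)+,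
            rule N.sweedler_coact_act) (assumption | rule multilinear)+
      also have "\<dots> = sweedler3 H ?W h1 (\<lambda>a1 a2 a3. sweedler3 H ?W h2 (\<lambda>b1 b2 b3.
          sweedler ?W (coactM m) (\<lambda>m0 m1. sweedler ?W (coactN n) (?L a1 a2 a3 b1 b2 b3 m0 m1))))"
        by (rule H.sweedler3_cong, rule multilinear, rule H.sweedler_sweedler3_swap)
          (assumption | rule multilinear)+
      finally show "?\<delta> (?p (actM m h1) (actN n h2)) = sweedler3 H ?W h1 (\<lambda>a1 a2 a3.
        sweedler3 H ?W h2 (\<lambda>b1 b2 b3. sweedler ?W (coactM m) (\<lambda>m0 m1.
          sweedler ?W (coactN n) (?L a1 a2 a3 b1 b2 b3 m0 m1))))" .
    qed
    also have "\<dots> = sweedler3 H ?W h (\<lambda>h1 h2 h3. sweedler ?W (coactM m) (\<lambda>m0 m1.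
        sweedler ?W (coactN n) (\<lambda>n0 n1.
          ?q (?\<alpha> (?p m0 n0) h2) (?S' h1 \<otimes>\<^bsub>H\<^esub> (m1 \<otimes>\<^bsub>H\<^esub> n1) \<otimes>\<^bsub>H\<^esub> h3))))"
    proof (rule H.sweedler_cancel_tensor[where c = "\<lambda>x y. x \<otimes>\<^bsub>H\<^esub> ?S y"
          and E = "\<lambda>m0 m1 n0 n1 a b z e d.
            ?q (?p (actM m0 b) (actN n0 e)) (?S' a \<otimes>\<^bsub>H\<^esub> m1 \<otimes>\<^bsub>H\<^esub> z \<otimes>\<^bsub>H\<^esub> n1 \<otimes>\<^bsub>H\<^esub> d)"])
      fix m0 m1 n0 n1 h1 h2 h3
      assume mem [multilinear]: "m0 \<in> carrier M" "m1 \<in> carrier H" "n0 \<in> carrier N" "n1 \<in> carrier H"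
        "h1 \<in> carrier H" "h2 \<in> carrier H" "h3 \<in> carrier H"
      have "?q (?\<alpha> (?p m0 n0) h2) (?S' h1 \<otimes>\<^bsub>H\<^esub> (m1 \<otimes>\<^bsub>H\<^esub> n1) \<otimes>\<^bsub>H\<^esub> h3) =
          sweedler ?W (comult H h2) (\<lambda>p r.
            ?q (?p (actM m0 p) (actN n0 r)) (?S' h1 \<otimes>\<^bsub>H\<^esub> (m1 \<otimes>\<^bsub>H\<^esub> n1) \<otimes>\<^bsub>H\<^esub> h3))"
        unfolding tensor_right_act_pure[OF mem(6,1,3)]
        by (rule sweedler_push) (assumption | rule multilinear)+
      then show "?q (?\<alpha> (?p m0 n0) h2) (?S' h1 \<otimes>\<^bsub>H\<^esub> (m1 \<otimes>\<^bsub>H\<^esub> n1) \<otimes>\<^bsub>H\<^esub> h3) =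
          sweedler ?W (comult H h2) (\<lambda>p r.
            ?q (?p (actM m0 p) (actN n0 r)) (?S' h1 \<otimes>\<^bsub>H\<^esub> m1 \<otimes>\<^bsub>H\<^esub> \<one>\<^bsub>H\<^esub> \<otimes>\<^bsub>H\<^esub> n1 \<otimes>\<^bsub>H\<^esub> h3))"
        using mem by (simp add: H.m_assoc H.antipode_closed H.antipode_inv_closed)
    qed (assumption | rule multilinear H.antipode_right
        | simp add: H.m_assoc H.antipode_closed H.antipode_inv_closed)+
    also have "\<dots> = sweedler3 H ?W h (\<lambda>h1 h2 h3. sweedler ?W (?\<delta> (?p m n)) (\<lambda>w x.
        ?q (?\<alpha> w h2) (?S' h1 \<otimes>\<^bsub>H\<^esub> x \<otimes>\<^bsub>H\<^esub> h3)))"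
      by (rule H.sweedler3_cong, rule multilinear, rule sweedler_tensor_coact_pure[symmetric])
        (assumption | rule multilinear)+
    finally show ?thesis .
  qed
  show ?thesis
  proof (intro aYD_right_right.intro aYD_right_right_axioms.intro H.hopf_algebra_axioms
      MN.right_module_axioms MN.right_comodule_axioms)
    fix h t assume [multilinear]: "h \<in> carrier H" and t: "t \<in> carrier ?T"
    show "?\<delta> (?\<alpha> t h) = sweedler3 H ?W h (\<lambda>h1 h2 h3.
        sweedler ?W (?\<delta> t) (\<lambda>w x. ?q (?\<alpha> w h2) (?S' h1 \<otimes>\<^bsub>H\<^esub> x \<otimes>\<^bsub>H\<^esub> h3)))"
      by (rule linear_map_eq_on_tensor[OF _ _ _ _ _ _ t]) (assumption | rule pure multilinear)+
  qed
qed

theorem lemma2p3: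
  fixes K :: "'k ring" and H :: "('k, 'h) hopf"
    and N :: "('k, 'n) module" and M :: "('k, 'm) module"
    and lactN :: "'h \<Rightarrow> 'n \<Rightarrow> 'n" and lactM :: "'h \<Rightarrow> 'm \<Rightarrow> 'm"
    and ractN :: "'n \<Rightarrow> 'h \<Rightarrow> 'n" and ractM :: "'m \<Rightarrow> 'h \<Rightarrow> 'm"
    and lcoactN :: "'n \<Rightarrow> ('h, 'n) tens" and lcoactM :: "'m \<Rightarrow> ('h, 'm) tens"
    and rcoactN :: "'n \<Rightarrow> ('n, 'h) tens" and rcoactM :: "'m \<Rightarrow> ('m, 'h) tens"
  assumes "field K"
    and "hopf_algebra K H"
    and "bij_betw (antipode H) (carrier H) (carrier H)"
  shows
    "(YD_left_left K H N lactN lcoactN \<and> aYD_left_left K H M lactM lcoactM \<longrightarrow>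
        aYD_left_left K H (tensor K N M)
          (tensor_left_act K H N M lactN lactM)
          (tensor_left_coact K H N M lcoactN lcoactM)) \<and>
     (YD_left_right K H N lactN rcoactN \<and> aYD_left_right K H M lactM rcoactM \<longrightarrow>
        aYD_left_right K H (tensor K N M)
          (tensor_left_act_swap K H N M lactN lactM)
          (tensor_right_coact K H N M rcoactN rcoactM)) \<and>
     (YD_right_left K H N ractN lcoactN \<and> aYD_right_left K H M ractM lcoactM \<longrightarrow>
        aYD_right_left K H (tensor K M N)
          (tensor_right_act_swap K H M N ractM ractN)
          (tensor_left_coact K H M N lcoactM lcoactN)) \<and>
     (YD_right_right K H N ractN rcoactN \<and> aYD_right_right K H M ractM rcoactM \<longrightarrow>
        aYD_right_right K H (tensor K M N)
          (tensor_right_act K H M N ractM ractN)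
          (tensor_right_coact K H M N rcoactM rcoactN))"
proof -
  have H: "hopf_algebra_bij K H"
    using assms(2,3) by (simp add: hopf_algebra_bij_def hopf_algebra_bij_axioms_def)
  show ?thesis
    by (intro conjI impI; elim conjE)
      (rule aYD_left_left_tensor[OF H] aYD_left_right_tensor[OF H]
        aYD_right_left_tensor[OF H] aYD_right_right_tensor[OF H]; assumption)+
qed

end
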